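(* Let $n\ge 1$ and $\mathbf d=(d_1,\ldots,d_n)$ be a tuple of positive integers, and let $\mathcal H=V(f)\subset\mathbb{C}^n$ be a generic hypersurface through $\mathbf 0$. Then the number of $\mathbf d$-osculants of $\mathcal H$ is equal to the number of primitive $\mathbf d$-necklaces.
   Context: Write $|\mathbf d|=d_1+\cdots+d_n$. A $\mathbf d$-parametrization is a polynomial map $\mathbf x(t)=(x_1(t),\ldots,x_n(t)):\mathbb{C}\to\mathbb{C}^n$ with $x_i\in\mathbb{C}[t]$ of degree $d_i$ and $\mathbf x(0)=\mathbf 0$; it is $k$-fold if it is generically $k$-to-one onto its image. For $f\in\mathbb{C}[x_1,\ldots,x_n]$ with $f(\mathbf 0)=0$, a parametrization $\mathbf x(t)$ approximates $\mathcal H=V(f)$ at $\mathbf 0$ to order $\gamma$ if $f(\mathbf x(t))\equiv 0 \pmod{t^\gamma}$. A $\mathbf d$-osculant of $\mathcal H$ is a curve $\mathbf x(\mathbb{C})\subset\mathbb{C}^n$ which is the image of a $1$-fold $\mathbf d$-parametrization approximating $\mathcal H$ to order $|\mathbf d|$; osculants are counted as distinct curves (two parametrizations with the same image give the same osculant). Only the coefficients of $f$ on monomials of total degree at most $|\mathbf d|$ affect this condition; "generic" means that this (projectivized) coefficient vector of $f$ lies in a dense Zariski open subset of the space of such coefficient vectors. A $\mathbf d$-necklace is a circular arrangement of $|\mathbf d|$ beads, $d_i$ of them of color $i$, considered up to cyclic rotation; it is primitive if its orbit under rotation has exactly $|\mathbf d|$ elements. *)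

theory Defs
  imports "HOL-Computational_Algebra.Polynomial"
begin

(* Points/vectors of C^n are functions nat => complex, only indices < n matter.
   Exponent vectors of monomials in x_0..x_{n-1}: functions nat => nat supported in {..<n}. *)

definition dsum :: "nat \<Rightarrow> (nat \<Rightarrow> nat) \<Rightarrow> nat" where
  "dsum n d = (\<Sum>i<n. d i)"

(* monomials of total degree between 1 and D (constant term excluded since f(0)=0) *)
definition mons :: "nat \<Rightarrow> nat \<Rightarrow> (nat \<Rightarrow> nat) set" where
  "mons n D = {\<alpha>. (\<forall>i\<ge>n. \<alpha> i = 0) \<and> 1 \<le> (\<Sum>i<n. \<alpha> i) \<and> (\<Sum>i<n. \<alpha> i) \<le> D}"

(* f(x(t)) as a univariate polynomial in t, where f has coefficient c \<alpha> on monomial x^\<alpha> *)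
definition fcomp :: "nat \<Rightarrow> nat \<Rightarrow> ((nat \<Rightarrow> nat) \<Rightarrow> complex) \<Rightarrow> (nat \<Rightarrow> complex poly) \<Rightarrow> complex poly" where
  "fcomp n D c x = (\<Sum>\<alpha>\<in>mons n D. smult (c \<alpha>) (\<Prod>i<n. x i ^ \<alpha> i))"

definition approximates :: "nat \<Rightarrow> nat \<Rightarrow> ((nat \<Rightarrow> nat) \<Rightarrow> complex) \<Rightarrow> (nat \<Rightarrow> complex poly) \<Rightarrow> nat \<Rightarrow> bool" where
  "approximates n D c x \<gamma> \<longleftrightarrow> [:0, 1:] ^ \<gamma> dvd fcomp n D c x"

definition param :: "nat \<Rightarrow> (nat \<Rightarrow> complex poly) \<Rightarrow> complex \<Rightarrow> (nat \<Rightarrow> complex)" where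
  "param n x t = (\<lambda>i. if i < n then poly (x i) t else 0)"

definition d_param :: "nat \<Rightarrow> (nat \<Rightarrow> nat) \<Rightarrow> (nat \<Rightarrow> complex poly) \<Rightarrow> bool" where
  "d_param n d x \<longleftrightarrow> (\<forall>i<n. degree (x i) = d i \<and> poly (x i) 0 = 0)"

(* 1-fold: generically one-to-one onto its image, i.e. only finitely many parameter
   values share their image point with another parameter value *)
definition one_fold :: "nat \<Rightarrow> (nat \<Rightarrow> complex poly) \<Rightarrow> bool" where
  "one_fold n x \<longleftrightarrow> finite {t. \<exists>s. s \<noteq> t \<and> param n x s = param n x t}"

definition osculants :: "nat \<Rightarrow> (nat \<Rightarrow> nat) \<Rightarrow> ((nat \<Rightarrow> nat) \<Rightarrow> complex) \<Rightarrow> (nat \<Rightarrow> complex) set set" where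
  "osculants n d c = {range (param n x) | x. d_param n d x \<and> one_fold n x \<and>
      approximates n (dsum n d) c x (dsum n d)}"

definition d_words :: "nat \<Rightarrow> (nat \<Rightarrow> nat) \<Rightarrow> nat list set" where
  "d_words n d = {w. set w \<subseteq> {..<n} \<and> (\<forall>i<n. count_list w i = d i)}"

definition necklaces :: "nat \<Rightarrow> (nat \<Rightarrow> nat) \<Rightarrow> nat list set set" where
  "necklaces n d = {{rotate k w | k. True} | w. w \<in> d_words n d}"

definition primitive_necklaces :: "nat \<Rightarrow> (nat \<Rightarrow> nat) \<Rightarrow> nat list set set" where
  "primitive_necklaces n d = {N \<in> necklaces n d. card N = dsum n d}"

(* polynomial functions in the variables c_j, j \<in> I (I finite) *)
definition poly_fun :: "'i set \<Rightarrow> (('i \<Rightarrow> complex) \<Rightarrow> complex) \<Rightarrow> bool" where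
  "poly_fun I g \<longleftrightarrow> (\<exists>A a. finite A \<and>
      g = (\<lambda>c. \<Sum>e\<in>A. a e * (\<Prod>j\<in>I. c j ^ e j)))"

end

theory Submission
  imports Defs "HOL-Analysis.Analysis" "HOL-Computational_Algebra.Fundamental_Theorem_Algebra"
begin

text \<open>
  For the hypersurface \<open>(1 + x\<^sub>1) \<cdots> (1 + x\<^sub>n) = 1\<close> the approximation condition says that
  \<open>(1 + x\<^sub>1(t)) \<cdots> (1 + x\<^sub>n(t)) = 1 + a t\<^sup>D\<close>, since the left side has degree at most
  \<open>D = |d|\<close>. After rescaling \<open>t\<close> we may take \<open>a = -1\<close>, and the solutions are the ways to
  distribute the \<open>D\<close>-th roots of unity over the factors, i.e. the words with letter counts
  \<open>d\<close>; multiplying \<open>t\<close> by a root of unity rotates the word. So the osculants of this model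
  correspond to the primitive necklaces.

  The roots of unity are distinct, hence these solutions are nondegenerate, and there are none at
  infinity; a compactness argument shows that the count is the same for all coefficient vectors in
  a Euclidean neighbourhood of the model. Finally, the set of coefficient vectors with the right
  count is constructible by elimination of quantifiers over the complex numbers, and a
  constructible set is either generically true or generically false, so the neighbourhood
  forces the former.
\<close>

hide_const (open) Old_Datatype.dsum \<comment> \<open>it would shadow the \<open>dsum\<close> of the statement\<close>

section \<open>Polynomial functions and constructible predicates\<close>

text \<open>Coordinate \<open>i\<close> contributes \<open>d i\<close> coefficients, so there are
  \<open>D\<close> unknowns, and prescribing the coefficients of \<open>f(x(t))\<close> at
  \<open>t^1, ..., t^D\<close> gives \<open>D\<close> equations. Prescribing the last one as -1
  fixes the scaling of \<open>t\<close> up to \<open>D\<close>-th roots of unity. The objects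
  counted are images of generically injective maps, not solutions. So near the model a solution has
  to be one-to-one exactly when its word is primitive, and two solutions have to share their image
  exactly when their words are rotations of each other. One half of each claim follows from
  equivariance under roots of unity, which local uniqueness forces; the other half is a limit
  argument. The linearised equation is invertible because evaluation at the distinct roots of unity
  decouples its unknowns. Nothing escapes to infinity because polynomial factors of 1 are constant,
  and rescaling \<open>t\<close> carries a bound on the unit sphere to tuples of all sizes.
  Osculants are defined with quantifiers over parameter values (generic injectivity, equality of
  images), so their number is not visibly algebraic in the coefficients; hence the quantifier
  elimination.\<close>

inductive polyfun :: "'v set \<Rightarrow> (('v \<Rightarrow> complex) \<Rightarrow> complex) \<Rightarrow> bool" for V where
  const: "polyfun V (\<lambda>_. c)"
| var: "v \<in> V \<Longrightarrow> polyfun V (\<lambda>e. e v)"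
| add: "polyfun V p \<Longrightarrow> polyfun V q \<Longrightarrow> polyfun V (\<lambda>e. p e + q e)"
| mult: "polyfun V p \<Longrightarrow> polyfun V q \<Longrightarrow> polyfun V (\<lambda>e. p e * q e)"

text \<open>Only Boolean combinations of equations are generated; closure under quantifiers and
  under finiteness is proved below. Elimination runs over all variables, \<open>UNIV\<close>, and a
  substitution returns to the finite set \<open>mons n D\<close> at the end.\<close>

inductive constructible :: "'v set \<Rightarrow> (('v \<Rightarrow> complex) \<Rightarrow> bool) \<Rightarrow> bool" for V where
  zero: "polyfun V p \<Longrightarrow> constructible V (\<lambda>e. p e = 0)"
| neg: "constructible V P \<Longrightarrow> constructible V (\<lambda>e. \<not> P e)"
| conj: "constructible V P \<Longrightarrow> constructible V Q \<Longrightarrow> constructible V (\<lambda>e. P e \<and> Q e)"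

lemma polyfun_diff: "polyfun V p \<Longrightarrow> polyfun V q \<Longrightarrow> polyfun V (\<lambda>e. p e - q e)"
  using polyfun.add[of V p "\<lambda>e. (- 1) * q e"] polyfun.mult[OF polyfun.const, of V q "-1"] by simp

lemma polyfun_sum: "(\<And>i. i \<in> A \<Longrightarrow> polyfun V (p i)) \<Longrightarrow> polyfun V (\<lambda>e. \<Sum>i\<in>A. p i e)"
  by (induction A rule: infinite_finite_induct) (auto intro: polyfun.intros)

lemma polyfun_power: "polyfun V p \<Longrightarrow> polyfun V (\<lambda>e. p e ^ k)"
  by (induction k) (auto intro: polyfun.intros)

lemma polyfun_subst:
  assumes "polyfun V p" "\<And>v. v \<in> V \<Longrightarrow> polyfun W (\<lambda>e. s e v)"
  shows "polyfun W (\<lambda>e. p (s e))"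
  using assms(1) by induction (auto intro: polyfun.intros assms(2))

lemma constructible_subst:
  assumes "constructible V P" "\<And>v. v \<in> V \<Longrightarrow> polyfun W (\<lambda>e. s e v)"
  shows "constructible W (\<lambda>e. P (s e))"
  using assms(1) by induction (auto intro: constructible.intros polyfun_subst[OF _ assms(2)])

lemma constructible_eq:
  "polyfun V p \<Longrightarrow> polyfun V q \<Longrightarrow> constructible V (\<lambda>e. p e = q e)"
  using constructible.zero[OF polyfun_diff, of V p q] by simp

lemma constructible_disj:
  "constructible V P \<Longrightarrow> constructible V Q \<Longrightarrow> constructible V (\<lambda>e. P e \<or> Q e)"
  using constructible.neg[OF constructible.conj[OF constructible.neg constructible.neg], of V P Q]
  by simp

lemma constructible_const: "constructible V (\<lambda>_. b)"
  using constructible.zero[OF polyfun.const, of V 0] constructible.zero[OF polyfun.const, of V 1]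
  by (cases b) auto

lemma constructible_all_finite:
  "finite A \<Longrightarrow> (\<And>i. i \<in> A \<Longrightarrow> constructible V (P i)) \<Longrightarrow> constructible V (\<lambda>e. \<forall>i\<in>A. P i e)"
  by (induction A rule: finite_induct) (auto intro: constructible_const constructible.conj)

lemma constructible_ex_finite:
  "finite A \<Longrightarrow> (\<And>i. i \<in> A \<Longrightarrow> constructible V (P i)) \<Longrightarrow> constructible V (\<lambda>e. \<exists>i\<in>A. P i e)"
  by (induction A rule: finite_induct) (auto intro: constructible_const constructible_disj)

text \<open>Restriction to the line through \<open>u\<close> and \<open>w\<close> reduces
  nonvanishing in many, possibly infinitely many, variables to the finiteness of the roots of one
  univariate polynomial.\<close>

lemma polyfun_on_line:
  assumes "polyfun V p"
  shows "\<exists>r. \<forall>s. p (\<lambda>v. u v + s * (w v - u v)) = poly r s"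
  using assms
proof induction
  case (const c)
  show ?case by (rule exI[of _ "[:c:]"]) simp
next
  case (var v)
  show ?case by (rule exI[of _ "[:u v, w v - u v:]"]) (simp add: algebra_simps)
next
  case (add p q)
  then obtain r1 r2 where "\<forall>s. p (\<lambda>v. u v + s * (w v - u v)) = poly r1 s"
    "\<forall>s. q (\<lambda>v. u v + s * (w v - u v)) = poly r2 s" by blast
  then show ?case by (intro exI[of _ "r1 + r2"]) simp
next
  case (mult p q)
  then obtain r1 r2 where "\<forall>s. p (\<lambda>v. u v + s * (w v - u v)) = poly r1 s"
    "\<forall>s. q (\<lambda>v. u v + s * (w v - u v)) = poly r2 s" by blast
  then show ?case by (intro exI[of _ "r1 * r2"]) simp
qed

text \<open>On the line joining the two points both functions restrict to nonzero univariate
  polynomials, so their product is nonzero there.\<close>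

lemma polyfun_mult_nonzero:
  assumes "polyfun V p" "polyfun V q" "p u \<noteq> 0" "q w \<noteq> 0"
  shows "\<exists>e. p e * q e \<noteq> 0"
proof -
  obtain r1 where r1: "\<And>s. p (\<lambda>v. u v + s * (w v - u v)) = poly r1 s"
    using polyfun_on_line[OF assms(1)] by blast
  obtain r2 where r2: "\<And>s. q (\<lambda>v. u v + s * (w v - u v)) = poly r2 s"
    using polyfun_on_line[OF assms(2)] by blast
  have "r1 \<noteq> 0" using r1[of 0] assms(3) by auto
  moreover have "r2 \<noteq> 0" using r2[of 1] assms(4) by auto
  ultimately have "r1 * r2 \<noteq> 0" by simp
  then obtain s where "poly (r1 * r2) s \<noteq> 0" using poly_all_0_iff_0 by blast
  then show ?thesis
    using r1[of s] r2[of s] by (intro exI[of _ "\<lambda>v. u v + s * (w v - u v)"]) simp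
qed

text \<open>An equation \<open>p e = 0\<close> is generically false unless \<open>p\<close> vanishes
  identically, in which case \<open>g = 1\<close> serves. Negation swaps the alternatives, and a
  conjunction multiplies the two witnesses.\<close>

lemma constructible_generic_cases:
  assumes "constructible V P"
  shows "\<exists>g. polyfun V g \<and> (\<exists>e. g e \<noteq> 0) \<and>
    ((\<forall>e. g e \<noteq> 0 \<longrightarrow> P e) \<or> (\<forall>e. g e \<noteq> 0 \<longrightarrow> \<not> P e))"
  using assms
proof induction
  case (zero p)
  show ?case
  proof (cases "\<exists>e. p e \<noteq> 0")
    case True
    with zero show ?thesis by blast
  next
    case False
    then show ?thesis by (intro exI[of _ "\<lambda>_. 1"]) (auto intro: polyfun.const)
  qed
next
  case (neg P)
  then show ?case by blast
next
  case (conj P Q)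
  then obtain g u h w where gh: "polyfun V g" "g u \<noteq> 0" "polyfun V h" "h w \<noteq> 0"
    and P: "(\<forall>e. g e \<noteq> 0 \<longrightarrow> P e) \<or> (\<forall>e. g e \<noteq> 0 \<longrightarrow> \<not> P e)"
    and Q: "(\<forall>e. h e \<noteq> 0 \<longrightarrow> Q e) \<or> (\<forall>e. h e \<noteq> 0 \<longrightarrow> \<not> Q e)"
    by blast
  show ?case
  proof (intro exI[of _ "\<lambda>e. g e * h e"] conjI)
    show "polyfun V (\<lambda>e. g e * h e)" by (intro polyfun.mult gh)
    show "\<exists>e. g e * h e \<noteq> 0" using gh polyfun_mult_nonzero by blast
    show "(\<forall>e. g e * h e \<noteq> 0 \<longrightarrow> P e \<and> Q e) \<or> (\<forall>e. g e * h e \<noteq> 0 \<longrightarrow> \<not> (P e \<and> Q e))"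
      using P Q by auto
  qed
qed

text \<open>A nonempty Zariski open set meets every Euclidean ball: on the line from the centre
  \<open>e0\<close> to a point with \<open>g u\<close> nonzero, \<open>g\<close> has finitely many
  zeros. Hence truth on a ball excludes the alternative that \<open>P\<close> is generically
  false.\<close>

lemma constructible_generic_if_near:
  assumes P: "constructible V P" and "\<epsilon> > 0" "finite V"
    and near: "\<And>e. (\<forall>v\<in>V. cmod (e v - e0 v) < \<epsilon>) \<Longrightarrow> P e"
  shows "\<exists>g. polyfun V g \<and> (\<exists>e. g e \<noteq> 0) \<and> (\<forall>e. g e \<noteq> 0 \<longrightarrow> P e)"
proof -
  obtain g u where g: "polyfun V g" "g u \<noteq> 0"
    and cases: "(\<forall>e. g e \<noteq> 0 \<longrightarrow> P e) \<or> (\<forall>e. g e \<noteq> 0 \<longrightarrow> \<not> P e)"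
    using constructible_generic_cases[OF P] by blast
  obtain r where r: "\<And>s. g (\<lambda>v. e0 v + s * (u v - e0 v)) = poly r s"
    using polyfun_on_line[OF g(1)] by blast
  have "r \<noteq> 0" using r[of 1] g(2) by auto
  then have "finite {s. poly r s = 0}" by (rule poly_roots_finite)
  then have "\<forall>\<^sub>F s in at 0. s \<notin> {s. poly r s = 0}"
    using islimpt_finite islimpt_iff_eventually by blast
  moreover have "\<forall>\<^sub>F s in at 0. \<forall>v\<in>V. cmod ((e0 v + s * (u v - e0 v)) - e0 v) < \<epsilon>"
  proof (intro eventually_ball_finite \<open>finite V\<close> ballI)
    fix v
    have "((\<lambda>s. cmod ((e0 v + s * (u v - e0 v)) - e0 v)) \<longlongrightarrow> cmod ((e0 v + 0 * (u v - e0 v)) - e0 v)) (at 0)"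
      by (intro tendsto_intros)
    then show "\<forall>\<^sub>F s in at 0. cmod ((e0 v + s * (u v - e0 v)) - e0 v) < \<epsilon>"
      using \<open>\<epsilon> > 0\<close> by (intro order_tendstoD(2)) auto
  qed
  ultimately have "\<forall>\<^sub>F s in at (0::complex). poly r s \<noteq> 0 \<and>
      (\<forall>v\<in>V. cmod ((e0 v + s * (u v - e0 v)) - e0 v) < \<epsilon>)"
    by eventually_elim auto
  then obtain s where "poly r s \<noteq> 0" "\<forall>v\<in>V. cmod ((e0 v + s * (u v - e0 v)) - e0 v) < \<epsilon>"
    using eventually_happens'[OF at_neq_bot] by blast
  then have "g (\<lambda>v. e0 v + s * (u v - e0 v)) \<noteq> 0 \<and> P (\<lambda>v. e0 v + s * (u v - e0 v))"
    using r[of s] near[of "\<lambda>v. e0 v + s * (u v - e0 v)"] by simp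
  then have "\<not> (\<forall>e. g e \<noteq> 0 \<longrightarrow> \<not> P e)" by blast
  with cases g show ?thesis by blast
qed

section \<open>Conversion to the explicit sums of monomials of \<open>poly_fun\<close>\<close>

lemma poly_fun_mult:
  fixes I :: "'i set"
  assumes "poly_fun I p" "poly_fun I q"
  shows "poly_fun I (\<lambda>c. p c * q c)"
proof -
  obtain A a where A: "finite A" "p = (\<lambda>c. \<Sum>e\<in>A. a e * (\<Prod>j\<in>I. c j ^ e j))"
    using assms(1) unfolding poly_fun_def by blast
  obtain B b where B: "finite B" "q = (\<lambda>c. \<Sum>e\<in>B. b e * (\<Prod>j\<in>I. c j ^ e j))"
    using assms(2) unfolding poly_fun_def by blast
  let ?s = "\<lambda>(e, e') j. e j + e' j :: nat"
  \<comment> \<open>Different pairs of exponents can have the same sum, so their coefficients have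
    to be collected.\<close>
  define k where "k e = (\<Sum>x\<in>{x \<in> A \<times> B. ?s x = e}. a (fst x) * b (snd x))" for e
  have "p c * q c = (\<Sum>e\<in>?s ` (A \<times> B). k e * (\<Prod>j\<in>I. c j ^ e j))" for c
  proof -
    have "p c * q c = (\<Sum>x\<in>A \<times> B. a (fst x) * b (snd x) * (\<Prod>j\<in>I. c j ^ ?s x j))"
      unfolding A B sum_product sum.cartesian_product
      by (intro sum.cong) (auto simp: power_add prod.distrib)
    also have "\<dots> = (\<Sum>e\<in>?s ` (A \<times> B). \<Sum>x\<in>{x \<in> A \<times> B. ?s x = e}.
        a (fst x) * b (snd x) * (\<Prod>j\<in>I. c j ^ ?s x j))"
      by (rule sum.image_gen) (simp add: A B)
    also have "\<dots> = (\<Sum>e\<in>?s ` (A \<times> B). k e * (\<Prod>j\<in>I. c j ^ e j))"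
      unfolding k_def sum_distrib_right by (intro sum.cong refl) auto
    finally show ?thesis .
  qed
  then show ?thesis unfolding poly_fun_def using A(1) B(1)
    by (intro exI[of _ "?s ` (A \<times> B)"] exI[of _ k]) auto
qed

lemma poly_fun_add:
  assumes "poly_fun I p" "poly_fun I q"
  shows "poly_fun I (\<lambda>c. p c + q c)"
proof -
  obtain A a where A: "finite A" "p = (\<lambda>c. \<Sum>e\<in>A. a e * (\<Prod>j\<in>I. c j ^ e j))"
    using assms(1) unfolding poly_fun_def by blast
  obtain B b where B: "finite B" "q = (\<lambda>c. \<Sum>e\<in>B. b e * (\<Prod>j\<in>I. c j ^ e j))"
    using assms(2) unfolding poly_fun_def by blast
  let ?a = "\<lambda>e. if e \<in> A then a e else 0" and ?b = "\<lambda>e. if e \<in> B then b e else 0"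
  have "p c + q c = (\<Sum>e\<in>A \<union> B. (?a e + ?b e) * (\<Prod>j\<in>I. c j ^ e j))" for c
  proof -
    have "p c = (\<Sum>e\<in>A \<union> B. ?a e * (\<Prod>j\<in>I. c j ^ e j))"
      unfolding A using A(1) B(1) by (intro sum.mono_neutral_cong_left) auto
    moreover have "q c = (\<Sum>e\<in>A \<union> B. ?b e * (\<Prod>j\<in>I. c j ^ e j))"
      unfolding B using A(1) B(1) by (intro sum.mono_neutral_cong_left) auto
    ultimately show ?thesis by (simp add: distrib_right sum.distrib)
  qed
  then show ?thesis unfolding poly_fun_def using A(1) B(1)
    by (intro exI[of _ "A \<union> B"] exI[of _ "\<lambda>e. ?a e + ?b e"]) auto
qed

lemma polyfun_imp_poly_fun:
  assumes "polyfun I p" "finite I"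
  shows "poly_fun I p"
  using assms(1)
proof induction
  case (const c)
  show ?case unfolding poly_fun_def
    by (intro exI[of _ "{\<lambda>_. 0}"] exI[of _ "\<lambda>_. c"]) auto
next
  case (var v)
  have "(\<Prod>j\<in>I. c j ^ (if j = v then 1 else 0)) = c v" for c :: "'a \<Rightarrow> complex"
  proof -
    have "(\<Prod>j\<in>I. c j ^ (if j = v then 1 else 0)) = (\<Prod>j\<in>I. if j = v then c j else 1)"
      by (intro prod.cong) auto
    also have "\<dots> = c v" using var assms(2) by simp
    finally show ?thesis .
  qed
  then show ?case unfolding poly_fun_def
    by (intro exI[of _ "{\<lambda>j. if j = v then 1 else 0}"] exI[of _ "\<lambda>_. 1"]) auto
qed (auto intro: poly_fun_add poly_fun_mult)

section \<open>Quantifier elimination\<close>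

text \<open>A polynomial in the variable to be eliminated, with coefficients that are polynomial in
  the parameters \<open>e\<close>. The true degree jumps with \<open>e\<close>; \<open>N\<close> is
  a strict bound uniform in \<open>e\<close>, on which the algorithms below induct, splitting on the
  coefficient at \<open>N - 1\<close>.\<close>

definition family :: "nat \<Rightarrow> (('v \<Rightarrow> complex) \<Rightarrow> complex poly) \<Rightarrow> bool" where
  "family N f \<longleftrightarrow> (\<forall>e k. k \<ge> N \<longrightarrow> coeff (f e) k = 0) \<and> (\<forall>k. polyfun UNIV (\<lambda>e. coeff (f e) k))"

lemma familyD: "family N f \<Longrightarrow> polyfun UNIV (\<lambda>e. coeff (f e) k)"
  "family N f \<Longrightarrow> k \<ge> N \<Longrightarrow> coeff (f e) k = 0"
  by (auto simp: family_def)

lemma family_eq_0_iff: "family N f \<Longrightarrow> f e = 0 \<longleftrightarrow> (\<forall>k\<in>{..<N}. coeff (f e) k = 0)"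
  unfolding poly_eq_iff using familyD(2)[of N f] by (metis coeff_0 lessThan_iff not_less)

lemma family_add: "family N f \<Longrightarrow> family M g \<Longrightarrow> family (max N M) (\<lambda>e. f e + g e)"
  by (auto simp: family_def intro: polyfun.intros)

lemma family_mult: assumes "family N f" "family M g" shows "family (N + M) (\<lambda>e. f e * g e)"
  unfolding family_def
proof (intro conjI allI impI)
  fix e k assume "N + M \<le> k"
  then have "coeff (f e) i * coeff (g e) (k - i) = 0" if "i \<le> k" for i
    using familyD(2)[OF assms(1), of i e] familyD(2)[OF assms(2), of "k - i" e] by fastforce
  then show "coeff (f e * g e) k = 0" unfolding coeff_mult by (intro sum.neutral) auto
next
  fix k show "polyfun UNIV (\<lambda>e. coeff (f e * g e) k)"
    unfolding coeff_mult by (intro polyfun_sum polyfun.mult familyD(1)[OF assms(1)] familyD(1)[OF assms(2)])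
qed

lemma family_const: assumes "polyfun UNIV p" shows "family (Suc 0) (\<lambda>e. [:p e:])"
proof -
  have "polyfun UNIV (\<lambda>e. coeff [:p e:] k)" for k
    using assms by (cases k) (auto intro: polyfun.const)
  then show ?thesis by (auto simp: family_def coeff_pCons split: nat.split)
qed

lemma family_fixed: "\<exists>N. family N (\<lambda>e. p)"
  unfolding family_def by (rule exI[of _ "Suc (degree p)"]) (auto simp: coeff_eq_0 polyfun.const)

lemma family_power: "family N f \<Longrightarrow> \<exists>M. family M (\<lambda>e. f e ^ k)"
proof (induction k)
  case 0
  show ?case using family_fixed[of 1] by simp
next
  case (Suc k)
  then obtain M where "family M (\<lambda>e. f e ^ k)" by blast
  then show ?case using family_mult[OF Suc.prems] by auto
qed

definition drop_lead :: "nat \<Rightarrow> complex poly \<Rightarrow> complex poly" where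
  "drop_lead m p = p - monom (coeff p m) m"

text \<open>One step of pseudo-division: cross-multiplying by the leading coefficients cancels the
  term of degree \<open>m + k\<close> without dividing, so the coefficients stay polynomial in the
  parameters.\<close>

definition reduce_lead :: "nat \<Rightarrow> nat \<Rightarrow> complex poly \<Rightarrow> complex poly \<Rightarrow> complex poly" where
  "reduce_lead m k f g = smult (coeff f m) g - monom (coeff g (m + k)) k * f"

lemma family_drop_lead: assumes "family (Suc m) f" shows "family m (\<lambda>e. drop_lead m (f e))"
proof -
  have "polyfun UNIV (\<lambda>e. coeff (monom (coeff (f e) m) m) k)" for k
    using familyD(1)[OF assms] by (cases "k = m") (auto intro: polyfun.const)
  then show ?thesis using assms unfolding family_def drop_lead_def coeff_diff
    by (auto simp: le_Suc_eq intro!: polyfun_diff)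
qed

lemma family_reduce_lead:
  assumes "family (Suc m) f" "family (Suc (m + k)) g"
  shows "family (m + k) (\<lambda>e. reduce_lead m k (f e) (g e))"
  unfolding family_def
proof (intro conjI allI impI)
  fix e j assume "m + k \<le> j"
  then consider "j = m + k" | "Suc (m + k) \<le> j" by linarith
  then show "coeff (reduce_lead m k (f e) (g e)) j = 0"
  proof cases
    case 1
    then show ?thesis
      unfolding reduce_lead_def coeff_diff coeff_smult by (simp add: coeff_monom_mult)
  next
    case 2
    then show ?thesis using familyD(2)[OF assms(1), of "j - k" e] familyD(2)[OF assms(2), of j e]
      unfolding reduce_lead_def coeff_diff coeff_smult by (simp add: coeff_monom_mult)
  qed
next
  fix j
  have "polyfun UNIV (\<lambda>e. coeff (monom (coeff (g e) (m + k)) k * f e) j)"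
    unfolding coeff_monom_mult
    by (cases "k \<le> j") (auto intro: polyfun.intros familyD[OF assms(1)] familyD[OF assms(2)])
  then show "polyfun UNIV (\<lambda>e. coeff (reduce_lead m k (f e) (g e)) j)"
    unfolding reduce_lead_def coeff_diff coeff_smult
    by (intro polyfun_diff polyfun.mult familyD[OF assms(1)] familyD[OF assms(2)])
qed

lemma dvd_reduce_lead:
  assumes "coeff f m \<noteq> 0"
  shows "f dvd reduce_lead m k f g \<longleftrightarrow> f dvd g"
proof -
  have "f dvd reduce_lead m k f g \<longleftrightarrow> f dvd smult (coeff f m) g"
    unfolding reduce_lead_def by (metis dvd_diff_commute dvd_minus_iff dvd_add_right_iff dvd_triv_right add_uminus_conv_diff dvd_add_left_iff)
  then show ?thesis using assms by (simp add: dvd_smult_iff)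
qed

lemma constructible_family_eq_0: "family N f \<Longrightarrow> constructible UNIV (\<lambda>e. f e = 0)"
  unfolding family_eq_0_iff
  by (intro constructible_all_finite constructible.zero) (auto intro: familyD)

text \<open>Where its coefficient at \<open>m\<close> is nonzero, \<open>f\<close> has true degree
  \<open>m\<close>, and pseudo-division by \<open>f\<close> lowers the bound on \<open>h\<close>
  without affecting divisibility. Once \<open>h\<close> has degree below \<open>m\<close>,
  divisibility means \<open>h = 0\<close>.\<close>

lemma constructible_lead_dvd:
  assumes f: "family (Suc m) f" and "family N h"
  shows "constructible UNIV (\<lambda>e. coeff (f e) m \<noteq> 0 \<and> f e dvd h e)"
  using assms(2)
proof (induction N arbitrary: h)
  case 0
  then have "h e = 0" for e by (simp add: family_eq_0_iff)
  then show ?case by (auto intro!: constructible.intros familyD[OF f])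
next
  case (Suc N)
  have lead: "constructible UNIV (\<lambda>e. coeff (f e) m \<noteq> 0)"
    by (intro constructible.neg constructible.zero familyD[OF f])
  show ?case
  proof (cases "N < m")
    case True
    have "f e dvd h e \<longleftrightarrow> h e = 0" if "coeff (f e) m \<noteq> 0" for e
    proof
      assume "f e dvd h e"
      moreover have "degree (f e) \<ge> m" using that by (rule le_degree)
      moreover have "degree (h e) \<le> N" by (intro degree_le allI impI familyD(2)[OF Suc.prems]) auto
      ultimately show "h e = 0" using True dvd_imp_degree_le by fastforce
    qed auto
    then have eq: "(\<lambda>e. coeff (f e) m \<noteq> 0 \<and> f e dvd h e) = (\<lambda>e. coeff (f e) m \<noteq> 0 \<and> h e = 0)"
      by auto
    show ?thesis unfolding eq
      by (intro constructible.conj lead constructible_family_eq_0[OF Suc.prems])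
  next
    case False
    then obtain k where k: "N = m + k" using le_Suc_ex not_less by blast
    have "family N (\<lambda>e. reduce_lead m k (f e) (h e))"
      using family_reduce_lead[OF f, of k h] Suc.prems k by simp
    from Suc.IH[OF this] show ?thesis by (simp add: dvd_reduce_lead cong: conj_cong)
  qed
qed

lemma drop_lead_eq: "coeff p m = 0 \<Longrightarrow> drop_lead m p = p"
  by (simp add: drop_lead_def)

lemma constructible_if:
  assumes "constructible V P" "constructible V A" "constructible V B"
    and "\<And>e. P e \<Longrightarrow> Q e \<longleftrightarrow> A e" "\<And>e. \<not> P e \<Longrightarrow> Q e \<longleftrightarrow> B e"
  shows "constructible V Q"
proof -
  have "Q = (\<lambda>e. (P e \<and> A e) \<or> (\<not> P e \<and> B e))" using assms(4,5) by auto
  then show ?thesis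
    by (auto intro!: constructible_disj constructible.conj constructible.neg assms(1-3))
qed

text \<open>By the univariate Nullstellensatz, if \<open>f\<close> has degree \<open>m\<close>, all
  its roots are roots of \<open>q\<close> iff \<open>f dvd q ^ m\<close>. Splitting on the
  coefficient at \<open>m\<close> first makes this exponent independent of \<open>e\<close>; where
  that coefficient vanishes, the bound on \<open>f\<close> drops.\<close>

lemma constructible_ex_root_nonroot:
  assumes "family M f" and q: "family N q"
  shows "constructible UNIV (\<lambda>e. \<exists>z. poly (f e) z = 0 \<and> poly (q e) z \<noteq> 0)"
  using assms(1)
proof (induction M arbitrary: f)
  case 0
  then have "f e = 0" for e by (simp add: family_eq_0_iff)
  then have "(\<exists>z. poly (f e) z = 0 \<and> poly (q e) z \<noteq> 0) \<longleftrightarrow> \<not> q e = 0" for e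
    using poly_all_0_iff_0[of "q e"] by auto
  then show ?case by (auto intro: constructible.neg constructible_family_eq_0[OF q])
next
  case (Suc m)
  obtain K where K: "family K (\<lambda>e. q e ^ m)" using family_power[OF q] by blast
  show ?case
  proof (rule constructible_if)
    show "constructible UNIV (\<lambda>e. coeff (f e) m = 0)"
      by (intro constructible.zero familyD[OF Suc.prems])
    show "constructible UNIV (\<lambda>e. \<exists>z. poly (drop_lead m (f e)) z = 0 \<and> poly (q e) z \<noteq> 0)"
      by (rule Suc.IH[OF family_drop_lead[OF Suc.prems]])
    show "constructible UNIV (\<lambda>e. \<not> (coeff (f e) m \<noteq> 0 \<and> f e dvd q e ^ m))"
      by (intro constructible.neg constructible_lead_dvd[OF Suc.prems K])
    fix e assume "coeff (f e) m \<noteq> 0"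
    moreover have "degree (f e) \<le> m" by (intro degree_le allI impI familyD(2)[OF Suc.prems]) auto
    ultimately have "degree (f e) = m" "f e \<noteq> 0" by (auto intro: le_degree antisym)
    then show "(\<exists>z. poly (f e) z = 0 \<and> poly (q e) z \<noteq> 0) \<longleftrightarrow>
        \<not> (coeff (f e) m \<noteq> 0 \<and> f e dvd q e ^ m)"
      using nullstellensatz_univariate[of "f e" "q e"] \<open>coeff (f e) m \<noteq> 0\<close> by auto
  qed (auto simp: drop_lead_eq)
qed

text \<open>Euclid's algorithm with a case distinction on each leading coefficient: a property of
  the zero set that is constructible for one polynomial is constructible for two.\<close>

lemma constructible_common_roots2:
  assumes Q: "\<And>N h. family N h \<Longrightarrow> constructible UNIV (\<lambda>e. Q e {z. poly (h e) z = 0})"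
    and "family M f" "family N g"
  shows "constructible UNIV (\<lambda>e. Q e {z. poly (f e) z = 0 \<and> poly (g e) z = 0})"
  using assms(2,3)
proof (induction "M + N" arbitrary: M N f g rule: less_induct)
  case less
  \<comment> \<open>Stated for fresh \<open>M\<close>, \<open>N\<close>, \<open>f\<close>,
    \<open>g\<close> so that the case \<open>M > N\<close> can apply it with the two polynomials
    exchanged.\<close>
  have step: "constructible UNIV (\<lambda>e. Q e {z. poly (f e) z = 0 \<and> poly (g e) z = 0})"
    if "M \<le> N" "family M f" "family N g" "M + N = M0"
      and IH: "\<And>M N f g. M + N < M0 \<Longrightarrow> family M f \<Longrightarrow> family N g \<Longrightarrow>
        constructible UNIV (\<lambda>e. Q e {z. poly (f e) z = 0 \<and> poly (g e) z = 0})"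
    for M N M0 f g
  proof (cases M)
    case 0
    then have "f e = 0" for e using that by (simp add: family_eq_0_iff)
    then show ?thesis using Q[OF that(3)] by simp
  next
    case (Suc m)
    then obtain k where N: "N = Suc (m + k)" using le_Suc_ex[OF \<open>M \<le> N\<close>] by auto
    have f: "family (Suc m) f" and g: "family (Suc (m + k)) g" using that Suc N by auto
    show ?thesis
    proof (rule constructible_if)
      show "constructible UNIV (\<lambda>e. coeff (f e) m = 0)"
        by (intro constructible.zero familyD[OF f])
      show "constructible UNIV (\<lambda>e. Q e {z. poly (drop_lead m (f e)) z = 0 \<and> poly (g e) z = 0})"
        by (rule IH[OF _ family_drop_lead[OF f] g]) (use that(4) Suc N in auto)
      show "constructible UNIV (\<lambda>e. Q e {z. poly (f e) z = 0 \<and>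
          poly (reduce_lead m k (f e) (g e)) z = 0})"
        by (rule IH[OF _ f family_reduce_lead[OF f g]]) (use that(4) Suc N in auto)
      fix e assume "coeff (f e) m \<noteq> 0"
      then have "{z. poly (f e) z = 0 \<and> poly (g e) z = 0} =
          {z. poly (f e) z = 0 \<and> poly (reduce_lead m k (f e) (g e)) z = 0}"
        by (auto simp: reduce_lead_def)
      then show "Q e {z. poly (f e) z = 0 \<and> poly (g e) z = 0} \<longleftrightarrow>
          Q e {z. poly (f e) z = 0 \<and> poly (reduce_lead m k (f e) (g e)) z = 0}" by simp
    qed (simp add: drop_lead_eq)
  qed
  show ?case
  proof (cases "M \<le> N")
    case True
    show ?thesis by (rule step[OF True less.prems refl less.hyps])
  next
    case False
    then show ?thesis
      using step[of N M g f "M + N", OF _ less.prems(2,1) _ less.hyps]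
      by (simp add: conj_commute)
  qed
qed

text \<open>\<open>Q\<close> is generalised in the induction: for \<open>f # fs\<close>, the roots
  of \<open>f\<close> are intersected into the set that \<open>Q\<close> receives, and the
  two-polynomial lemma supplies the hypothesis for this new property.\<close>

lemma constructible_common_roots:
  assumes "\<And>N h. family N h \<Longrightarrow> constructible UNIV (\<lambda>e. Q e {z. poly (h e) z = 0})"
    and "\<forall>f\<in>set fs. \<exists>N. family N f"
  shows "constructible UNIV (\<lambda>e. Q e {z. \<forall>f\<in>set fs. poly (f e) z = 0})"
  using assms
proof (induction fs arbitrary: Q)
  case Nil
  obtain N where "family N (\<lambda>e :: 'a \<Rightarrow> complex. 0)" using family_fixed by blast
  from Nil(1)[OF this] show ?case by simp
next
  case (Cons f fs)
  then obtain M where f: "family M f" by auto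
  have "constructible UNIV (\<lambda>e. Q e ({z. poly (f e) z = 0} \<inter> {z. \<forall>f\<in>set fs. poly (f e) z = 0}))"
  proof (rule Cons.IH)
    fix N and h :: "('a \<Rightarrow> complex) \<Rightarrow> complex poly" assume "family N h"
    from constructible_common_roots2[of Q, OF Cons.prems(1) f this]
    show "constructible UNIV (\<lambda>e. Q e ({z. poly (f e) z = 0} \<inter> {z. poly (h e) z = 0}))"
      by (simp add: Collect_conj_eq)
  qed (use Cons.prems in auto)
  moreover have "{z. poly (f e) z = 0} \<inter> {z. \<forall>f\<in>set fs. poly (f e) z = 0} =
      {z. \<forall>f\<in>set (f # fs). poly (f e) z = 0}" for e by auto
  ultimately show ?case by simp
qed

lemma polyfun_as_family:
  assumes "polyfun UNIV p"
  shows "\<exists>N f. family N f \<and> (\<forall>e z. p (e(v := z)) = poly (f e) z)"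
  using assms
proof induction
  case (const c)
  show ?case using family_const[OF polyfun.const, of c] by fastforce
next
  case (var u)
  show ?case
  proof (cases "u = v")
    case True
    then show ?thesis using family_fixed[of "[:0, 1:]"] by fastforce
  next
    case False
    then show ?thesis using family_const[OF polyfun.var, of u] by fastforce
  qed
next
  case (add p q)
  then show ?case by (metis family_add poly_add)
next
  case (mult p q)
  then show ?case by (metis family_mult poly_mult)
qed

text \<open>Disjunctive normal form in the single variable \<open>v\<close>: each entry of
  \<open>L\<close> is a list of equations with one inequation. A single inequation suffices because
  conjoined inequations are multiplied.\<close>

definition dnf :: "'v \<Rightarrow> (('v \<Rightarrow> complex) \<Rightarrow> bool) \<Rightarrow> bool" where
  "dnf v P \<longleftrightarrow> (\<exists>L. (\<forall>x\<in>set L. (\<forall>f\<in>set (fst x). \<exists>N. family N f) \<and> (\<exists>N. family N (snd x))) \<and>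
     (\<forall>e z. P (e(v := z)) \<longleftrightarrow>
       (\<exists>x\<in>set L. (\<forall>f\<in>set (fst x). poly (f e) z = 0) \<and> poly (snd x e) z \<noteq> 0)))"

lemma dnfE:
  assumes "dnf v P"
  obtains L where
    "\<And>x. x \<in> set L \<Longrightarrow> (\<forall>f\<in>set (fst x). \<exists>N. family N f) \<and> (\<exists>N. family N (snd x))"
    "\<And>e z. P (e(v := z)) \<longleftrightarrow>
      (\<exists>x\<in>set L. (\<forall>f\<in>set (fst x). poly (f e) z = 0) \<and> poly (snd x e) z \<noteq> 0)"
proof -
  from assms obtain L where
    L: "\<forall>x\<in>set L. (\<forall>f\<in>set (fst x). \<exists>N. family N f) \<and> (\<exists>N. family N (snd x))"
    "\<forall>e z. P (e(v := z)) \<longleftrightarrow>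
      (\<exists>x\<in>set L. (\<forall>f\<in>set (fst x). poly (f e) z = 0) \<and> poly (snd x e) z \<noteq> 0)"
    unfolding dnf_def by (elim exE conjE)
  show ?thesis by (rule that[of L]) (use L(1) in blast, rule L(2)[rule_format])
qed

lemma dnf_disj: assumes "dnf v P" "dnf v Q" shows "dnf v (\<lambda>e. P e \<or> Q e)"
proof -
  obtain L where L: "\<And>x. x \<in> set L \<Longrightarrow> (\<forall>f\<in>set (fst x). \<exists>N. family N f) \<and> (\<exists>N. family N (snd x))"
    "\<And>e z. P (e(v := z)) \<longleftrightarrow>
      (\<exists>x\<in>set L. (\<forall>f\<in>set (fst x). poly (f e) z = 0) \<and> poly (snd x e) z \<noteq> 0)"
    by (rule dnfE[OF assms(1)]) auto
  obtain K where K: "\<And>x. x \<in> set K \<Longrightarrow> (\<forall>f\<in>set (fst x). \<exists>N. family N f) \<and> (\<exists>N. family N (snd x))"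
    "\<And>e z. Q (e(v := z)) \<longleftrightarrow>
      (\<exists>x\<in>set K. (\<forall>f\<in>set (fst x). poly (f e) z = 0) \<and> poly (snd x e) z \<noteq> 0)"
    by (rule dnfE[OF assms(2)]) auto
  show ?thesis unfolding dnf_def
    by (rule exI[of _ "L @ K"]) (use L(1) K(1) in \<open>simp add: ball_Un bex_Un L(2) K(2)\<close>)
qed

lemma dnf_conj: assumes "dnf v P" "dnf v Q" shows "dnf v (\<lambda>e. P e \<and> Q e)"
proof -
  obtain L where L: "\<And>x. x \<in> set L \<Longrightarrow> (\<forall>f\<in>set (fst x). \<exists>N. family N f) \<and> (\<exists>N. family N (snd x))"
    "\<And>e z. P (e(v := z)) \<longleftrightarrow>
      (\<exists>x\<in>set L. (\<forall>f\<in>set (fst x). poly (f e) z = 0) \<and> poly (snd x e) z \<noteq> 0)"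
    by (rule dnfE[OF assms(1)]) auto
  obtain K where K: "\<And>x. x \<in> set K \<Longrightarrow> (\<forall>f\<in>set (fst x). \<exists>N. family N f) \<and> (\<exists>N. family N (snd x))"
    "\<And>e z. Q (e(v := z)) \<longleftrightarrow>
      (\<exists>x\<in>set K. (\<forall>f\<in>set (fst x). poly (f e) z = 0) \<and> poly (snd x e) z \<noteq> 0)"
    by (rule dnfE[OF assms(2)]) auto
  define M where "M = map (\<lambda>x. (fst (fst x) @ fst (snd x), \<lambda>e. snd (fst x) e * snd (snd x) e))
    (List.product L K)"
  have set_M: "set M = (\<Union>x\<in>set L. \<Union>y\<in>set K. {(fst x @ fst y, \<lambda>e. snd x e * snd y e)})"
    unfolding M_def set_map set_product by force
  have "(\<forall>f\<in>set (fst m). \<exists>N. family N f) \<and> (\<exists>N. family N (snd m))" if m: "m \<in> set M" for m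
  proof -
    obtain x y where *: "x \<in> set L" "y \<in> set K" "m = (fst x @ fst y, \<lambda>e. snd x e * snd y e)"
      using m unfolding set_M by blast
    obtain N M where "family N (snd x)" "family M (snd y)" using L(1)[OF *(1)] K(1)[OF *(2)] by blast
    then have "family (N + M) (snd m)" unfolding *(3) snd_conv by (rule family_mult)
    then show ?thesis using L(1)[OF *(1)] K(1)[OF *(2)] *(3) by auto
  qed
  moreover have "P (e(v := z)) \<and> Q (e(v := z)) \<longleftrightarrow>
      (\<exists>x\<in>set M. (\<forall>f\<in>set (fst x). poly (f e) z = 0) \<and> poly (snd x e) z \<noteq> 0)" for e z
  proof -
    have "P (e(v := z)) \<and> Q (e(v := z)) \<longleftrightarrow> (\<exists>x\<in>set L. \<exists>y\<in>set K.
        ((\<forall>f\<in>set (fst x). poly (f e) z = 0) \<and> poly (snd x e) z \<noteq> 0) \<and>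
        ((\<forall>f\<in>set (fst y). poly (f e) z = 0) \<and> poly (snd y e) z \<noteq> 0))"
      unfolding L(2) K(2) by blast
    also have "\<dots> \<longleftrightarrow> (\<exists>x\<in>set L. \<exists>y\<in>set K. (\<forall>f\<in>set (fst x @ fst y). poly (f e) z = 0) \<and>
        poly (snd x e * snd y e) z \<noteq> 0)"
      unfolding set_append ball_Un poly_mult mult_eq_0_iff by blast
    also have "\<dots> \<longleftrightarrow> (\<exists>x\<in>set M. (\<forall>f\<in>set (fst x). poly (f e) z = 0) \<and> poly (snd x e) z \<noteq> 0)"
      unfolding set_M by simp
    finally show ?thesis .
  qed
  ultimately show ?thesis unfolding dnf_def
    by (intro exI[of _ M] conjI ballI allI) blast+
qed

text \<open>\<open>P\<close> and its negation are carried together, so that the negation case of the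
  induction just swaps them and the negated conjunction becomes a disjunction.\<close>

lemma constructible_dnf:
  assumes "constructible UNIV P"
  shows "dnf v P \<and> dnf v (\<lambda>e. \<not> P e)"
  using assms
proof induction
  case (zero p)
  obtain N f where f: "family N f" "\<forall>e z. p (e(v := z)) = poly (f e) z"
    using polyfun_as_family[OF zero] by blast
  obtain M where "family M (\<lambda>e :: 'a \<Rightarrow> complex. 1)" using family_fixed by blast
  then have "dnf v (\<lambda>e. p e = 0)" unfolding dnf_def
    using f by (intro exI[of _ "[([f], \<lambda>_. 1)]"]) auto
  moreover have "dnf v (\<lambda>e. p e \<noteq> 0)" unfolding dnf_def
    using f by (intro exI[of _ "[([], f)]"]) auto
  ultimately show ?case by blast
next
  case (conj P Q)
  then show ?case using dnf_conj[of v P Q] dnf_disj[of v "\<lambda>e. \<not> P e" "\<lambda>e. \<not> Q e"]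
    by simp
qed simp

text \<open>This is Chevalley's theorem for a coordinate projection. The quantifier passes into the
  disjuncts; in each one the equations collapse to one polynomial by
  \<open>constructible_common_roots\<close>, leaving the question of a root of \<open>f\<close> that
  is not a root of \<open>q\<close>.\<close>

lemma constructible_ex:
  assumes "constructible UNIV P"
  shows "constructible UNIV (\<lambda>e. \<exists>z. P (e(v := z)))"
proof -
  obtain L where L: "\<And>x. x \<in> set L \<Longrightarrow> (\<forall>f\<in>set (fst x). \<exists>N. family N f) \<and> (\<exists>N. family N (snd x))"
    "\<And>e z. P (e(v := z)) \<longleftrightarrow>
      (\<exists>x\<in>set L. (\<forall>f\<in>set (fst x). poly (f e) z = 0) \<and> poly (snd x e) z \<noteq> 0)"
    by (rule dnfE[OF conjunct1[OF constructible_dnf[OF assms]], of v]) auto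
  have "constructible UNIV (\<lambda>e. \<exists>x\<in>set L. \<exists>z\<in>{z. \<forall>f\<in>set (fst x). poly (f e) z = 0}. poly (snd x e) z \<noteq> 0)"
  proof (intro constructible_ex_finite)
    fix x assume "x \<in> set L"
    then obtain N where fs: "\<forall>f\<in>set (fst x). \<exists>N. family N f" and q: "family N (snd x)"
      using L(1) by blast
    show "constructible UNIV (\<lambda>e. \<exists>z\<in>{z. \<forall>f\<in>set (fst x). poly (f e) z = 0}. poly (snd x e) z \<noteq> 0)"
      by (rule constructible_common_roots[OF _ fs]) (use constructible_ex_root_nonroot[OF _ q] in auto)
  qed auto
  moreover have "(\<exists>x\<in>set L. \<exists>z\<in>{z. \<forall>f\<in>set (fst x). poly (f e) z = 0}. poly (snd x e) z \<noteq> 0) \<longleftrightarrow>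
      (\<exists>z. P (e(v := z)))" for e
    unfolding L(2) by blast
  ultimately show ?thesis by simp
qed

lemma constructible_all:
  "constructible UNIV P \<Longrightarrow> constructible UNIV (\<lambda>e. \<forall>z. P (e(v := z)))"
  using constructible.neg[OF constructible_ex[OF constructible.neg], of P v] by simp

lemma constructible_ex_block:
  assumes "finite W" "constructible UNIV P"
  shows "constructible UNIV (\<lambda>e. \<exists>z. P (override_on e z W))"
  using assms
proof (induction W arbitrary: P rule: finite_induct)
  case empty
  then show ?case by simp
next
  case (insert v W)
  have "(\<exists>z. P (override_on e z (insert v W))) \<longleftrightarrow> (\<exists>z y. P ((override_on e z W)(v := y)))" for e
  proof
    assume "\<exists>z y. P ((override_on e z W)(v := y))"
    then obtain z y where "P ((override_on e z W)(v := y))" by blast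
    moreover have "(override_on e z W)(v := y) = override_on e (z(v := y)) (insert v W)"
      using insert by (auto simp: override_on_def)
    ultimately show "\<exists>z. P (override_on e z (insert v W))" by auto
  qed (auto simp: override_on_insert)
  then show ?case using insert.IH[OF constructible_ex[OF insert.prems, of v]] by presburger
qed

text \<open>A disjunct has infinitely many solutions only if all its equations vanish identically
  and its inequation does not, and this is a condition on coefficients. It is needed because
  \<open>one_fold\<close> is a finiteness statement.\<close>

lemma constructible_finite:
  assumes "constructible UNIV P"
  shows "constructible UNIV (\<lambda>e. finite {z. P (e(v := z))})"
proof -
  obtain L where L: "\<And>x. x \<in> set L \<Longrightarrow> (\<forall>f\<in>set (fst x). \<exists>N. family N f) \<and> (\<exists>N. family N (snd x))"
    "\<And>e z. P (e(v := z)) \<longleftrightarrow>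
      (\<exists>x\<in>set L. (\<forall>f\<in>set (fst x). poly (f e) z = 0) \<and> poly (snd x e) z \<noteq> 0)"
    by (rule dnfE[OF conjunct1[OF constructible_dnf[OF assms]], of v]) auto
  have "constructible UNIV (\<lambda>e. \<forall>x\<in>set L. \<not> ((\<forall>f\<in>set (fst x). f e = 0) \<and> \<not> snd x e = 0))"
  proof (intro constructible_all_finite constructible.neg constructible.conj)
    fix x assume "x \<in> set L"
    then obtain N where fs: "\<forall>f\<in>set (fst x). \<exists>N. family N f" and q: "family N (snd x)"
      using L(1) by blast
    show "constructible UNIV (\<lambda>e. snd x e = 0)" by (rule constructible_family_eq_0[OF q])
    show "constructible UNIV (\<lambda>e. f e = 0)" if "f \<in> set (fst x)" for f
      using that fs constructible_family_eq_0 by blast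
  qed auto
  moreover have "(\<forall>x\<in>set L. \<not> ((\<forall>f\<in>set (fst x). f e = 0) \<and> \<not> snd x e = 0)) \<longleftrightarrow>
      finite {z. P (e(v := z))}" for e
  proof -
    have basic: "finite {z. (\<forall>f\<in>set fs. poly (f e) z = 0) \<and> poly (q e) z \<noteq> 0} \<longleftrightarrow>
        \<not> ((\<forall>f\<in>set fs. f e = 0) \<and> \<not> q e = 0)" (is "finite ?S \<longleftrightarrow> _")
      for fs and q :: "('a \<Rightarrow> complex) \<Rightarrow> complex poly"
    proof
      assume "finite ?S"
      show "\<not> ((\<forall>f\<in>set fs. f e = 0) \<and> \<not> q e = 0)"
      proof
        assume *: "(\<forall>f\<in>set fs. f e = 0) \<and> \<not> q e = 0"
        then have "?S \<union> {z. poly (q e) z = 0} = UNIV" by auto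
        moreover have "finite (?S \<union> {z. poly (q e) z = 0})"
          using \<open>finite ?S\<close> poly_roots_finite[of "q e"] * by blast
        ultimately show False using infinite_UNIV_char_0[where 'a = complex] by simp
      qed
    next
      assume "\<not> ((\<forall>f\<in>set fs. f e = 0) \<and> \<not> q e = 0)"
      then consider f where "f \<in> set fs" "f e \<noteq> 0" | "q e = 0" by blast
      then show "finite ?S"
      proof cases
        case 1
        then show ?thesis by (intro finite_subset[OF _ poly_roots_finite[of "f e"]]) auto
      qed auto
    qed
    have "{z. P (e(v := z))} = (\<Union>x\<in>set L. {z. (\<forall>f\<in>set (fst x). poly (f e) z = 0) \<and> poly (snd x e) z \<noteq> 0})"
      unfolding L(2) by blast
    then show ?thesis by (simp add: basic)
  qed
  ultimately show ?thesis by simp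
qed

text \<open>Strong minimality of the complex field. It upgrades the failure of
  \<open>one_fold\<close> from an infinite set of multiple points to a cofinite one.\<close>

lemma constructible_finite_or_cofinite:
  assumes "constructible UNIV P"
  shows "finite {z. P (e(v := z))} \<or> finite {z. \<not> P (e(v := z))}"
  using assms
proof induction
  case (zero p)
  obtain N f where "family N f" "\<forall>e z. p (e(v := z)) = poly (f e) z"
    using polyfun_as_family[OF zero] by blast
  then have eq: "{z. p (e(v := z)) = 0} = {z. poly (f e) z = 0}"
    "{z. p (e(v := z)) \<noteq> 0} = {z. poly (f e) z \<noteq> 0}"
    by presburger+
  show ?case unfolding eq using poly_roots_finite[of "f e"] by (cases "f e = 0") auto
next
  case (conj P Q)
  have "{z. \<not> (P (e(v := z)) \<and> Q (e(v := z)))} = {z. \<not> P (e(v := z))} \<union> {z. \<not> Q (e(v := z))}"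
    by auto
  moreover have "finite {z. P (e(v := z)) \<and> Q (e(v := z))}"
    if "finite {z. P (e(v := z))} \<or> finite {z. Q (e(v := z))}"
    using that by (elim disjE) (erule rev_finite_subset, blast)+
  ultimately show ?case using conj.IH by (metis finite_UnI)
qed auto

section \<open>The $\ell^1$ norm and coefficientwise convergence of polynomials\<close>

text \<open>The \<open>l^1\<close> norm is submultiplicative, dominates every coefficient, and can
  be computed with any bound on the degree.\<close>

definition pnorm :: "complex poly \<Rightarrow> real" where
  "pnorm p = (\<Sum>i\<le>degree p. cmod (coeff p i))"

lemma pnorm_degree_le:
  assumes "degree p \<le> N"
  shows "pnorm p = (\<Sum>i\<le>N. cmod (coeff p i))"
  unfolding pnorm_def using assms
  by (intro sum.mono_neutral_left) (auto simp: coeff_eq_0)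

lemma pnorm_nonneg [simp]: "pnorm p \<ge> 0"
  unfolding pnorm_def by (intro sum_nonneg) auto

lemma cmod_coeff_le_pnorm: "cmod (coeff p k) \<le> pnorm p"
proof (cases "k \<le> degree p")
  case True
  then show ?thesis unfolding pnorm_def by (intro member_le_sum) auto
qed (simp add: coeff_eq_0)

lemma pnorm_eq_0_iff [simp]: "pnorm p = 0 \<longleftrightarrow> p = 0"
proof
  assume "pnorm p = 0"
  then have "coeff p k = 0" for k using cmod_coeff_le_pnorm[of p k] by simp
  then show "p = 0" by (simp add: poly_eq_iff)
qed (simp add: pnorm_def)

lemma pnorm_0 [simp]: "pnorm 0 = 0"
  by simp

lemma pnorm_add: "pnorm (p + q) \<le> pnorm p + pnorm q"
proof -
  let ?N = "max (degree p) (degree q)"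
  have "pnorm (p + q) = (\<Sum>i\<le>?N. cmod (coeff p i + coeff q i))"
    by (subst pnorm_degree_le[OF degree_add_le_max]) simp
  also have "\<dots> \<le> (\<Sum>i\<le>?N. cmod (coeff p i) + cmod (coeff q i))"
    by (intro sum_mono norm_triangle_ineq)
  also have "\<dots> = pnorm p + pnorm q"
    by (simp add: sum.distrib pnorm_degree_le[of p ?N] pnorm_degree_le[of q ?N])
  finally show ?thesis .
qed

lemma pnorm_pCons: "pnorm (pCons a p) = cmod a + pnorm p"
proof -
  have "pnorm (pCons a p) = (\<Sum>i\<le>Suc (degree p). cmod (coeff (pCons a p) i))"
    by (intro pnorm_degree_le degree_pCons_le)
  then show ?thesis by (simp only: sum.atMost_Suc_shift coeff_pCons_0 coeff_pCons_Suc pnorm_def)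
qed

lemma pnorm_smult: "pnorm (smult a p) = cmod a * pnorm p"
  by (subst pnorm_degree_le[OF degree_smult_le]) (simp add: norm_mult pnorm_def sum_distrib_left)

lemma pnorm_minus [simp]: "pnorm (- p) = pnorm p"
  by (simp add: pnorm_def)

lemma pnorm_1 [simp]: "pnorm 1 = 1"
  by (simp add: pnorm_def)

lemma pnorm_minus_commute: "pnorm (p - q) = pnorm (q - p)"
  using pnorm_minus[of "p - q"] by simp

lemma pnorm_triangle_via: "pnorm (p - r) \<le> pnorm (p - q) + pnorm (q - r)"
  using pnorm_add[of "p - q" "q - r"] by simp

lemma pnorm_mult: "pnorm (p * q) \<le> pnorm p * pnorm q"
proof (induction p)
  case 0
  show ?case by (simp add: pnorm_def)
next
  case (pCons a p)
  have "pnorm (pCons a p * q) \<le> pnorm (smult a q) + pnorm (pCons 0 (p * q))"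
    unfolding mult_pCons_left by (rule pnorm_add)
  also have "\<dots> \<le> pnorm (pCons a p) * pnorm q"
    using pCons by (simp add: pnorm_smult pnorm_pCons distrib_right)
  finally show ?case .
qed

lemma pnorm_sum: "pnorm (\<Sum>i\<in>A. f i) \<le> (\<Sum>i\<in>A. pnorm (f i))"
  by (induction A rule: infinite_finite_induct) (auto intro: order_trans[OF pnorm_add])

text \<open>Under a common degree bound this agrees with convergence in \<open>pnorm\<close>; the
  coefficientwise form passes through sums, products and powers with no such bound.\<close>

definition pconv :: "('b \<Rightarrow> complex poly) \<Rightarrow> complex poly \<Rightarrow> 'b filter \<Rightarrow> bool" where
  "pconv f p F \<longleftrightarrow> (\<forall>k. ((\<lambda>x. coeff (f x) k) \<longlongrightarrow> coeff p k) F)"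

lemma pconvD: "pconv f p F \<Longrightarrow> ((\<lambda>x. coeff (f x) k) \<longlongrightarrow> coeff p k) F"
  by (simp add: pconv_def)

lemma pconv_const: "pconv (\<lambda>_. p) p F"
  by (simp add: pconv_def)

lemma pconv_add: "pconv f p F \<Longrightarrow> pconv g q F \<Longrightarrow> pconv (\<lambda>x. f x + g x) (p + q) F"
  unfolding pconv_def coeff_add by (intro allI tendsto_add) auto

lemma pconv_diff: "pconv f p F \<Longrightarrow> pconv g q F \<Longrightarrow> pconv (\<lambda>x. f x - g x) (p - q) F"
  unfolding pconv_def coeff_diff by (intro allI tendsto_diff) auto

lemma pconv_mult: "pconv f p F \<Longrightarrow> pconv g q F \<Longrightarrow> pconv (\<lambda>x. f x * g x) (p * q) F"
  unfolding pconv_def coeff_mult by (intro allI tendsto_sum tendsto_mult) auto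

lemma pconv_smult: "(c \<longlongrightarrow> a) F \<Longrightarrow> pconv f p F \<Longrightarrow> pconv (\<lambda>x. smult (c x) (f x)) (smult a p) F"
  unfolding pconv_def coeff_smult by (intro allI tendsto_mult) auto

lemma pconv_sum: "(\<And>i. i \<in> A \<Longrightarrow> pconv (f i) (p i) F) \<Longrightarrow> pconv (\<lambda>x. \<Sum>i\<in>A. f i x) (\<Sum>i\<in>A. p i) F"
  by (induction A rule: infinite_finite_induct) (auto intro: pconv_add pconv_const)

lemma pconv_prod: "(\<And>i. i \<in> A \<Longrightarrow> pconv (f i) (p i) F) \<Longrightarrow> pconv (\<lambda>x. \<Prod>i\<in>A. f i x) (\<Prod>i\<in>A. p i) F"
  by (induction A rule: infinite_finite_induct) (auto intro: pconv_mult pconv_const)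

lemma pconv_power: "pconv f p F \<Longrightarrow> pconv (\<lambda>x. f x ^ k) (p ^ k) F"
  by (induction k) (auto intro: pconv_mult pconv_const)

lemmas pconv_intros = pconv_const pconv_add pconv_diff pconv_mult pconv_smult pconv_sum
  pconv_prod pconv_power

lemma pconv_subseq:
  "pconv f p sequentially \<Longrightarrow> strict_mono (r :: nat \<Rightarrow> nat) \<Longrightarrow> pconv (\<lambda>m. f (r m)) p sequentially"
  unfolding pconv_def using LIMSEQ_subseq_LIMSEQ[of "\<lambda>m. coeff (f m) _" _ r] by (auto simp: o_def)

lemma pconv_imp_pnorm:
  assumes "pconv f p F" "\<And>x. degree (f x) \<le> N" "degree p \<le> N"
  shows "((\<lambda>x. pnorm (f x - p)) \<longlongrightarrow> 0) F"
proof -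
  have "((\<lambda>x. \<Sum>k\<le>N. cmod (coeff (f x) k - coeff p k)) \<longlongrightarrow> (\<Sum>k\<le>N. cmod (coeff p k - coeff p k))) F"
    by (intro tendsto_intros pconvD[OF assms(1)])
  moreover have "pnorm (f x - p) = (\<Sum>k\<le>N. cmod (coeff (f x) k - coeff p k))" for x
    using assms(2)[of x] assms(3) by (subst pnorm_degree_le[of _ N]) (auto intro: degree_diff_le)
  ultimately show ?thesis by simp
qed

lemma pnorm_imp_pconv:
  assumes "((\<lambda>x. pnorm (f x - p)) \<longlongrightarrow> 0) F"
  shows "pconv f p F"
  unfolding pconv_def
proof
  fix k
  have "((\<lambda>x. coeff (f x) k - coeff p k) \<longlongrightarrow> 0) F"
    by (rule Lim_null_comparison[OF _ assms])
      (auto simp: cmod_coeff_le_pnorm simp flip: coeff_diff)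
  then show "((\<lambda>x. coeff (f x) k) \<longlongrightarrow> coeff p k) F" by (rule LIM_zero_cancel)
qed

lemma tendsto_pnorm:
  assumes "pconv f p F" "\<And>x. degree (f x) \<le> N" "degree p \<le> N"
  shows "((\<lambda>x. pnorm (f x)) \<longlongrightarrow> pnorm p) F"
  unfolding pnorm_degree_le[OF assms(2)] pnorm_degree_le[OF assms(3)]
  by (intro tendsto_intros pconvD[OF assms(1)])

lemma poly_degree_le_sum:
  "degree p \<le> N \<Longrightarrow> poly p (t :: 'a::comm_semiring_1) = (\<Sum>k\<le>N. coeff p k * t ^ k)"
  unfolding poly_altdef by (intro sum.mono_neutral_left) (auto simp: coeff_eq_0)

lemma tendsto_poly:
  assumes "pconv f p F" "(t \<longlongrightarrow> s) F" "\<And>x. degree (f x) \<le> N" "degree p \<le> N"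
  shows "((\<lambda>x. poly (f x) (t x)) \<longlongrightarrow> poly p s) F"
  unfolding poly_degree_le_sum[OF assms(3)] poly_degree_le_sum[OF assms(4)]
  by (intro tendsto_intros pconvD assms)

lemma bounded_seq_convergent_subseq_finite:
  fixes f :: "'i \<Rightarrow> nat \<Rightarrow> 'a::heine_borel"
  assumes "finite I" "\<And>i. i \<in> I \<Longrightarrow> bounded (range (f i))"
  shows "\<exists>r l. strict_mono (r :: nat \<Rightarrow> nat) \<and> (\<forall>i\<in>I. (f i \<circ> r) \<longlonglongrightarrow> l i)"
  using assms
proof (induction I rule: finite_induct)
  case empty
  show ?case by (intro exI[of _ id]) (auto simp: strict_mono_def)
next
  case (insert i I)
  then obtain r l where r: "strict_mono (r :: nat \<Rightarrow> nat)" "\<forall>i\<in>I. (f i \<circ> r) \<longlonglongrightarrow> l i" by blast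
  have "bounded (range (f i \<circ> r))"
    by (rule bounded_subset[OF insert.prems[of i]]) auto
  then obtain q a where q: "strict_mono (q :: nat \<Rightarrow> nat)" "((f i \<circ> r) \<circ> q) \<longlonglongrightarrow> a"
    using bounded_imp_convergent_subsequence by blast
  have "(f j \<circ> (r \<circ> q)) \<longlonglongrightarrow> (l(i := a)) j" if "j \<in> insert i I" for j
    using that q r insert.hyps LIMSEQ_subseq_LIMSEQ[OF _ q(1), of "f j \<circ> r" "l j"]
    by (cases "j = i") (auto simp: o_assoc)
  then show ?case using strict_mono_o[OF r(1) q(1)] by (intro exI[of _ "r \<circ> q"] exI[of _ "l(i := a)"]) blast
qed

lemma poly_tuple_convergent_subseq:
  fixes x :: "nat \<Rightarrow> nat \<Rightarrow> complex poly"
  assumes "\<And>m i. i < n \<Longrightarrow> degree (x m i) \<le> d i" "\<And>m i. i < n \<Longrightarrow> pnorm (x m i) \<le> B"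
  shows "\<exists>r y. strict_mono (r :: nat \<Rightarrow> nat) \<and>
    (\<forall>i<n. degree (y i) \<le> d i \<and> pconv (\<lambda>m. x (r m) i) (y i) sequentially)"
proof -
  let ?I = "SIGMA i:{..<n}. {..d i}"
  have "\<exists>r l. strict_mono (r :: nat \<Rightarrow> nat) \<and>
      (\<forall>ik\<in>?I. ((\<lambda>m. coeff (x m (fst ik)) (snd ik)) \<circ> r) \<longlonglongrightarrow> l ik)"
  proof (rule bounded_seq_convergent_subseq_finite)
    fix ik assume "ik \<in> ?I"
    then have "cmod (coeff (x m (fst ik)) (snd ik)) \<le> B" for m
      using order_trans[OF cmod_coeff_le_pnorm assms(2), of "fst ik"] by auto
    then show "bounded (range (\<lambda>m. coeff (x m (fst ik)) (snd ik)))"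
      by (auto simp: bounded_iff)
  qed auto
  then obtain r l where r: "strict_mono (r :: nat \<Rightarrow> nat)"
    and l: "\<And>i k. i < n \<Longrightarrow> k \<le> d i \<Longrightarrow> (\<lambda>m. coeff (x (r m) i) k) \<longlonglongrightarrow> l (i, k)"
    by (force simp: o_def)
  define y where "y i = (\<Sum>k\<le>d i. monom (l (i, k)) k)" for i
  have deg: "degree (y i) \<le> d i" for i
    unfolding y_def by (intro degree_sum_le) (auto intro: order_trans[OF degree_monom_le])
  have co: "coeff (y i) k = (if k \<le> d i then l (i, k) else 0)" for i k
    by (simp add: y_def coeff_sum)
  have "(\<lambda>m. coeff (x (r m) i) k) \<longlonglongrightarrow> coeff (y i) k" if "i < n" for i k
  proof (cases "k \<le> d i")
    case True
    then show ?thesis using l[OF that] by (simp add: co)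
  next
    case False
    then have "coeff (x (r m) i) k = 0" for m using assms(1)[OF that, of "r m"] by (simp add: coeff_eq_0)
    with False show ?thesis by (simp add: co)
  qed
  with r deg show ?thesis unfolding pconv_def by blast
qed

text \<open>A nonconstant polynomial is proper, and uniformly so along a convergent sequence of no
  larger degree, because the leading coefficients stay away from 0. This bounds the preimages whose
  limits are taken later.\<close>

lemma pconv_preimage_bounded:
  fixes f :: "nat \<Rightarrow> complex poly"
  assumes f: "pconv f p sequentially" "\<And>m. degree (f m) \<le> degree p" and deg: "degree p > 0"
    and C: "\<And>m. cmod (poly (f m) (s m)) \<le> C"
  shows "bounded (range s)"
proof -
  define N where "N = degree p"
  define L where "L = cmod (coeff p N)"
  have "L > 0" using deg by (auto simp: L_def N_def)
  have "(\<lambda>m. cmod (coeff (f m) N)) \<longlonglongrightarrow> L"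
    unfolding L_def by (intro tendsto_norm pconvD f)
  then have "\<forall>\<^sub>F m in sequentially. cmod (coeff (f m) N) > L / 2"
    using \<open>L > 0\<close> by (intro order_tendstoD(1)) auto
  moreover have "(\<lambda>m. pnorm (f m)) \<longlonglongrightarrow> pnorm p"
    by (rule tendsto_pnorm[OF f]) auto
  then have "\<forall>\<^sub>F m in sequentially. pnorm (f m) < pnorm p + 1"
    by (rule order_tendstoD(2)) auto
  \<comment> \<open>For \<open>r = cmod (s m) > 1\<close> the leading term gives
    \<open>L / 2 * r ^ N \<le> C + (pnorm p + 1) * r ^ (N - 1)\<close>; absorbing \<open>C\<close>
    into the power and dividing by \<open>r ^ (N - 1)\<close> yields the bound.\<close>
  ultimately have "\<forall>\<^sub>F m in sequentially. cmod (s m) \<le> max 1 ((C + pnorm p + 1) / (L / 2))"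
  proof eventually_elim
    case (elim m)
    let ?r = "cmod (s m)"
    show ?case
    proof (cases "?r \<le> 1")
      case False
      have split: "poly (f m) (s m) = (\<Sum>k<N. coeff (f m) k * s m ^ k) + coeff (f m) N * s m ^ N"
        using poly_degree_le_sum[OF f(2)[of m], of "s m"]
        unfolding N_def[symmetric] by (simp add: lessThan_Suc_atMost[symmetric])
      have "cmod (\<Sum>k<N. coeff (f m) k * s m ^ k) \<le> (\<Sum>k<N. cmod (coeff (f m) k) * ?r ^ (N - 1))"
      proof (rule order_trans[OF norm_sum], rule sum_mono)
        fix k assume "k \<in> {..<N}"
        then have "?r ^ k \<le> ?r ^ (N - 1)" using False by (intro power_increasing) auto
        then show "cmod (coeff (f m) k * s m ^ k) \<le> cmod (coeff (f m) k) * ?r ^ (N - 1)"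
          unfolding norm_mult norm_power by (rule mult_left_mono) simp
      qed
      also have "\<dots> = (\<Sum>k<N. cmod (coeff (f m) k)) * ?r ^ (N - 1)" by (simp add: sum_distrib_right)
      also have "\<dots> \<le> pnorm (f m) * ?r ^ (N - 1)"
        unfolding pnorm_degree_le[OF f(2)[of m, folded N_def]]
        by (intro mult_right_mono sum_mono2) auto
      also have "\<dots> \<le> (pnorm p + 1) * ?r ^ (N - 1)"
        using elim(2) by (intro mult_right_mono) auto
      finally have low: "cmod (\<Sum>k<N. coeff (f m) k * s m ^ k) \<le> (pnorm p + 1) * ?r ^ (N - 1)" .
      have "0 \<le> C" using C[of m] norm_ge_zero order_trans by blast
      have "L / 2 * ?r ^ N \<le> cmod (coeff (f m) N * s m ^ N)"
        unfolding norm_mult norm_power using elim(1) by (intro mult_right_mono) auto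
      also have "\<dots> \<le> C + (pnorm p + 1) * ?r ^ (N - 1)"
        using norm_triangle_ineq4[of "poly (f m) (s m)" "\<Sum>k<N. coeff (f m) k * s m ^ k"] low C[of m]
        unfolding split by simp
      also have "\<dots> \<le> C * ?r ^ (N - 1) + (pnorm p + 1) * ?r ^ (N - 1)"
        using False \<open>0 \<le> C\<close> one_le_power[of ?r "N - 1"] mult_left_mono[of 1 "?r ^ (N - 1)" C] by simp
      finally have "L / 2 * ?r * ?r ^ (N - 1) \<le> (C + pnorm p + 1) * ?r ^ (N - 1)"
        using deg unfolding N_def by (simp add: algebra_simps power_eq_if)
      moreover have "?r ^ (N - 1) > 0" using False by (intro zero_less_power) linarith
      ultimately have "L / 2 * ?r \<le> C + pnorm p + 1" using mult_right_le_imp_le by blast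
      then have "?r \<le> (C + pnorm p + 1) / (L / 2)" using \<open>L > 0\<close> by (simp add: field_simps)
      then show ?thesis by simp
    qed simp
  qed
  then obtain B where "\<forall>\<^sub>F m in sequentially. cmod (s m) \<le> B" by blast
  then show ?thesis by (metis Bseq_eq_bounded BfunI)
qed

section \<open>The model hypersurface and its solutions\<close>

definition rescale :: "complex \<Rightarrow> complex poly \<Rightarrow> complex poly" where
  "rescale \<kappa> p = pcompose p [:0, \<kappa>:]"

lemma coeff_rescale: "coeff (rescale \<kappa> p) k = \<kappa> ^ k * coeff p k"
  by (simp add: rescale_def coeff_pcompose_linear)

lemma poly_rescale: "poly (rescale \<kappa> p) t = poly p (\<kappa> * t)"
  by (simp add: rescale_def poly_pcompose mult.commute)

lemma degree_rescale_le: "degree (rescale \<kappa> p) \<le> degree p"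
  by (intro degree_le) (simp add: coeff_rescale coeff_eq_0)

lemma pnorm_rescale_unit: assumes "cmod \<kappa> = 1" shows "pnorm (rescale \<kappa> p) = pnorm p"
  unfolding pnorm_degree_le[OF degree_rescale_le]
  unfolding pnorm_def coeff_rescale norm_mult norm_power
  using assms by simp

lemma rescale_diff: "rescale \<kappa> (p - q) = rescale \<kappa> p - rescale \<kappa> q"
  by (simp add: poly_eq_iff coeff_rescale algebra_simps)

lemma pcompose_power: "pcompose (p ^ k) q = pcompose p q ^ k" for p q :: "complex poly"
  by (induction k) (auto simp: pcompose_mult pcompose_1)

lemma fcomp_rescale: "fcomp n D c (\<lambda>i. rescale \<kappa> (x i)) = rescale \<kappa> (fcomp n D c x)"
  unfolding fcomp_def rescale_def
  by (simp add: pcompose_sum pcompose_smult pcompose_prod pcompose_power)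

lemma param_eq_iff: "param n x s = param n y t \<longleftrightarrow> (\<forall>i<n. poly (x i) s = poly (y i) t)"
  unfolding param_def fun_eq_iff by auto

lemma range_param_rescale:
  assumes "\<kappa> \<noteq> 0" "\<And>i. i < n \<Longrightarrow> y i = rescale \<kappa> (x i)"
  shows "range (param n y) = range (param n x)"
proof -
  have "param n y t = param n x (\<kappa> * t)" for t
    unfolding param_eq_iff using assms(2) by (simp add: poly_rescale)
  moreover have "range (\<lambda>t. param n x (\<kappa> * t)) = range (param n x)"
    using assms(1) by (auto simp: image_iff) (metis nonzero_mult_div_cancel_left times_divide_eq_right)
  ultimately show ?thesis by simp
qed

lemma one_fold_rescale:
  assumes "\<kappa> \<noteq> 0" "\<And>i. i < n \<Longrightarrow> y i = rescale \<kappa> (x i)" "one_fold n x"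
  shows "one_fold n y"
proof -
  have eq: "param n y t = param n x (\<kappa> * t)" for t
    unfolding param_eq_iff using assms(2) by (simp add: poly_rescale)
  have "(*) \<kappa> ` {t. \<exists>s. s \<noteq> t \<and> param n y s = param n y t} \<subseteq>
      {t. \<exists>s. s \<noteq> t \<and> param n x s = param n x t}"
  proof safe
    fix t s assume "s \<noteq> t" "param n y s = param n y t"
    then show "\<exists>s. s \<noteq> \<kappa> * t \<and> param n x s = param n x (\<kappa> * t)"
      using assms(1) by (intro exI[of _ "\<kappa> * s"]) (simp add: eq)
  qed
  then have "finite ((*) \<kappa> ` {t. \<exists>s. s \<noteq> t \<and> param n y s = param n y t})"
    using assms(3) unfolding one_fold_def by (rule finite_subset)
  then show ?thesis unfolding one_fold_def
    using assms(1) by (auto dest!: finite_imageD simp: inj_on_def)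
qed

lemma finite_mons: "finite (mons n D)"
proof (rule finite_subset)
  show "mons n D \<subseteq> {\<alpha>. \<forall>i. (i \<in> {..<n} \<longrightarrow> \<alpha> i \<in> {..D}) \<and> (i \<notin> {..<n} \<longrightarrow> \<alpha> i = 0)}"
  proof
    fix \<alpha> assume \<alpha>: "\<alpha> \<in> mons n D"
    have "\<alpha> i \<le> D" if "i < n" for i
      using \<alpha> member_le_sum[of i "{..<n}" \<alpha>] that by (auto simp: mons_def)
    with \<alpha> show "\<alpha> \<in> {\<alpha>. \<forall>i. (i \<in> {..<n} \<longrightarrow> \<alpha> i \<in> {..D}) \<and> (i \<notin> {..<n} \<longrightarrow> \<alpha> i = 0)}"
      by (auto simp: mons_def)
  qed
qed (rule finite_set_of_finite_funs; simp)

text \<open>The coefficients of \<open>(\<Prod>i<n. 1 + x i) - 1\<close>: each nonconstant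
  squarefree monomial occurs once.\<close>

definition model_coeff :: "(nat \<Rightarrow> nat) \<Rightarrow> complex" where
  "model_coeff \<alpha> = (if \<forall>i. \<alpha> i \<le> 1 then 1 else 0)"

text \<open>Squarefree monomials correspond to the nonempty subsets of \<open>{..<n}\<close>;
  \<open>n \<le> D\<close> ensures that the largest of them is not cut off by
  \<open>mons n D\<close>.\<close>

lemma fcomp_model:
  assumes "n \<le> D"
  shows "fcomp n D model_coeff x = (\<Prod>i<n. 1 + x i) - 1"
proof -
  let ?ind = "\<lambda>S i. if i \<in> S then 1 else 0 :: nat"
  have "fcomp n D model_coeff x = (\<Sum>\<alpha>\<in>{\<alpha> \<in> mons n D. \<forall>i. \<alpha> i \<le> 1}. \<Prod>i<n. x i ^ \<alpha> i)"
    unfolding fcomp_def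
    by (intro sum.mono_neutral_cong_right finite_mons) (auto simp: model_coeff_def)
  also have "\<dots> = (\<Sum>S\<in>Pow {..<n} - {{}}. \<Prod>i\<in>S. x i)"
  proof (rule sum.reindex_bij_witness[of _ ?ind "\<lambda>\<alpha>. {i. \<alpha> i = 1}"])
    fix \<alpha> assume \<alpha>: "\<alpha> \<in> {\<alpha> \<in> mons n D. \<forall>i. \<alpha> i \<le> 1}"
    then show "?ind {i. \<alpha> i = 1} = \<alpha>" by (auto simp: fun_eq_iff le_Suc_eq)
    have out: "\<alpha> i = 0" if "i \<ge> n" for i using \<alpha> that by (auto simp: mons_def)
    then have sub: "{i. \<alpha> i = 1} \<subseteq> {..<n}" by (metis (mono_tags, lifting) lessThan_iff mem_Collect_eq not_less subsetI zero_neq_one)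
    have "(\<Sum>i<n. \<alpha> i) \<noteq> 0" using \<alpha> unfolding mons_def by force
    then have "\<exists>i<n. \<alpha> i \<noteq> 0" by (auto simp del: neq0_conv)
    then obtain i where "\<alpha> i \<noteq> 0" by blast
    then have "\<alpha> i = 1" using \<alpha> le_antisym[of "\<alpha> i" 1] by auto
    then have "{i. \<alpha> i = 1} \<noteq> {}" by blast
    with sub show "{i. \<alpha> i = 1} \<in> Pow {..<n} - {{}}" by blast
    show "(\<Prod>i | \<alpha> i = 1. x i) = (\<Prod>i<n. x i ^ \<alpha> i)"
    proof (rule prod.mono_neutral_cong_left)
      have "\<alpha> i = 0" if "\<alpha> i \<noteq> 1" for i
      proof -
        have "\<alpha> i \<le> 1" using \<alpha> by blast
        with that show ?thesis by linarith
      qed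
      then show "\<forall>i\<in>{..<n} - {i. \<alpha> i = 1}. x i ^ \<alpha> i = 1"
        by (metis (mono_tags, lifting) Diff_iff mem_Collect_eq power_0)
    qed (use sub in auto)
  next
    fix S assume S: "S \<in> Pow {..<n} - {{}}"
    then show "{i. ?ind S i = 1} = S" by auto
    have "(\<Sum>i<n. ?ind S i) = card S"
      using S by (simp add: sum.If_cases Int_absorb1)
    moreover have "card S \<le> n" using S card_mono[of "{..<n}" S] by simp
    moreover have "card S \<ge> 1" using S finite_subset[of S "{..<n}"] by (auto simp: Suc_le_eq card_gt_0_iff)
    ultimately show "?ind S \<in> {\<alpha> \<in> mons n D. \<forall>i. \<alpha> i \<le> 1}"
      using S assms by (auto simp: mons_def)
  qed
  also have "\<dots> = (\<Sum>S\<in>Pow {..<n}. \<Prod>i\<in>S. x i) - 1"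
    by (subst sum_diff1) auto
  also have "(\<Sum>S\<in>Pow {..<n}. \<Prod>i\<in>S. x i) = (\<Prod>i<n. 1 + x i)"
    using prod_add[of "{..<n}" x "\<lambda>_. 1"] by (simp add: add.commute)
  finally show ?thesis .
qed

section \<open>Solutions of the model equation and words\<close>

locale osculation =
  fixes n :: nat and d :: "nat \<Rightarrow> nat"
  assumes n_pos: "n \<ge> 1" and d_pos: "i < n \<Longrightarrow> d i > 0"
begin

abbreviation "D \<equiv> dsum n d"

definition \<omega> :: complex where "\<omega> = cis (2 * pi / real D)"

lemma n_le_D: "n \<le> D"
proof -
  have "(\<Sum>i<n. 1) \<le> D" unfolding Defs.dsum_def using d_pos by (intro sum_mono) (simp add: Suc_le_eq)
  then show ?thesis by simp
qed

lemma D_pos: "D > 0"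
  using n_le_D n_pos by simp

lemma d_le_D: "i < n \<Longrightarrow> d i \<le> D"
  unfolding Defs.dsum_def by (intro member_le_sum) auto

lemma \<omega>_power: "\<omega> ^ k = cis (2 * pi * real k / real D)"
  unfolding \<omega>_def Complex.DeMoivre by (simp add: mult_ac)

lemma \<omega>_power_D: "\<omega> ^ D = 1"
  using D_pos by (simp add: \<omega>_power)

lemma \<omega>_nonzero: "\<omega> \<noteq> 0"
  by (simp add: \<omega>_def)

lemma cmod_\<omega>: "cmod (\<omega> ^ k) = 1"
  by (simp add: \<omega>_power)

lemma \<omega>_power_mod: "\<omega> ^ (k mod D) = \<omega> ^ k"
proof -
  have "\<omega> ^ k = \<omega> ^ (D * (k div D) + k mod D)" by simp
  also have "\<dots> = \<omega> ^ (k mod D)" by (simp only: power_add power_mult \<omega>_power_D) simp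
  finally show ?thesis by simp
qed

lemma bij_\<omega>: "bij_betw (\<lambda>k. \<omega> ^ k) {..<D} {z. z ^ D = 1}"
  unfolding \<omega>_power using Complex.bij_betw_roots_unity[OF D_pos] by simp

lemma \<omega>_power_inj: "j < D \<Longrightarrow> k < D \<Longrightarrow> \<omega> ^ j = \<omega> ^ k \<Longrightarrow> j = k"
  using bij_betw_imp_inj_on[OF bij_\<omega>] by (auto simp: inj_on_def)

lemma power_D_eqE:
  assumes "s ^ D = t ^ D"
  obtains r where "r < D" "s = \<omega> ^ r * t"
proof (cases "t = 0")
  case True
  then have "s = 0" using assms D_pos by (simp add: power_0_left)
  then show ?thesis using that[of 0] True D_pos by simp
next
  case False
  then have "(s / t) ^ D = 1" using assms by (simp add: power_divide)
  then obtain r where "r < D" "s / t = \<omega> ^ r"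
    using bij_betw_imp_surj_on[OF bij_\<omega>] by (metis (mono_tags, lifting) imageE lessThan_iff mem_Collect_eq)
  then show ?thesis using that[of r] False by (simp add: field_simps)
qed

text \<open>Degrees are bounded rather than prescribed, so the condition is linear and closed under
  limits; exact degrees are recovered near the model.\<close>

definition tuple :: "(nat \<Rightarrow> complex poly) \<Rightarrow> bool" where
  "tuple x \<longleftrightarrow> (\<forall>i<n. degree (x i) \<le> d i \<and> coeff (x i) 0 = 0)"

text \<open>The normalisation -1 turns the model equation into a product equal to
  \<open>1 - t^D\<close>, whose roots are the powers of \<open>\<omega>\<close>. The
  reparametrizations \<open>t \<mapsto> \<kappa> t\<close> that preserve it are those with
  \<open>\<kappa> ^ D = 1\<close>.\<close>

definition solution :: "((nat \<Rightarrow> nat) \<Rightarrow> complex) \<Rightarrow> (nat \<Rightarrow> complex poly) \<Rightarrow> bool" where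
  "solution c x \<longleftrightarrow> tuple x \<and> (\<forall>k<D. coeff (fcomp n D c x) k = 0) \<and> coeff (fcomp n D c x) D = - 1"

text \<open>The bead at position \<open>k\<close> owns the root \<open>\<omega> ^ k\<close>, and a
  colour collects the linear factors of its beads, scaled to have value 1 at 0 as
  \<open>1 + x i\<close> must.\<close>

definition bead_poly :: "nat list \<Rightarrow> nat \<Rightarrow> complex poly" where
  "bead_poly w i = (\<Prod>k | k < D \<and> w ! k = i. [:1, - inverse (\<omega> ^ k):])"

definition word_tuple :: "nat list \<Rightarrow> nat \<Rightarrow> complex poly" where
  "word_tuple w i = bead_poly w i - 1"

lemma tuple_rescale: "tuple x \<Longrightarrow> tuple (\<lambda>i. rescale \<kappa> (x i))"
  unfolding tuple_def using degree_rescale_le order_trans by (fastforce simp: coeff_rescale)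

lemma solution_rescale: "solution c x \<Longrightarrow> \<kappa> ^ D = 1 \<Longrightarrow> solution c (\<lambda>i. rescale \<kappa> (x i))"
  unfolding solution_def fcomp_rescale by (auto simp: coeff_rescale tuple_rescale)

lemma degree_prod_tuple:
  assumes "tuple x"
  shows "degree (\<Prod>i<n. 1 + x i) \<le> D"
proof -
  have "degree (\<Prod>i<n. 1 + x i) \<le> (\<Sum>i<n. degree (1 + x i))"
    using degree_prod_sum_le[of "{..<n}" "\<lambda>i. 1 + x i"] by (simp add: o_def)
  also have "\<dots> \<le> D" unfolding Defs.dsum_def
    using assms by (intro sum_mono) (auto simp: tuple_def intro!: degree_add_le)
  finally show ?thesis .
qed

lemma coeff_fcomp_0: assumes "tuple x" shows "coeff (fcomp n K c x) 0 = 0"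
proof -
  have "(\<Prod>i<n. poly (x i) 0 ^ \<alpha> i) = 0" if "\<alpha> \<in> mons n K" for \<alpha>
  proof -
    have "(\<Sum>i<n. \<alpha> i) \<noteq> 0" using that unfolding mons_def by force
    then have "\<exists>i<n. \<alpha> i \<noteq> 0" by (auto simp del: neq0_conv)
    then show ?thesis using assms by (auto simp: tuple_def poly_0_coeff_0)
  qed
  then have "(\<Sum>\<alpha>\<in>mons n K. c \<alpha> * (\<Prod>i<n. poly (x i) 0 ^ \<alpha> i)) = 0"
    by (intro sum.neutral) (simp del: prod_zero_iff)
  then show ?thesis
    by (simp add: fcomp_def poly_sum poly_prod flip: poly_0_coeff_0)
qed

lemma prod_tuple_eqI:
  assumes "tuple x" "\<And>k. k < D \<Longrightarrow> coeff (fcomp n D model_coeff x) k = 0"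
  shows "(\<Prod>i<n. 1 + x i) = 1 + monom (coeff (fcomp n D model_coeff x) D) D"
proof (rule poly_eqI)
  fix k
  have *: "(\<Prod>i<n. 1 + x i) = fcomp n D model_coeff x + 1" by (simp add: fcomp_model[OF n_le_D])
  consider "k < D" | "k = D" | "k > D" by linarith
  then show "coeff (\<Prod>i<n. 1 + x i) k = coeff (1 + monom (coeff (fcomp n D model_coeff x) D) D) k"
  proof cases
    case 3
    then have "coeff (\<Prod>i<n. 1 + x i) k = 0" using degree_prod_tuple[OF assms(1)] by (simp add: coeff_eq_0)
    with 3 show ?thesis by (simp add: coeff_1)
  qed (use assms(2) * D_pos in \<open>auto simp: coeff_1\<close>)
qed

text \<open>Absence of solutions at infinity: if the product of the \<open>1 + x i\<close> is 1,
  each factor is a unit, hence constant, and its value at 0 is 1.\<close>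

lemma tuple_model_zero:
  assumes "tuple x" "\<And>k. k \<le> D \<Longrightarrow> coeff (fcomp n D model_coeff x) k = 0" "i < n"
  shows "x i = 0"
proof -
  have prod: "(\<Prod>i<n. 1 + x i) = 1" using prod_tuple_eqI[OF assms(1)] assms(2) by simp
  then have "(1 + x i) dvd 1" using dvd_prodI[of "{..<n}" i "\<lambda>i. 1 + x i"] assms(3) by simp
  then have "degree (1 + x i) = 0" by (metis degree_1 dvd_imp_degree_le le_zero_eq one_neq_zero)
  moreover have "coeff (1 + x i) 0 = 1" using assms(1,3) by (simp add: tuple_def)
  ultimately have "1 + x i = 1" by (metis degree_0_id one_pCons)
  then show ?thesis by simp
qed

lemma solution_model_prod:
  "solution model_coeff x \<Longrightarrow> (\<Prod>i<n. 1 + x i) = 1 - monom 1 D"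
  using prod_tuple_eqI[of x] by (auto simp: solution_def minus_monom[symmetric])

text \<open>The common value at 0 is one more interpolation node besides the roots, so degree
  \<open>card K\<close>, not only less, is determined.\<close>

lemma poly_eq_if_eq_on_roots:
  assumes "poly p 0 = poly q 0" "\<And>k. k \<in> K \<Longrightarrow> poly p (\<omega> ^ k) = poly q (\<omega> ^ k)"
    and "K \<subseteq> {..<D}" "degree p \<le> card K" "degree q \<le> card K"
  shows "p = q"
proof -
  have fin: "finite K" using assms(3) finite_subset by blast
  have inj: "inj_on (\<lambda>k. \<omega> ^ k) K"
    using bij_betw_imp_inj_on[OF bij_\<omega>] assms(3) inj_on_subset by blast
  have "0 \<notin> (\<lambda>k. \<omega> ^ k) ` K" using \<omega>_nonzero by auto
  then have card: "card (insert 0 ((\<lambda>k. \<omega> ^ k) ` K)) = Suc (card K)"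
    using fin card_image[OF inj] by simp
  show ?thesis
    by (rule poly_eqI_degree[of "insert 0 ((\<lambda>k. \<omega> ^ k) ` K)"]) (use assms card in auto)
qed

lemma length_d_word: assumes "w \<in> d_words n d" shows "length w = D"
proof -
  have "(\<Sum>i<n. count_list w i) = length w"
    using assms by (intro sum_count_set) (auto simp: d_words_def)
  then show ?thesis using assms by (simp add: d_words_def Defs.dsum_def)
qed

lemma nth_d_word: assumes "w \<in> d_words n d" "k < D" shows "w ! k < n"
proof -
  have "w ! k \<in> set w" using length_d_word[OF assms(1)] assms(2) by simp
  then show ?thesis using assms(1) unfolding d_words_def by blast
qed

lemma card_beads:
  assumes "w \<in> d_words n d" "i < n"
  shows "card {k. k < D \<and> w ! k = i} = d i"
proof -
  have "count_list w i = card {k. k < length w \<and> i = w ! k}"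
    by (simp add: count_list_eq_length_filter length_filter_conv_card)
  moreover have "{k. k < length w \<and> i = w ! k} = {k. k < D \<and> w ! k = i}"
    using length_d_word[OF assms(1)] by auto
  ultimately show ?thesis using assms by (simp add: d_words_def)
qed

lemma poly_bead_poly_0: "poly (bead_poly w i) 0 = 1"
  by (simp add: bead_poly_def poly_prod)

lemma poly_bead_poly_root: assumes "k < D" shows "poly (bead_poly w i) (\<omega> ^ k) = 0 \<longleftrightarrow> w ! k = i"
proof -
  have "1 - \<omega> ^ k * inverse (\<omega> ^ j) = 0 \<longleftrightarrow> j = k" if "j < D" for j
    using \<omega>_power_inj[OF that assms] \<omega>_nonzero by (auto simp: field_simps)
  then show ?thesis using assms by (auto simp: bead_poly_def poly_prod)
qed

lemma degree_bead_poly: assumes "w \<in> d_words n d" "i < n" shows "degree (bead_poly w i) = d i"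
proof -
  have "degree (bead_poly w i) = (\<Sum>k | k < D \<and> w ! k = i. degree [:1, - inverse (\<omega> ^ k):])"
    unfolding bead_poly_def by (intro degree_prod_eq_sum_degree) auto
  also have "\<dots> = d i" using \<omega>_nonzero card_beads[OF assms] by simp
  finally show ?thesis .
qed

lemma bead_poly_eqI:
  assumes w: "w \<in> d_words n d" "i < n" and "degree p \<le> d i" "poly p 0 = 1"
    and "\<And>k. k < D \<Longrightarrow> w ! k = i \<Longrightarrow> poly p (\<omega> ^ k) = 0"
  shows "p = bead_poly w i"
  by (rule poly_eq_if_eq_on_roots[where K = "{k. k < D \<and> w ! k = i}"])
    (use assms in \<open>auto simp: card_beads[OF w] degree_bead_poly[OF w] poly_bead_poly_0 poly_bead_poly_root\<close>)

lemma degree_word_tuple: assumes "w \<in> d_words n d" "i < n" shows "degree (word_tuple w i) = d i"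
proof -
  have "degree (1 :: complex poly) < degree (bead_poly w i)"
    using degree_bead_poly[OF assms] d_pos[OF assms(2)] by simp
  then show ?thesis unfolding word_tuple_def
    using degree_bead_poly[OF assms] degree_add_eq_left[of "- 1" "bead_poly w i"] by simp
qed

lemma tuple_word_tuple: "w \<in> d_words n d \<Longrightarrow> tuple (word_tuple w)"
  unfolding tuple_def
  by (auto simp: degree_word_tuple) (simp add: word_tuple_def poly_bead_poly_0 flip: poly_0_coeff_0)

lemma prod_bead_poly: assumes "w \<in> d_words n d" shows "(\<Prod>i<n. bead_poly w i) = 1 - monom 1 D"
proof (rule poly_eq_if_eq_on_roots[where K = "{..<D}"])
  show "poly (\<Prod>i<n. bead_poly w i) 0 = poly (1 - monom 1 D) 0"
    using D_pos by (simp add: poly_prod poly_bead_poly_0 poly_monom)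
  show "poly (\<Prod>i<n. bead_poly w i) (\<omega> ^ k) = poly (1 - monom 1 D) (\<omega> ^ k)" if "k \<in> {..<D}" for k
  proof -
    have "(\<omega> ^ k) ^ D = 1" using \<omega>_power_D by (metis mult.commute power_mult power_one)
    moreover have "\<exists>i<n. poly (bead_poly w i) (\<omega> ^ k) = 0"
      using that nth_d_word[OF assms, of k] poly_bead_poly_root[of k w] by auto
    ultimately show ?thesis by (auto simp: poly_prod poly_monom)
  qed
  show "degree (\<Prod>i<n. bead_poly w i) \<le> card {..<D}"
    using degree_prod_tuple[OF tuple_word_tuple[OF assms]] by (simp add: word_tuple_def)
  show "degree (1 - monom 1 D :: complex poly) \<le> card {..<D}"
    by (simp add: degree_diff_le degree_monom_le)
qed auto

lemma fcomp_word_tuple: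
  "w \<in> d_words n d \<Longrightarrow> fcomp n D model_coeff (word_tuple w) = - monom 1 D"
  unfolding fcomp_model[OF n_le_D] word_tuple_def by (simp add: prod_bead_poly)

lemma solution_word_tuple: "w \<in> d_words n d \<Longrightarrow> solution model_coeff (word_tuple w)"
  unfolding solution_def by (simp add: tuple_word_tuple fcomp_word_tuple)

text \<open>Every root of unity kills some factor; recording one such factor per root gives a word.
  A factor of degree at most \<open>d i\<close> has at most \<open>d i\<close> of the roots, and the
  counts add up to \<open>D\<close>, so all these bounds are attained and the factors are
  determined.\<close>

lemma solution_model_is_word_tuple:
  assumes "solution model_coeff x"
  shows "\<exists>w\<in>d_words n d. \<forall>i<n. x i = word_tuple w i"
proof -
  have tup: "tuple x" using assms by (simp add: solution_def)
  have ex: "\<exists>i<n. poly (1 + x i) (\<omega> ^ k) = 0" for k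
  proof -
    have "poly (\<Prod>i<n. 1 + x i) (\<omega> ^ k) = 1 - (\<omega> ^ k) ^ D"
      unfolding solution_model_prod[OF assms] by (simp add: poly_monom)
    also have "(\<omega> ^ k) ^ D = 1" using \<omega>_power_D by (metis mult.commute power_mult power_one)
    finally show ?thesis unfolding poly_prod by (auto simp del: poly_add)
  qed
  \<comment> \<open>Any choice of a vanishing factor works; the counting below needs no
    uniqueness.\<close>
  define u where "u k = (SOME i. i < n \<and> poly (1 + x i) (\<omega> ^ k) = 0)" for k
  have u: "u k < n" "poly (1 + x (u k)) (\<omega> ^ k) = 0" for k
    using someI_ex[OF ex[of k]] by (auto simp: u_def)
  define w where "w = map u [0..<D]"
  have w_nth: "w ! k = u k" if "k < D" for k using that by (simp add: w_def)
  let ?K = "\<lambda>i. {k. k < D \<and> w ! k = i}"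
  have deg: "degree (1 + x i) \<le> d i" if "i < n" for i
    using tup that by (auto simp: tuple_def intro!: degree_add_le)
  have nz: "1 + x i \<noteq> 0" if "i < n" for i
  proof
    assume "1 + x i = 0"
    then have "poly (1 + x i) 0 = 0" by simp
    then show False using tup that by (simp add: tuple_def poly_0_coeff_0)
  qed
  have card_le: "card (?K i) \<le> d i" if "i < n" for i
  proof -
    have "inj_on (\<lambda>k. \<omega> ^ k) (?K i)"
      by (rule inj_on_subset[OF bij_betw_imp_inj_on[OF bij_\<omega>]]) auto
    then have "card (?K i) = card ((\<lambda>k. \<omega> ^ k) ` ?K i)" by (simp add: card_image)
    also have "\<dots> \<le> card {t. poly (1 + x i) t = 0}"
    proof (rule card_mono[OF poly_roots_finite[OF nz[OF that]]])
      show "(\<lambda>k. \<omega> ^ k) ` ?K i \<subseteq> {t. poly (1 + x i) t = 0}"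
      proof safe
        fix k assume "k < D" "i = w ! k"
        then show "poly (1 + x (w ! k)) (\<omega> ^ k) = 0" using u(2) w_nth by metis
      qed
    qed
    also have "\<dots> \<le> degree (1 + x i)" by (rule card_poly_roots_bound[OF nz[OF that]])
    finally show ?thesis using deg[OF that] by simp
  qed
  have cnt: "count_list w i = card (?K i)" for i
  proof -
    have "count_list w i = card {k. k < length w \<and> i = w ! k}"
      by (simp add: count_list_eq_length_filter length_filter_conv_card)
    moreover have "{k. k < length w \<and> i = w ! k} = ?K i" by (auto simp: w_def)
    ultimately show ?thesis by simp
  qed
  have set: "set w \<subseteq> {..<n}" using u by (auto simp: w_def)
  have "(\<Sum>i<n. card (?K i)) = (\<Sum>i<n. d i)"
    using sum_count_set[OF set] by (simp add: cnt) (simp add: w_def Defs.dsum_def)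
  then have "card (?K i) = d i" if "i < n" for i
    using sum_mono_inv[of "\<lambda>i. card (?K i)" "{..<n}" d i] card_le that by simp
  then have "w \<in> d_words n d" using set by (simp add: d_words_def cnt)
  moreover have "1 + x i = bead_poly w i" if "i < n" for i
  proof (rule bead_poly_eqI[OF \<open>w \<in> d_words n d\<close> that deg[OF that]])
    show "poly (1 + x i) 0 = 1" using tup that by (simp add: tuple_def poly_0_coeff_0)
    show "poly (1 + x i) (\<omega> ^ k) = 0" if "k < D" "w ! k = i" for k
      using u(2)[of k] that w_nth by simp
  qed
  ultimately show ?thesis unfolding word_tuple_def
    by (metis add_diff_cancel_left')
qed

text \<open>The letter at position \<open>k\<close> can be read off as the colour whose factor
  vanishes at \<open>\<omega> ^ k\<close>.\<close>

lemma word_tuple_inj: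
  assumes "w \<in> d_words n d" "w' \<in> d_words n d" "\<And>i. i < n \<Longrightarrow> word_tuple w i = word_tuple w' i"
  shows "w = w'"
proof (rule nth_equalityI)
  fix k assume "k < length w"
  then have k: "k < D" using length_d_word assms by simp
  have "bead_poly w (w ! k) = bead_poly w' (w ! k)"
    using assms(3)[of "w ! k"] nth_d_word[OF assms(1) k] by (simp add: word_tuple_def)
  then show "w ! k = w' ! k"
    using poly_bead_poly_root[OF k, of w "w ! k"] poly_bead_poly_root[OF k, of w' "w ! k"] by simp
qed (use assms length_d_word in simp)

lemma rotate_d_word: assumes "w \<in> d_words n d" shows "rotate r w \<in> d_words n d"
proof -
  have "count_list (rotate1 v) i = count_list v i" for v :: "nat list" and i
    by (cases v) auto
  then have "count_list (rotate r w) i = count_list w i" for i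
    by (induction r) auto
  then show ?thesis using assms by (simp add: d_words_def)
qed

text \<open>The substitution \<open>t \<mapsto> \<omega> ^ r * t\<close> moves the root
  \<open>\<omega> ^ (r + k)\<close> to \<open>\<omega> ^ k\<close>, which is the index shift of
  \<open>rotate r\<close>. Rotations of words thus become reparametrizations of one curve.\<close>

lemma word_tuple_rotate:
  assumes "w \<in> d_words n d" "i < n"
  shows "word_tuple (rotate r w) i = rescale (\<omega> ^ r) (word_tuple w i)"
proof -
  have "rescale (\<omega> ^ r) (bead_poly w i) = bead_poly (rotate r w) i"
  proof (rule bead_poly_eqI[OF rotate_d_word[OF assms(1)] assms(2)])
    show "degree (rescale (\<omega> ^ r) (bead_poly w i)) \<le> d i"
      using degree_rescale_le[of "\<omega> ^ r" "bead_poly w i"] degree_bead_poly[OF assms] by simp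
    show "poly (rescale (\<omega> ^ r) (bead_poly w i)) 0 = 1" by (simp add: poly_rescale poly_bead_poly_0)
    fix k assume "k < D" "rotate r w ! k = i"
    then have "w ! ((r + k) mod D) = i" using nth_rotate[of k w r] length_d_word[OF assms(1)] by simp
    then show "poly (rescale (\<omega> ^ r) (bead_poly w i)) (\<omega> ^ k) = 0"
      using poly_bead_poly_root[of "(r + k) mod D" w i] D_pos
      by (simp add: poly_rescale \<omega>_power_mod power_add)
  qed
  moreover have "rescale (\<omega> ^ r) 1 = 1" by (simp add: rescale_def pcompose_1)
  ultimately show ?thesis by (simp add: word_tuple_def rescale_diff)
qed

text \<open>The function \<open>\<Prod>i<n. 1 + x i\<close> on the ambient space equals
  \<open>1 - t^D\<close> along every model curve, so a point of the curve determines
  \<open>t^D\<close>.\<close>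

lemma word_tuple_power_D_eq:
  assumes w: "w \<in> d_words n d" "w' \<in> d_words n d"
    and eq: "\<And>i. i < n \<Longrightarrow> poly (word_tuple w i) s = poly (word_tuple w' i) t"
  shows "s ^ D = t ^ D"
proof -
  have "poly (\<Prod>i<n. bead_poly w i) s = poly (\<Prod>i<n. bead_poly w' i) t"
    unfolding poly_prod using eq by (intro prod.cong) (auto simp: word_tuple_def)
  then show ?thesis using w by (simp add: prod_bead_poly poly_monom)
qed

end

section \<open>Perturbing the model hypersurface\<close>

text \<open>\<open>poly_cutoff\<close> keeps the coefficients strictly below its argument, hence the
  \<open>Suc\<close>.\<close>

definition truncate :: "nat \<Rightarrow> complex poly \<Rightarrow> complex poly" where
  "truncate N p = poly_cutoff (Suc N) p"

lemma coeff_truncate: "coeff (truncate N p) k = (if k \<le> N then coeff p k else 0)"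
  by (simp add: truncate_def coeff_poly_cutoff less_Suc_eq_le)

lemma degree_truncate: "degree (truncate N p) \<le> N"
  by (intro degree_le) (simp add: coeff_truncate)

lemma truncate_diff: "truncate N (p - q) = truncate N p - truncate N q"
  by (simp add: poly_eq_iff coeff_truncate)

lemma truncate_id: "degree p \<le> N \<Longrightarrow> truncate N p = p"
  by (simp add: poly_eq_iff coeff_truncate coeff_eq_0)

lemma pnorm_truncate: "pnorm (truncate N p) \<le> pnorm p"
proof -
  have "pnorm (truncate N p) = (\<Sum>k\<le>max N (degree p). cmod (coeff (truncate N p) k))"
    by (rule pnorm_degree_le) (use degree_truncate[of N p] in linarith)
  also have "\<dots> \<le> (\<Sum>k\<le>max N (degree p). cmod (coeff p k))"
    by (intro sum_mono) (simp add: coeff_truncate)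
  also have "\<dots> = pnorm p" by (rule pnorm_degree_le[symmetric]) simp
  finally show ?thesis .
qed

lemma pconv_truncate: "pconv f p F \<Longrightarrow> pconv (\<lambda>x. truncate N (f x)) (truncate N p) F"
  unfolding pconv_def coeff_truncate by auto

lemma fcomp_conv:
  assumes "\<And>\<alpha>. \<alpha> \<in> mons n D \<Longrightarrow> ((\<lambda>m. cs m \<alpha>) \<longlongrightarrow> c \<alpha>) F"
    and "\<And>i. i < n \<Longrightarrow> pconv (\<lambda>m. xs m i) (x i) F"
  shows "pconv (\<lambda>m. fcomp n D (cs m) (xs m)) (fcomp n D c x) F"
  unfolding fcomp_def by (intro pconv_intros assms) auto

text \<open>The factors are exchanged one at a time. The identity is exact, and the cofactor of
  \<open>u i - v i\<close> tends to a partial derivative of the product when \<open>u\<close> and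
  \<open>v\<close> tend to the same limit.\<close>

lemma prod_diff_telescope:
  fixes u v :: "nat \<Rightarrow> 'a::comm_ring_1"
  shows "(\<Prod>i<n. u i) - (\<Prod>i<n. v i) =
    (\<Sum>i<n. (u i - v i) * ((\<Prod>j<i. v j) * (\<Prod>j\<in>{i<..<n}. u j)))"
proof (induction n)
  case (Suc n)
  have "(\<Prod>j\<in>{i<..<Suc n}. u j) = (\<Prod>j\<in>{i<..<n}. u j) * u n" if "i < n" for i
  proof -
    have "{i<..<Suc n} = insert n {i<..<n}" using that by auto
    then show ?thesis by (simp add: mult.commute)
  qed
  then have "(\<Sum>i<n. (u i - v i) * ((\<Prod>j<i. v j) * (\<Prod>j\<in>{i<..<Suc n}. u j))) =
      ((\<Prod>i<n. u i) - (\<Prod>i<n. v i)) * u n"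
    unfolding Suc.IH sum_distrib_right by (intro sum.cong) (auto simp: mult_ac)
  moreover have "{n<..<Suc n} = {}" by auto
  ultimately show ?case by (simp add: algebra_simps)
qed simp

text \<open>Bounded Lipschitz maps are closed under products; this controls the monomials that
  distinguish \<open>c\<close> from the model.\<close>

lemma pnorm_monomial_lipschitz:
  fixes n :: nat
  shows "\<exists>K\<ge>0. \<forall>x y. (\<forall>i<n. pnorm (x i) \<le> B \<and> pnorm (y i) \<le> B) \<longrightarrow>
    pnorm ((\<Prod>i<n. x i ^ \<alpha> i) - (\<Prod>i<n. y i ^ \<alpha> i)) \<le> K * (\<Sum>i<n. pnorm (x i - y i))"
proof -
  \<comment> \<open>The bound \<open>C\<close> is carried along because the Lipschitz constant of a
    product involves the sizes of its factors.\<close>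
  define lip where "lip f \<longleftrightarrow> (\<exists>K\<ge>0. \<exists>C\<ge>0. \<forall>x y. (\<forall>i<n. pnorm (x i) \<le> B \<and> pnorm (y i) \<le> B) \<longrightarrow>
    pnorm (f x) \<le> C \<and> pnorm (f x - f y) \<le> K * (\<Sum>i<n. pnorm (x i - y i)))"
    for f :: "(nat \<Rightarrow> complex poly) \<Rightarrow> complex poly"
  have lipI: "lip f" if "K \<ge> 0" "C \<ge> 0" "\<And>x y. \<forall>i<n. pnorm (x i) \<le> B \<and> pnorm (y i) \<le> B \<Longrightarrow>
    pnorm (f x) \<le> C \<and> pnorm (f x - f y) \<le> K * (\<Sum>i<n. pnorm (x i - y i))" for f K C
    unfolding lip_def using that by blast
  have one: "lip (\<lambda>x. 1)" by (rule lipI[of 0 1]) auto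
  have mult: "lip (\<lambda>x. f x * g x)" if f: "lip f" and g: "lip g" for f g
  proof -
    obtain K C where K: "K \<ge> 0" "C \<ge> 0" "\<And>x y. \<forall>i<n. pnorm (x i) \<le> B \<and> pnorm (y i) \<le> B \<Longrightarrow>
      pnorm (f x) \<le> C \<and> pnorm (f x - f y) \<le> K * (\<Sum>i<n. pnorm (x i - y i))"
      using f unfolding lip_def by blast
    obtain K' C' where K': "K' \<ge> 0" "C' \<ge> 0" "\<And>x y. \<forall>i<n. pnorm (x i) \<le> B \<and> pnorm (y i) \<le> B \<Longrightarrow>
      pnorm (g x) \<le> C' \<and> pnorm (g x - g y) \<le> K' * (\<Sum>i<n. pnorm (x i - y i))"
      using g unfolding lip_def by blast
    show ?thesis
    proof (rule lipI[of "K * C' + C * K'" "C * C'"], goal_cases)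
      case (3 x y)
      then have b: "\<forall>i<n. pnorm (x i) \<le> B \<and> pnorm (y i) \<le> B" .
      then have b': "\<forall>i<n. pnorm (y i) \<le> B \<and> pnorm (x i) \<le> B" by blast
      let ?s = "\<Sum>i<n. pnorm (x i - y i)"
      note fx = K(3)[OF b] and gx = K'(3)[OF b] and fy = K(3)[OF b']
      have s: "?s \<ge> 0" by (intro sum_nonneg) auto
      have bd: "pnorm (f x * g x) \<le> C * C'"
        by (rule order_trans[OF pnorm_mult mult_mono]) (use fx gx K(2) in simp_all)
      have eq: "f x * g x - f y * g y = (f x - f y) * g x + f y * (g x - g y)"
        by (simp add: algebra_simps)
      have "pnorm (f x * g x - f y * g y) \<le> pnorm (f x - f y) * pnorm (g x) + pnorm (f y) * pnorm (g x - g y)"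
        unfolding eq by (rule order_trans[OF pnorm_add add_mono[OF pnorm_mult pnorm_mult]])
      also have "\<dots> \<le> (K * ?s) * C' + C * (K' * ?s)"
        using fx gx fy K(1,2) K'(1,2) s by (intro add_mono mult_mono) simp_all
      finally have "pnorm (f x * g x - f y * g y) \<le> (K * C' + C * K') * ?s"
        by (simp add: algebra_simps)
      with bd show ?case by blast
    qed (use K K' in auto)
  qed
  have coord: "lip (\<lambda>x. x i)" if "i < n" for i
  proof -
    have "pnorm (x i - y i) \<le> (\<Sum>i<n. pnorm (x i - y i))" for x y
      using that by (intro member_le_sum) auto
    then show ?thesis using that by (intro lipI[of 1 "max B 0"]) (auto simp: le_max_iff_disj)
  qed
  have power: "lip (\<lambda>x. x i ^ k)" if "i < n" for i k
    by (induction k) (use one mult[OF coord[OF that]] in auto)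
  have "lip (\<lambda>x. \<Prod>i<m. x i ^ \<alpha> i)" if "m \<le> n" for m
    using that
  proof (induction m)
    case (Suc m)
    then show ?case using mult[of "\<lambda>x. \<Prod>i<m. x i ^ \<alpha> i" "\<lambda>x. x m ^ \<alpha> m"] power[of m] by simp
  qed (use one in simp)
  from this[of n] show ?thesis unfolding lip_def by blast
qed

section \<open>Neighbourhoods of the model coefficients and convergence of tuples\<close>

context osculation
begin

definition near :: "(((nat \<Rightarrow> nat) \<Rightarrow> complex) \<Rightarrow> bool) \<Rightarrow> bool" where
  "near P \<longleftrightarrow> (\<exists>\<epsilon>>0. \<forall>c. (\<forall>\<alpha>\<in>mons n D. cmod (c \<alpha> - model_coeff \<alpha>) < \<epsilon>) \<longrightarrow> P c)"

definition to_model :: "(nat \<Rightarrow> (nat \<Rightarrow> nat) \<Rightarrow> complex) \<Rightarrow> bool" where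
  "to_model cs \<longleftrightarrow> (\<forall>\<alpha>\<in>mons n D. (\<lambda>m. cs m \<alpha>) \<longlonglongrightarrow> model_coeff \<alpha>)"

definition tnorm :: "(nat \<Rightarrow> complex poly) \<Rightarrow> real" where
  "tnorm x = (\<Sum>i<n. pnorm (x i))"

definition tdist :: "(nat \<Rightarrow> complex poly) \<Rightarrow> (nat \<Rightarrow> complex poly) \<Rightarrow> real" where
  "tdist x y = (\<Sum>i<n. pnorm (x i - y i))"

lemma to_modelI:
  assumes "\<And>m \<alpha>. \<alpha> \<in> mons n D \<Longrightarrow> cmod (cs m \<alpha> - model_coeff \<alpha>) < inverse (real (Suc m))"
  shows "to_model cs"
  unfolding to_model_def
proof
  fix \<alpha> assume "\<alpha> \<in> mons n D"
  then have "\<forall>m. norm (cs m \<alpha> - model_coeff \<alpha>) \<le> inverse (real (Suc m))"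
    using assms less_imp_le by blast
  then have "(\<lambda>m. cs m \<alpha> - model_coeff \<alpha>) \<longlonglongrightarrow> 0"
    by (intro Lim_null_comparison[OF _ LIMSEQ_inverse_real_of_nat]) auto
  then show "(\<lambda>m. cs m \<alpha>) \<longlonglongrightarrow> model_coeff \<alpha>" by (rule LIM_zero_cancel)
qed

text \<open>If no radius works, the radii \<open>1 / (m + 1)\<close> give a sequence of
  counterexamples converging to the model. The perturbation arguments can then extract convergent
  subsequences instead of tracking estimates.\<close>

lemma nearI_seq:
  assumes "\<And>cs. to_model cs \<Longrightarrow> (\<And>m. \<not> P (cs m)) \<Longrightarrow> False"
  shows "near P"
proof (rule ccontr)
  assume "\<not> near P"
  then have "\<exists>c. (\<forall>\<alpha>\<in>mons n D. cmod (c \<alpha> - model_coeff \<alpha>) < inverse (real (Suc m))) \<and> \<not> P c" for m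
    unfolding near_def using inverse_positive_iff_positive[of "real (Suc m)"] by force
  then obtain cs where cs: "\<And>m. (\<forall>\<alpha>\<in>mons n D. cmod (cs m \<alpha> - model_coeff \<alpha>) < inverse (real (Suc m))) \<and> \<not> P (cs m)"
    by metis
  then show False by (intro assms[of cs] to_modelI) auto
qed

lemma near_seq:
  assumes "near P" "to_model cs"
  shows "\<forall>\<^sub>F m in sequentially. P (cs m)"
proof -
  obtain \<epsilon> where "\<epsilon> > 0" and P: "\<And>c. \<forall>\<alpha>\<in>mons n D. cmod (c \<alpha> - model_coeff \<alpha>) < \<epsilon> \<Longrightarrow> P c"
    using assms(1) unfolding near_def by blast
  have "\<forall>\<^sub>F m in sequentially. \<forall>\<alpha>\<in>mons n D. cmod (cs m \<alpha> - model_coeff \<alpha>) < \<epsilon>"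
    using assms(2) \<open>\<epsilon> > 0\<close> unfolding to_model_def
    by (intro eventually_ball_finite finite_mons ballI) (auto simp: tendsto_iff dist_norm)
  then show ?thesis by eventually_elim (rule P)
qed

lemma near_mono: "near P \<Longrightarrow> (\<And>c. P c \<Longrightarrow> Q c) \<Longrightarrow> near Q"
  unfolding near_def by blast

lemma near_conj: assumes "near P" "near Q" shows "near (\<lambda>c. P c \<and> Q c)"
proof -
  obtain \<epsilon> \<delta> where "\<epsilon> > 0" "\<delta> > 0"
    "\<And>c. \<forall>\<alpha>\<in>mons n D. cmod (c \<alpha> - model_coeff \<alpha>) < \<epsilon> \<Longrightarrow> P c"
    "\<And>c. \<forall>\<alpha>\<in>mons n D. cmod (c \<alpha> - model_coeff \<alpha>) < \<delta> \<Longrightarrow> Q c"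
    using assms unfolding near_def by blast
  then show ?thesis unfolding near_def by (intro exI[of _ "min \<epsilon> \<delta>"]) simp
qed

lemma near_ball: "finite A \<Longrightarrow> (\<And>w. w \<in> A \<Longrightarrow> near (P w)) \<Longrightarrow> near (\<lambda>c. \<forall>w\<in>A. P w c)"
proof (induction A rule: finite_induct)
  case empty
  show ?case unfolding near_def by (intro exI[of _ 1]) auto
next
  case (insert w A)
  then show ?case using near_conj[of "P w" "\<lambda>c. \<forall>w\<in>A. P w c"] by simp
qed

lemma to_model_subseq:
  assumes "to_model cs" "strict_mono r"
  shows "to_model (\<lambda>m. cs (r m))"
  unfolding to_model_def
proof
  fix \<alpha> assume "\<alpha> \<in> mons n D"
  then have "(\<lambda>m. cs m \<alpha>) \<longlonglongrightarrow> model_coeff \<alpha>" using assms(1) by (simp add: to_model_def)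
  from LIMSEQ_subseq_LIMSEQ[OF this assms(2)] show "(\<lambda>m. cs (r m) \<alpha>) \<longlonglongrightarrow> model_coeff \<alpha>"
    by (simp add: o_def)
qed

lemma tnorm_nonneg: "tnorm x \<ge> 0"
  unfolding tnorm_def by (intro sum_nonneg) auto

lemma tdist_nonneg: "tdist x y \<ge> 0"
  unfolding tdist_def by (intro sum_nonneg) auto

lemma tdist_eq_tnorm: "tdist x y = tnorm (\<lambda>i. x i - y i)"
  by (simp add: tdist_def tnorm_def)

lemma tnorm_eq_0_iff: "tnorm x = 0 \<longleftrightarrow> (\<forall>i<n. x i = 0)"
  unfolding tnorm_def by (subst sum_nonneg_eq_0_iff) auto

lemma tdist_self: "tdist x x = 0"
  by (simp add: tdist_def)

lemma tdist_commute: "tdist x y = tdist y x"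
  unfolding tdist_def by (simp add: pnorm_minus_commute)

lemma tdist_triangle: "tdist x z \<le> tdist x y + tdist y z"
  unfolding tdist_def sum.distrib[symmetric] by (intro sum_mono pnorm_triangle_via)

lemma pnorm_le_tnorm: "i < n \<Longrightarrow> pnorm (x i) \<le> tnorm x"
  unfolding tnorm_def by (intro member_le_sum) auto

lemma tnorm_triangle_tdist: "tnorm x \<le> tdist x y + tnorm y"
proof -
  have "pnorm (x i) \<le> pnorm (x i - y i) + pnorm (y i)" for i
    using pnorm_add[of "x i - y i" "y i"] by simp
  then show ?thesis unfolding tnorm_def tdist_def sum.distrib[symmetric] by (intro sum_mono)
qed

lemma tuple_limit:
  assumes "\<And>m. tuple (xs m)" "\<And>i. i < n \<Longrightarrow> pconv (\<lambda>m. xs m i) (x i) sequentially"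
  shows "tuple x"
proof -
  have "coeff (x i) k = 0" if "i < n" "k = 0 \<or> k > d i" for i k
  proof -
    have "coeff (xs m i) k = 0" for m
      using assms(1)[of m] that coeff_eq_0[of "xs m i" k] by (auto simp: tuple_def)
    then show ?thesis using pconvD[OF assms(2)[OF that(1)], of k] by (simp add: LIMSEQ_const_iff)
  qed
  then show ?thesis unfolding tuple_def by (auto intro!: degree_le)
qed

lemma tuple_bounded_subseq:
  assumes "\<And>m. tuple (xs m)" "\<And>m. tnorm (xs m) \<le> B"
  shows "\<exists>r y. strict_mono (r :: nat \<Rightarrow> nat) \<and> tuple y \<and>
    (\<forall>i<n. pconv (\<lambda>m. xs (r m) i) (y i) sequentially)"
proof -
  have "\<exists>r y. strict_mono (r :: nat \<Rightarrow> nat) \<and>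
      (\<forall>i<n. degree (y i) \<le> d i \<and> pconv (\<lambda>m. xs (r m) i) (y i) sequentially)"
    by (rule poly_tuple_convergent_subseq[where B = B])
      (use assms in \<open>auto simp: tuple_def intro: order_trans[OF pnorm_le_tnorm]\<close>)
  then show ?thesis using tuple_limit[of "\<lambda>m. xs (_ m)"] assms(1) by blast
qed

lemma tendsto_tnorm:
  assumes "\<And>m. tuple (xs m)" "tuple x" "\<And>i. i < n \<Longrightarrow> pconv (\<lambda>m. xs m i) (x i) sequentially"
  shows "(\<lambda>m. tnorm (xs m)) \<longlonglongrightarrow> tnorm x"
  unfolding tnorm_def
proof (intro tendsto_sum)
  fix i assume "i \<in> {..<n}"
  then show "(\<lambda>m. pnorm (xs m i)) \<longlonglongrightarrow> pnorm (x i)"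
    using assms by (intro tendsto_pnorm[where N = "d i"]) (auto simp: tuple_def)
qed

lemma tuple_add: "tuple x \<Longrightarrow> tuple y \<Longrightarrow> tuple (\<lambda>i. x i + y i)"
  unfolding tuple_def by (auto intro: degree_add_le)

lemma tuple_diff: "tuple x \<Longrightarrow> tuple y \<Longrightarrow> tuple (\<lambda>i. x i - y i)"
  unfolding tuple_def by (auto intro: degree_diff_le)

lemma tuple_smult: "tuple x \<Longrightarrow> tuple (\<lambda>i. smult a (x i))"
  unfolding tuple_def by (auto intro: order_trans[OF degree_smult_le])

lemma tnorm_smult: "tnorm (\<lambda>i. smult a (x i)) = cmod a * tnorm x"
  by (simp add: tnorm_def pnorm_smult sum_distrib_left)

lemma tendsto_tdist:
  assumes "\<And>m. tuple (xs m)" "tuple x" "tuple z" "\<And>i. i < n \<Longrightarrow> pconv (\<lambda>m. xs m i) (x i) sequentially"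
  shows "(\<lambda>m. tdist (xs m) z) \<longlonglongrightarrow> tdist x z"
  unfolding tdist_eq_tnorm using assms
  by (intro tendsto_tnorm tuple_diff pconv_intros) auto

lemma tdist_0_imp_pconv:
  assumes "(\<lambda>m. tdist (xs m) x) \<longlonglongrightarrow> 0" "i < n"
  shows "pconv (\<lambda>m. xs m i) (x i) sequentially"
proof (rule pnorm_imp_pconv)
  have "pnorm (xs m i - x i) \<le> tdist (xs m) x" for m
    unfolding tdist_def using assms(2) by (intro member_le_sum) auto
  then show "(\<lambda>m. pnorm (xs m i - x i)) \<longlonglongrightarrow> 0"
    by (intro Lim_null_comparison[OF _ assms(1)]) auto
qed

section \<open>The differential of the model equation at a word tuple\<close>

definition model_deriv :: "nat list \<Rightarrow> (nat \<Rightarrow> complex poly) \<Rightarrow> complex poly" where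
  "model_deriv w y = (\<Sum>i<n. y i * (\<Prod>j\<in>{..<n} - {i}. bead_poly w j))"

lemma model_deriv_smult: "model_deriv w (\<lambda>i. smult a (x i)) = smult a (model_deriv w x)"
  by (simp add: model_deriv_def poly_eq_iff coeff_sum sum_distrib_left)

lemma degree_model_deriv:
  assumes "w \<in> d_words n d" "tuple y"
  shows "degree (model_deriv w y) \<le> D"
  unfolding model_deriv_def
proof (intro degree_sum_le)
  fix i assume i: "i \<in> {..<n}"
  have "degree (\<Prod>j\<in>{..<n} - {i}. bead_poly w j) \<le> (\<Sum>j\<in>{..<n} - {i}. d j)"
    using degree_prod_sum_le[of "{..<n} - {i}" "bead_poly w"] degree_bead_poly[OF assms(1)]
    by (simp add: o_def)
  moreover have "degree (y i) \<le> d i" using assms(2) i by (simp add: tuple_def)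
  moreover have "D = d i + (\<Sum>j\<in>{..<n} - {i}. d j)"
    unfolding Defs.dsum_def using i by (simp add: sum.remove)
  ultimately show "degree (y i * (\<Prod>j\<in>{..<n} - {i}. bead_poly w j)) \<le> D"
    by (intro order_trans[OF degree_mult_le]) simp
qed simp

text \<open>At \<open>\<omega> ^ k\<close> every summand except that of colour \<open>w ! k\<close>
  contains the vanishing factor \<open>bead_poly w (w ! k)\<close>. The surviving cofactor is
  nonzero since the roots of unity are distinct.\<close>

lemma poly_model_deriv_root:
  assumes "w \<in> d_words n d" "k < D"
  shows "poly (model_deriv w y) (\<omega> ^ k) =
    poly (y (w ! k)) (\<omega> ^ k) * (\<Prod>j\<in>{..<n} - {w ! k}. poly (bead_poly w j) (\<omega> ^ k))"
    and "(\<Prod>j\<in>{..<n} - {w ! k}. poly (bead_poly w j) (\<omega> ^ k)) \<noteq> 0"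
proof -
  have k: "w ! k < n" by (rule nth_d_word[OF assms])
  have "(\<Prod>j\<in>{..<n} - {i}. poly (bead_poly w j) (\<omega> ^ k)) = 0" if "i \<noteq> w ! k" for i
    by (rule prod_zero) (use that k poly_bead_poly_root[OF assms(2)] in auto)
  then have "poly (model_deriv w y) (\<omega> ^ k) =
      (\<Sum>i<n. if i = w ! k then poly (y i) (\<omega> ^ k) * (\<Prod>j\<in>{..<n} - {i}. poly (bead_poly w j) (\<omega> ^ k)) else 0)"
    unfolding model_deriv_def poly_sum poly_mult poly_prod by (intro sum.cong) auto
  then show "poly (model_deriv w y) (\<omega> ^ k) =
    poly (y (w ! k)) (\<omega> ^ k) * (\<Prod>j\<in>{..<n} - {w ! k}. poly (bead_poly w j) (\<omega> ^ k))"
    using k by simp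
  show "(\<Prod>j\<in>{..<n} - {w ! k}. poly (bead_poly w j) (\<omega> ^ k)) \<noteq> 0"
    using poly_bead_poly_root[OF assms(2)] by auto
qed

text \<open>Evaluation at the roots of colour \<open>i\<close> isolates \<open>y i\<close>, which
  then vanishes at \<open>d i\<close> roots and at 0, too many points for its degree.\<close>

lemma model_deriv_inj:
  assumes "w \<in> d_words n d" "tuple y" "model_deriv w y = 0" "i < n"
  shows "y i = 0"
proof (rule poly_eq_if_eq_on_roots[where K = "{k. k < D \<and> w ! k = i}"])
  show "poly (y i) 0 = poly 0 0" using assms(2,4) by (simp add: tuple_def poly_0_coeff_0)
  show "poly (y i) (\<omega> ^ k) = poly 0 (\<omega> ^ k)" if "k \<in> {k. k < D \<and> w ! k = i}" for k
    using that poly_model_deriv_root(1)[OF assms(1), of k y] poly_model_deriv_root(2)[OF assms(1), of k]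
      assms(3) by auto
  show "degree (y i) \<le> card {k. k < D \<and> w ! k = i}"
    using assms by (simp add: card_beads tuple_def)
qed auto

lemma interpolation_at_roots:
  assumes "K \<subseteq> {..<D}"
  shows "\<exists>y. degree y \<le> card K \<and> poly y 0 = 0 \<and> (\<forall>k\<in>K. poly y (\<omega> ^ k) = v k)"
proof -
  have "finite K" using assms finite_subset by blast
  then show ?thesis using assms
  proof (induction K rule: finite_induct)
    case empty
    show ?case by (intro exI[of _ 0]) auto
  next
    case (insert k K)
    then obtain y where y: "degree y \<le> card K" "poly y 0 = 0" "\<forall>k\<in>K. poly y (\<omega> ^ k) = v k" by auto
    \<comment> \<open>Newton interpolation: \<open>q\<close> vanishes at 0 and at all earlier nodes,
      so adding a multiple of it corrects only the value at the new node.\<close>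
    define q where "q = [:0, 1:] * (\<Prod>j\<in>K. [:- (\<omega> ^ j), 1:])"
    have q: "degree q = Suc (card K)" unfolding q_def
      using insert.hyps(1) by (subst degree_mult_eq) (auto simp: degree_prod_eq_sum_degree)
    have nz: "poly q (\<omega> ^ k) \<noteq> 0"
    proof -
      have "\<omega> ^ k \<noteq> \<omega> ^ j" if "j \<in> K" for j
        using \<omega>_power_inj[of j k] insert.hyps insert.prems that by fastforce
      then show ?thesis using \<omega>_nonzero insert.hyps(1) by (auto simp: q_def poly_prod)
    qed
    have z: "poly q (\<omega> ^ j) = 0" if "j \<in> K" for j
      using that insert.hyps(1) by (auto simp: q_def poly_prod intro!: prod_zero)
    let ?y = "y + smult ((v k - poly y (\<omega> ^ k)) / poly q (\<omega> ^ k)) q"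
    have "degree ?y \<le> Suc (card K)"
      using y(1) q by (intro degree_add_le) (auto intro: order_trans[OF degree_smult_le])
    moreover have "poly ?y 0 = 0" using y by (simp add: q_def)
    moreover have "\<forall>j\<in>insert k K. poly ?y (\<omega> ^ j) = v j" using y z nz by auto
    ultimately show ?case using insert by auto
  qed
qed

text \<open>The values required of \<open>y i\<close> at its own roots are those of \<open>r\<close>
  divided by the nonzero cofactors; interpolation realises them within the degree bounds.\<close>

lemma model_deriv_surj:
  assumes w: "w \<in> d_words n d" and "degree r \<le> D" "coeff r 0 = 0"
  shows "\<exists>y. tuple y \<and> model_deriv w y = r"
proof -
  let ?Q = "\<lambda>k. \<Prod>j\<in>{..<n} - {w ! k}. poly (bead_poly w j) (\<omega> ^ k)"
  have "\<exists>y. degree y \<le> card {k. k < D \<and> w ! k = i} \<and> poly y 0 = 0 \<and>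
      (\<forall>k\<in>{k. k < D \<and> w ! k = i}. poly y (\<omega> ^ k) = poly r (\<omega> ^ k) / ?Q k)" for i
    by (rule interpolation_at_roots) auto
  then have "\<exists>y. \<forall>i. degree (y i) \<le> card {k. k < D \<and> w ! k = i} \<and> poly (y i) 0 = 0 \<and>
      (\<forall>k\<in>{k. k < D \<and> w ! k = i}. poly (y i) (\<omega> ^ k) = poly r (\<omega> ^ k) / ?Q k)"
    by (intro choice allI)
  then obtain y where y: "\<And>i. degree (y i) \<le> card {k. k < D \<and> w ! k = i}" "\<And>i. poly (y i) 0 = 0"
      "\<And>i k. k < D \<Longrightarrow> w ! k = i \<Longrightarrow> poly (y i) (\<omega> ^ k) = poly r (\<omega> ^ k) / ?Q k"
    by auto
  have tup: "tuple y" unfolding tuple_def using y(1,2) card_beads[OF w]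
    by (metis poly_0_coeff_0)
  have "model_deriv w y = r"
  proof (rule poly_eq_if_eq_on_roots[where K = "{..<D}"])
    show "poly (model_deriv w y) 0 = poly r 0"
    proof -
      have "poly r 0 = 0" using assms(3) by (simp add: poly_0_coeff_0)
      then show ?thesis by (simp add: model_deriv_def poly_sum y(2))
    qed
    show "poly (model_deriv w y) (\<omega> ^ k) = poly r (\<omega> ^ k)" if "k \<in> {..<D}" for k
      using that poly_model_deriv_root(1)[OF w, of k y] poly_model_deriv_root(2)[OF w, of k]
        y(3)[of k "w ! k"] by simp
  qed (use degree_model_deriv[OF w tup] assms in auto)
  with tup show ?thesis by blast
qed

lemma pconv_model_deriv:
  "(\<And>i. i < n \<Longrightarrow> pconv (\<lambda>m. ys m i) (y i) F) \<Longrightarrow>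
    pconv (\<lambda>m. model_deriv w (ys m)) (model_deriv w y) F"
  unfolding model_deriv_def by (intro pconv_intros) auto

text \<open>Otherwise tuples of norm 1 with images tending to 0 would have a limit of norm 1 in the
  kernel, contradicting injectivity.\<close>

lemma model_deriv_bounded_below:
  assumes w: "w \<in> d_words n d"
  shows "\<exists>K>0. \<forall>y. tuple y \<longrightarrow> tnorm y \<le> K * pnorm (model_deriv w y)"
proof (rule ccontr)
  assume "\<not> ?thesis"
  then have "\<exists>y. tuple y \<and> tnorm y > real (Suc m) * pnorm (model_deriv w y)" for m
    by (metis not_less of_nat_0_less_iff zero_less_Suc)
  then obtain ys where ys: "\<And>m. tuple (ys m)" "\<And>m. tnorm (ys m) > real (Suc m) * pnorm (model_deriv w (ys m))"
    by metis
  have pos: "tnorm (ys m) > 0" for m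
    using ys(2)[of m] by (meson le_less_trans mult_nonneg_nonneg of_nat_0_le_iff pnorm_nonneg)
  define zs where "zs m i = smult (of_real (inverse (tnorm (ys m)))) (ys m i)" for m i
  have zs: "tuple (zs m)" "tnorm (zs m) = 1" for m
    using pos[of m] unfolding zs_def by (auto simp: tuple_smult ys tnorm_smult norm_inverse)
  have small: "pnorm (model_deriv w (zs m)) \<le> inverse (real (Suc m))" for m
  proof -
    have "pnorm (model_deriv w (zs m)) = pnorm (model_deriv w (ys m)) / tnorm (ys m)"
      using pos[of m] unfolding zs_def model_deriv_smult by (simp add: pnorm_smult norm_inverse divide_inverse mult.commute)
    also have "\<dots> \<le> inverse (real (Suc m))"
    proof -
      have "pnorm (model_deriv w (ys m)) \<le> inverse (real (Suc m)) * tnorm (ys m)"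
        using ys(2)[of m] by (simp add: field_simps del: of_nat_Suc)
      then show ?thesis using pos[of m] by (simp only: pos_divide_le_eq)
    qed
    finally show ?thesis .
  qed
  obtain r y where r: "strict_mono r" "tuple y" and y: "\<And>i. i < n \<Longrightarrow> pconv (\<lambda>m. zs (r m) i) (y i) sequentially"
    using tuple_bounded_subseq[of zs 1] zs by auto
  have "(\<lambda>m. pnorm (model_deriv w (zs (r m)))) \<longlonglongrightarrow> pnorm (model_deriv w y)"
    by (intro tendsto_pnorm[where N = D] pconv_model_deriv y degree_model_deriv w r zs)
  moreover have "(\<lambda>m. pnorm (model_deriv w (zs (r m)))) \<longlonglongrightarrow> 0"
  proof (rule Lim_null_comparison)
    show "(\<lambda>m. inverse (real (Suc (r m)))) \<longlonglongrightarrow> 0"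
      using LIMSEQ_subseq_LIMSEQ[OF LIMSEQ_inverse_real_of_nat r(1)] by (simp add: o_def)
  qed (use small in auto)
  ultimately have "pnorm (model_deriv w y) = 0" by (rule LIMSEQ_unique)
  then have "model_deriv w y = 0" by simp
  then have "tnorm y = 0" using model_deriv_inj[OF w r(2)] by (simp add: tnorm_eq_0_iff)
  moreover have "(\<lambda>m. tnorm (zs (r m))) \<longlonglongrightarrow> tnorm y"
    by (intro tendsto_tnorm zs r y)
  ultimately show False by (simp add: zs(2) LIMSEQ_const_iff)
qed

lemma fcomp_diff_model:
  "fcomp n D c x = fcomp n D model_coeff x + (\<Sum>\<alpha>\<in>mons n D. smult (c \<alpha> - model_coeff \<alpha>) (\<Prod>i<n. x i ^ \<alpha> i))"
  unfolding fcomp_def by (simp add: smult_diff_left sum_subtractf)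

lemma model_diff:
  "fcomp n D model_coeff x - fcomp n D model_coeff y =
    (\<Sum>i<n. (x i - y i) * ((\<Prod>j<i. 1 + y j) * (\<Prod>j\<in>{i<..<n}. 1 + x j)))"
  unfolding fcomp_model[OF n_le_D]
  using prod_diff_telescope[of "\<lambda>i. 1 + x i" n "\<lambda>i. 1 + y i"] by simp

text \<open>Strict differentiability at the word tuple, uniform in the coefficients
  \<open>c\<close>. Comparing two arbitrary nearby tuples, rather than one with the centre, gives
  both local uniqueness and control of a correction step.\<close>

lemma strict_diff:
  assumes w: "w \<in> d_words n d" and "\<epsilon> > 0"
  shows "\<exists>\<delta>>0. \<forall>c x y. (\<forall>\<alpha>\<in>mons n D. cmod (c \<alpha> - model_coeff \<alpha>) < \<delta>) \<and> tuple x \<and> tuple y \<and>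
    tdist x (word_tuple w) \<le> \<delta> \<and> tdist y (word_tuple w) \<le> \<delta> \<longrightarrow>
    pnorm (fcomp n D c x - fcomp n D c y - model_deriv w (\<lambda>i. x i - y i)) \<le> \<epsilon> * tdist x y"
proof (rule ccontr)
  let ?W = "word_tuple w"
  assume neg: "\<not> ?thesis"
  define bad where "bad m c x y \<longleftrightarrow>
    (\<forall>\<alpha>\<in>mons n D. cmod (c \<alpha> - model_coeff \<alpha>) < inverse (real (Suc m))) \<and> tuple x \<and> tuple y \<and>
    tdist x ?W \<le> inverse (real (Suc m)) \<and> tdist y ?W \<le> inverse (real (Suc m)) \<and>
    pnorm (fcomp n D c x - fcomp n D c y - model_deriv w (\<lambda>i. x i - y i)) > \<epsilon> * tdist x y" for m c x y
  have "\<exists>c x y. bad m c x y" for m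
  proof -
    have "inverse (real (Suc m)) > 0" by simp
    with neg show ?thesis unfolding bad_def by (meson not_le)
  qed
  then obtain cs xs ys where "\<And>m. bad m (cs m) (xs m) (ys m)" by metis
  then have
    cs: "\<And>m. \<forall>\<alpha>\<in>mons n D. cmod (cs m \<alpha> - model_coeff \<alpha>) < inverse (real (Suc m))"
    and tup: "\<And>m. tuple (xs m)" "\<And>m. tuple (ys m)"
    and x: "\<And>m. tdist (xs m) ?W \<le> inverse (real (Suc m))"
    and y: "\<And>m. tdist (ys m) ?W \<le> inverse (real (Suc m))"
    and big: "\<And>m. pnorm (fcomp n D (cs m) (xs m) - fcomp n D (cs m) (ys m) -
      model_deriv w (\<lambda>i. xs m i - ys m i)) > \<epsilon> * tdist (xs m) (ys m)"
    unfolding bad_def by blast+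
  have model: "to_model cs" using cs by (intro to_modelI) auto
  have "\<forall>m. norm (tdist (xs m) ?W) \<le> inverse (real (Suc m))"
    "\<forall>m. norm (tdist (ys m) ?W) \<le> inverse (real (Suc m))"
    using x y tdist_nonneg by simp_all
  then have "(\<lambda>m. tdist (xs m) ?W) \<longlonglongrightarrow> 0" "(\<lambda>m. tdist (ys m) ?W) \<longlonglongrightarrow> 0"
    by (auto intro: Lim_null_comparison[OF always_eventually LIMSEQ_inverse_real_of_nat])
  then have xc: "pconv (\<lambda>m. xs m i) (?W i) sequentially" and yc: "pconv (\<lambda>m. ys m i) (?W i) sequentially"
    if "i < n" for i using that tdist_0_imp_pconv by blast+
  \<comment> \<open>The exact cofactors from the telescoping identity mix \<open>xs\<close> and
    \<open>ys\<close>; both sequences tend to the word tuple, so they converge to the cofactors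
    \<open>?Q\<close> of \<open>model_deriv\<close>.\<close>
  let ?K = "\<lambda>m i. (\<Prod>j<i. 1 + ys m j) * (\<Prod>j\<in>{i<..<n}. 1 + xs m j)"
  let ?Q = "\<lambda>i. \<Prod>j\<in>{..<n} - {i}. bead_poly w j"
  have "(\<lambda>m. pnorm (?K m i - ?Q i)) \<longlonglongrightarrow> 0" if i: "i < n" for i
  proof (rule pconv_imp_pnorm[where N = D])
    have split: "{..<n} - {i} = {..<i} \<union> {i<..<n}" using i by auto
    have "?Q i = (\<Prod>j<i. 1 + ?W j) * (\<Prod>j\<in>{i<..<n}. 1 + ?W j)"
      unfolding split by (subst prod.union_disjoint) (auto simp: word_tuple_def)
    moreover have "pconv (\<lambda>m. ?K m i) ((\<Prod>j<i. 1 + ?W j) * (\<Prod>j\<in>{i<..<n}. 1 + ?W j)) sequentially"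
      using i by (intro pconv_intros xc yc) auto
    ultimately show "pconv (\<lambda>m. ?K m i) (?Q i) sequentially" by simp
    have sum: "(\<Sum>j<i. d j) + (\<Sum>j\<in>{i<..<n}. d j) \<le> D"
    proof -
      have "(\<Sum>j<i. d j) + (\<Sum>j\<in>{i<..<n}. d j) = (\<Sum>j\<in>{..<n} - {i}. d j)"
        unfolding split by (subst sum.union_disjoint) auto
      also have "\<dots> \<le> D" unfolding Defs.dsum_def by (intro sum_mono2) auto
      finally show ?thesis .
    qed
    have deg: "degree (\<Prod>j\<in>A. 1 + z j) \<le> (\<Sum>j\<in>A. d j)" if "tuple z" "A \<subseteq> {..<n}" for A z
    proof -
      have "finite A" using that(2) finite_subset by blast
      then have "degree (\<Prod>j\<in>A. 1 + z j) \<le> (\<Sum>j\<in>A. degree (1 + z j))"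
        using degree_prod_sum_le[of A "\<lambda>i. 1 + z i"] by (simp add: o_def)
      also have "\<dots> \<le> (\<Sum>j\<in>A. d j)"
        using that by (intro sum_mono degree_add_le) (auto simp: tuple_def)
      finally show ?thesis .
    qed
    show "degree (?K m i) \<le> D" for m
    proof -
      have "{..<i} \<subseteq> {..<n}" "{i<..<n} \<subseteq> {..<n}" using i by auto
      then show ?thesis
        using deg[OF tup(2), of "{..<i}" m] deg[OF tup(1), of "{i<..<n}" m] sum
        by (intro order_trans[OF degree_mult_le]) linarith
    qed
    show "degree (?Q i) \<le> D"
    proof -
      have "degree (?Q i) \<le> (\<Sum>j\<in>{..<n} - {i}. d j)"
        using deg[OF tuple_word_tuple[OF w], of "{..<n} - {i}"] by (simp add: word_tuple_def)
      also have "\<dots> \<le> D" unfolding Defs.dsum_def by (intro sum_mono2) auto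
      finally show ?thesis .
    qed
  qed
  \<comment> \<open>All tuples considered lie within distance 1 of the word tuple, so this bounds
    every coordinate.\<close>
  define B where "B = tnorm ?W + 1"
  define lip where "lip \<alpha> K \<longleftrightarrow> K \<ge> 0 \<and> (\<forall>x y. (\<forall>i<n. pnorm (x i) \<le> B \<and> pnorm (y i) \<le> B) \<longrightarrow>
    pnorm ((\<Prod>i<n. x i ^ \<alpha> i) - (\<Prod>i<n. y i ^ \<alpha> i)) \<le> K * (\<Sum>i<n. pnorm (x i - y i)))" for \<alpha> K
  have "\<exists>K. lip \<alpha> K" for \<alpha> unfolding lip_def by (rule pnorm_monomial_lipschitz)
  then obtain L where "\<And>\<alpha>. lip \<alpha> (L \<alpha>)" by metis
  then have L: "L \<alpha> \<ge> 0" "\<forall>i<n. pnorm (x i) \<le> B \<and> pnorm (y i) \<le> B \<Longrightarrow>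
    pnorm ((\<Prod>i<n. x i ^ \<alpha> i) - (\<Prod>i<n. y i ^ \<alpha> i)) \<le> L \<alpha> * tdist x y" for \<alpha> x y
    unfolding lip_def tdist_def by blast+
  have bound: "pnorm (xs m i) \<le> B" "pnorm (ys m i) \<le> B" if "i < n" for m i
  proof -
    have "inverse (real (Suc m)) \<le> 1" by (simp add: field_simps)
    then show "pnorm (xs m i) \<le> B" "pnorm (ys m i) \<le> B"
      using pnorm_le_tnorm[OF that, of "xs m"] pnorm_le_tnorm[OF that, of "ys m"] x[of m] y[of m]
        tnorm_triangle_tdist[of "xs m" ?W] tnorm_triangle_tdist[of "ys m" ?W]
      unfolding B_def by linarith+
  qed
  \<comment> \<open>The first sum is the effect of perturbing the coefficients, through Lipschitz
    constants of the monomials; the second is the error from replacing the cofactors by their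
    limits. Both tend to 0.\<close>
  define \<theta> where "\<theta> m = (\<Sum>\<alpha>\<in>mons n D. cmod (cs m \<alpha> - model_coeff \<alpha>) * L \<alpha>) + (\<Sum>i<n. pnorm (?K m i - ?Q i))" for m
  have "\<theta> \<longlonglongrightarrow> (\<Sum>\<alpha>\<in>mons n D. cmod (model_coeff \<alpha> - model_coeff \<alpha>) * L \<alpha>) + (\<Sum>i<n. 0)"
    unfolding \<theta>_def using model unfolding to_model_def
    by (intro tendsto_intros) (use \<open>\<And>i. i < n \<Longrightarrow> (\<lambda>m. pnorm (?K m i - ?Q i)) \<longlonglongrightarrow> 0\<close> in auto)
  then have "\<theta> \<longlonglongrightarrow> 0" by simp
  then have "\<forall>\<^sub>F m in sequentially. \<theta> m < \<epsilon>" using \<open>\<epsilon> > 0\<close> by (rule order_tendstoD(2))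
  then obtain m where m: "\<theta> m < \<epsilon>" using eventually_happens'[OF sequentially_bot] by blast
  let ?t = "tdist (xs m) (ys m)"
  have eq: "fcomp n D (cs m) (xs m) - fcomp n D (cs m) (ys m) - model_deriv w (\<lambda>i. xs m i - ys m i) =
      (\<Sum>\<alpha>\<in>mons n D. smult (cs m \<alpha> - model_coeff \<alpha>) ((\<Prod>i<n. xs m i ^ \<alpha> i) - (\<Prod>i<n. ys m i ^ \<alpha> i))) +
      (\<Sum>i<n. (xs m i - ys m i) * (?K m i - ?Q i))"
    unfolding fcomp_diff_model[of "cs m"] model_deriv_def
    using model_diff[of "xs m" "ys m"]
    by (simp add: smult_diff_right sum_subtractf sum.distrib algebra_simps)
  have "pnorm (fcomp n D (cs m) (xs m) - fcomp n D (cs m) (ys m) - model_deriv w (\<lambda>i. xs m i - ys m i)) \<le>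
      (\<Sum>\<alpha>\<in>mons n D. cmod (cs m \<alpha> - model_coeff \<alpha>) * (L \<alpha> * ?t)) +
      (\<Sum>i<n. ?t * pnorm (?K m i - ?Q i))"
    unfolding eq
  proof (rule order_trans[OF pnorm_add], rule add_mono)
    show "pnorm (\<Sum>\<alpha>\<in>mons n D. smult (cs m \<alpha> - model_coeff \<alpha>) ((\<Prod>i<n. xs m i ^ \<alpha> i) - (\<Prod>i<n. ys m i ^ \<alpha> i)))
        \<le> (\<Sum>\<alpha>\<in>mons n D. cmod (cs m \<alpha> - model_coeff \<alpha>) * (L \<alpha> * ?t))"
      using bound by (intro order_trans[OF pnorm_sum] sum_mono)
        (simp only: pnorm_smult, intro mult_left_mono L, auto)
    show "pnorm (\<Sum>i<n. (xs m i - ys m i) * (?K m i - ?Q i)) \<le> (\<Sum>i<n. ?t * pnorm (?K m i - ?Q i))"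
    proof (intro order_trans[OF pnorm_sum] sum_mono)
      fix i assume "i \<in> {..<n}"
      then have "pnorm (xs m i - ys m i) \<le> ?t" unfolding tdist_def by (intro member_le_sum) auto
      then show "pnorm ((xs m i - ys m i) * (?K m i - ?Q i)) \<le> ?t * pnorm (?K m i - ?Q i)"
        by (intro order_trans[OF pnorm_mult] mult_right_mono) auto
    qed
  qed
  also have "\<dots> = \<theta> m * ?t"
    unfolding \<theta>_def distrib_right sum_distrib_right
    by (intro arg_cong2[of _ _ _ _ "(+)"] sum.cong) (simp_all only: mult_ac)
  also have "\<dots> \<le> \<epsilon> * ?t" using m tdist_nonneg by (intro mult_right_mono) auto
  finally show False using big[of m] by simp
qed

section \<open>The residual and its zeros near a word tuple\<close>

definition residual :: "((nat \<Rightarrow> nat) \<Rightarrow> complex) \<Rightarrow> (nat \<Rightarrow> complex poly) \<Rightarrow> complex poly" where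
  "residual c x = truncate D (fcomp n D c x) + monom 1 D"

lemma degree_residual: "degree (residual c x) \<le> D"
  unfolding residual_def by (intro degree_add_le degree_truncate degree_monom_le)

lemma residual_diff: "residual c x - residual c y = truncate D (fcomp n D c x - fcomp n D c y)"
  by (simp add: residual_def truncate_diff)

lemma solution_iff_residual: "solution c x \<longleftrightarrow> tuple x \<and> residual c x = 0"
proof -
  have "residual c x = 0 \<longleftrightarrow> (\<forall>k<D. coeff (fcomp n D c x) k = 0) \<and> coeff (fcomp n D c x) D = - 1"
    (is "?L \<longleftrightarrow> ?R")
  proof
    assume ?L
    have eq: "(if k \<le> D then coeff (fcomp n D c x) k else 0) + (if k = D then 1 else 0) = 0" for k
      using arg_cong[OF \<open>?L\<close>, of "\<lambda>p. coeff p k"] by (simp add: residual_def coeff_truncate eq_commute[of k])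
    show ?R
    proof (intro conjI allI impI)
      show "coeff (fcomp n D c x) k = 0" if "k < D" for k using eq[of k] that by simp
      show "coeff (fcomp n D c x) D = - 1" using eq[of D] by (simp add: add_eq_0_iff2)
    qed
  next
    assume ?R
    then show ?L by (auto simp: residual_def poly_eq_iff coeff_truncate)
  qed
  then show ?thesis by (auto simp: solution_def)
qed

lemma coeff_residual_0: "tuple x \<Longrightarrow> coeff (residual c x) 0 = 0"
  using D_pos by (simp add: residual_def coeff_truncate coeff_fcomp_0)

lemma tendsto_pnorm_residual:
  assumes "\<And>\<alpha>. \<alpha> \<in> mons n D \<Longrightarrow> ((\<lambda>m. cs m \<alpha>) \<longlongrightarrow> c \<alpha>) F"
    and "\<And>i. i < n \<Longrightarrow> pconv (\<lambda>m. xs m i) (x i) F"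
  shows "((\<lambda>m. pnorm (residual (cs m) (xs m))) \<longlongrightarrow> pnorm (residual c x)) F"
proof (rule tendsto_pnorm[OF _ degree_residual degree_residual])
  show "pconv (\<lambda>m. residual (cs m) (xs m)) (residual c x) F"
    unfolding residual_def by (intro pconv_intros pconv_truncate fcomp_conv assms)
qed

text \<open>A minimising sequence in the closed ball is bounded, so it has a convergent subsequence;
  the degree bounds, the distance and the residual norm pass to the limit.\<close>

lemma residual_minimizer:
  assumes z: "tuple z" and "\<delta> \<ge> 0"
  shows "\<exists>y. tuple y \<and> tdist y z \<le> \<delta> \<and>
    (\<forall>x. tuple x \<and> tdist x z \<le> \<delta> \<longrightarrow> pnorm (residual c y) \<le> pnorm (residual c x))"
proof -
  define S where "S = (\<lambda>x. pnorm (residual c x)) ` {x. tuple x \<and> tdist x z \<le> \<delta>}"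
  have ne: "S \<noteq> {}" using assms by (auto simp: S_def tdist_self intro!: exI[of _ z])
  have bdd: "bdd_below S" by (rule bdd_belowI[of _ 0]) (auto simp: S_def)
  have "\<exists>x. tuple x \<and> tdist x z \<le> \<delta> \<and> pnorm (residual c x) < Inf S + inverse (real (Suc m))" for m
  proof -
    have "Inf S < Inf S + inverse (real (Suc m))" by simp
    from cInf_lessD[OF ne this] show ?thesis by (auto simp: S_def)
  qed
  then obtain xs where xs: "\<And>m. tuple (xs m)" "\<And>m. tdist (xs m) z \<le> \<delta>"
    "\<And>m. pnorm (residual c (xs m)) < Inf S + inverse (real (Suc m))" by metis
  have "tnorm (xs m) \<le> \<delta> + tnorm z" for m using tnorm_triangle_tdist[of "xs m" z] xs(2)[of m] by simp
  then obtain r y where r: "strict_mono r" "tuple y"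
    and y: "\<And>i. i < n \<Longrightarrow> pconv (\<lambda>m. xs (r m) i) (y i) sequentially"
    using tuple_bounded_subseq[of xs "\<delta> + tnorm z"] xs(1) by blast
  have "(\<lambda>m. tdist (xs (r m)) z) \<longlonglongrightarrow> tdist y z" by (intro tendsto_tdist xs r z y)
  then have dist: "tdist y z \<le> \<delta>" by (rule LIMSEQ_le_const2) (use xs in auto)
  have lim: "(\<lambda>m. pnorm (residual c (xs (r m)))) \<longlonglongrightarrow> pnorm (residual c y)"
    by (intro tendsto_pnorm_residual tendsto_const y)
  have "(\<lambda>m. inverse (real (Suc (r m)))) \<longlonglongrightarrow> 0"
    using LIMSEQ_subseq_LIMSEQ[OF LIMSEQ_inverse_real_of_nat r(1)] by (simp add: o_def)
  then have "(\<lambda>m. Inf S + inverse (real (Suc (r m)))) \<longlonglongrightarrow> Inf S + 0" by (intro tendsto_intros)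
  then have "pnorm (residual c y) \<le> Inf S + 0"
    by (rule LIMSEQ_le[OF lim]) (use xs(3) less_imp_le in blast)
  then have "pnorm (residual c y) \<le> pnorm (residual c x)" if "tuple x" "tdist x z \<le> \<delta>" for x
    using cInf_lower[OF _ bdd, of "pnorm (residual c x)"] that by (force simp: S_def)
  with r dist show ?thesis by blast
qed

text \<open>Newton's method in variational form: at a minimum of the residual norm in the interior of
  a ball, moving in the direction that solves the linearised equation would decrease the norm.\<close>

lemma local_solution:
  assumes w: "w \<in> d_words n d"
  shows "\<exists>\<delta>0>0. near (\<lambda>c. \<forall>x y. solution c x \<and> solution c y \<and> tdist x (word_tuple w) \<le> \<delta>0 \<and>
      tdist y (word_tuple w) \<le> \<delta>0 \<longrightarrow> (\<forall>i<n. x i = y i)) \<and>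
    (\<forall>\<delta>. 0 < \<delta> \<and> \<delta> \<le> \<delta>0 \<longrightarrow> near (\<lambda>c. \<exists>x. solution c x \<and> tdist x (word_tuple w) < \<delta>))"
proof -
  let ?W = "word_tuple w" and ?L = "model_deriv w"
  have W: "tuple ?W" by (rule tuple_word_tuple[OF w])
  obtain K where "K > 0" and K: "\<And>y. tuple y \<Longrightarrow> tnorm y \<le> K * pnorm (?L y)"
    using model_deriv_bounded_below[OF w] by blast
  \<comment> \<open>The differential is bounded below by \<open>1 / K\<close>; an error of at most
    half of that leaves the lower bound \<open>1 / (2 * K)\<close> for differences of
    residuals.\<close>
  obtain \<delta>0 where "\<delta>0 > 0" and diff: "\<And>c x y. \<forall>\<alpha>\<in>mons n D. cmod (c \<alpha> - model_coeff \<alpha>) < \<delta>0 \<Longrightarrow>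
      tuple x \<Longrightarrow> tuple y \<Longrightarrow> tdist x ?W \<le> \<delta>0 \<Longrightarrow> tdist y ?W \<le> \<delta>0 \<Longrightarrow>
      pnorm (fcomp n D c x - fcomp n D c y - ?L (\<lambda>i. x i - y i)) \<le> 1 / (2 * K) * tdist x y"
    using strict_diff[OF w, of "1 / (2 * K)"] \<open>K > 0\<close> by (force simp only: zero_less_divide_iff)
  define close where "close c \<longleftrightarrow> (\<forall>\<alpha>\<in>mons n D. cmod (c \<alpha> - model_coeff \<alpha>) < \<delta>0)" for c
  have close: "near close" unfolding near_def close_def using \<open>\<delta>0 > 0\<close> by blast
  have res: "pnorm (residual c x - residual c y - ?L (\<lambda>i. x i - y i)) \<le> tdist x y / (2 * K)"
    if "close c" "tuple x" "tuple y" "tdist x ?W \<le> \<delta>0" "tdist y ?W \<le> \<delta>0" for c x y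
  proof -
    have "residual c x - residual c y - ?L (\<lambda>i. x i - y i) =
        truncate D (fcomp n D c x - fcomp n D c y - ?L (\<lambda>i. x i - y i))"
      using truncate_id[OF degree_model_deriv[OF w tuple_diff[OF that(2,3)]]]
      by (simp add: residual_diff truncate_diff)
    then have "pnorm (residual c x - residual c y - ?L (\<lambda>i. x i - y i)) \<le>
        pnorm (fcomp n D c x - fcomp n D c y - ?L (\<lambda>i. x i - y i))"
      by (simp only: pnorm_truncate)
    also have "\<dots> \<le> 1 / (2 * K) * tdist x y" using that by (intro diff) (auto simp: close_def)
    finally show ?thesis by simp
  qed
  have lower: "tdist x y / (2 * K) \<le> pnorm (residual c x - residual c y)"
    if "close c" "tuple x" "tuple y" "tdist x ?W \<le> \<delta>0" "tdist y ?W \<le> \<delta>0" for c x y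
  proof -
    have "tdist x y \<le> K * pnorm (?L (\<lambda>i. x i - y i))"
      unfolding tdist_eq_tnorm by (intro K tuple_diff that)
    then have "tdist x y / K \<le> pnorm (?L (\<lambda>i. x i - y i))"
      using \<open>K > 0\<close> by (simp add: pos_divide_le_eq mult.commute)
    also have "\<dots> \<le> pnorm (?L (\<lambda>i. x i - y i) - (residual c x - residual c y)) + pnorm (residual c x - residual c y)"
      using pnorm_add[of "?L (\<lambda>i. x i - y i) - (residual c x - residual c y)" "residual c x - residual c y"] by simp
    also have "\<dots> \<le> tdist x y / (2 * K) + pnorm (residual c x - residual c y)"
      using res[OF that] by (simp add: pnorm_minus_commute)
    finally show ?thesis by (simp add: field_simps)
  qed
  have "near (\<lambda>c. \<forall>x y. solution c x \<and> solution c y \<and> tdist x ?W \<le> \<delta>0 \<and>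
      tdist y ?W \<le> \<delta>0 \<longrightarrow> (\<forall>i<n. x i = y i))"
  proof (rule near_mono[OF close], intro allI impI)
    fix c x y i assume c: "close c" and "solution c x \<and> solution c y \<and> tdist x ?W \<le> \<delta>0 \<and> tdist y ?W \<le> \<delta>0"
      and "i < n"
    then have "tdist x y / (2 * K) \<le> 0" using lower[OF c, of x y] by (simp add: solution_iff_residual)
    then have "tdist x y \<le> 0" using \<open>K > 0\<close> by (simp add: divide_le_0_iff)
    then have "tdist x y = 0" using tdist_nonneg[of x y] by simp
    then show "x i = y i" using \<open>i < n\<close> unfolding tdist_eq_tnorm tnorm_eq_0_iff by simp
  qed
  moreover have "near (\<lambda>c. \<exists>x. solution c x \<and> tdist x ?W < \<delta>)" if \<delta>: "0 < \<delta>" "\<delta> \<le> \<delta>0" for \<delta>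
  proof -
    \<comment> \<open>The minimiser and the centre both have residual below
      \<open>\<delta> / (4 * K)\<close>, so their residuals differ by less than
      \<open>\<delta> / (2 * K)\<close>, and the lower bound places the minimiser strictly inside
      the ball.\<close>
    have "near (\<lambda>c. pnorm (residual c ?W) < \<delta> / (4 * K))"
    proof (rule nearI_seq)
      fix cs assume "to_model cs" and *: "\<And>m. \<not> pnorm (residual (cs m) ?W) < \<delta> / (4 * K)"
      then have "(\<lambda>m. pnorm (residual (cs m) ?W)) \<longlonglongrightarrow> pnorm (residual model_coeff ?W)"
        by (intro tendsto_pnorm_residual pconv_const) (auto simp: to_model_def)
      moreover have "residual model_coeff ?W = 0"
        using solution_word_tuple[OF w] by (simp add: solution_iff_residual)
      ultimately have "(\<lambda>m. pnorm (residual (cs m) ?W)) \<longlonglongrightarrow> 0" by simp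
      then have "\<forall>\<^sub>F m in sequentially. pnorm (residual (cs m) ?W) < \<delta> / (4 * K)"
        using \<delta> \<open>K > 0\<close> by (intro order_tendstoD(2)) auto
      with * show False by simp
    qed
    then have "near (\<lambda>c. close c \<and> pnorm (residual c ?W) < \<delta> / (4 * K))" by (rule near_conj[OF close])
    then show ?thesis
    proof (rule near_mono)
      fix c assume "close c \<and> pnorm (residual c ?W) < \<delta> / (4 * K)"
      then have c: "close c" and small: "pnorm (residual c ?W) < \<delta> / (4 * K)" by auto
      obtain y where y: "tuple y" "tdist y ?W \<le> \<delta>"
        and min: "\<And>x. tuple x \<Longrightarrow> tdist x ?W \<le> \<delta> \<Longrightarrow> pnorm (residual c y) \<le> pnorm (residual c x)"
        using residual_minimizer[OF W, of \<delta> c] \<delta> by auto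
      have "pnorm (residual c y) \<le> pnorm (residual c ?W)" using min[OF W] \<delta> by (simp add: tdist_self)
      then have "pnorm (residual c y - residual c ?W) < \<delta> / (2 * K)"
        using pnorm_add[of "residual c y" "- residual c ?W"] small by simp
      moreover have "tdist y ?W / (2 * K) \<le> pnorm (residual c y - residual c ?W)"
        using y \<delta> by (intro lower c W) (auto simp: tdist_self)
      ultimately have "tdist y ?W / (2 * K) < \<delta> / (2 * K)" by linarith
      then have int: "tdist y ?W < \<delta>" using \<open>K > 0\<close> by (simp add: divide_less_cancel)
      define \<rho> where "\<rho> = residual c y"
      have "\<rho> = 0"
      proof (rule ccontr)
        assume "\<rho> \<noteq> 0"
        then have pos: "pnorm \<rho> > 0" using pnorm_nonneg[of \<rho>] pnorm_eq_0_iff[of \<rho>] by linarith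
        have "degree (- \<rho>) \<le> D" "coeff (- \<rho>) 0 = 0"
          using degree_residual coeff_residual_0[OF y(1)] by (auto simp: \<rho>_def)
        then obtain v where v: "tuple v" "?L v = - \<rho>" using model_deriv_surj[OF w] by blast
        have Kv: "tnorm v \<le> K * pnorm \<rho>" using K[OF v(1)] v(2) by simp
        \<comment> \<open>A damped step that stays in the ball of radius \<open>\<delta>\<close>;
          the summand 1 keeps the denominator positive even if \<open>v\<close> has norm 0.\<close>
        define h where "h = min 1 ((\<delta> - tdist y ?W) / (tnorm v + 1))"
        have tv: "tnorm v + 1 > 0" using tnorm_nonneg[of v] by simp
        have h: "0 < h" "h \<le> 1" using int tv by (auto simp: h_def)
        have "h * tnorm v \<le> (\<delta> - tdist y ?W) / (tnorm v + 1) * (tnorm v + 1)"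
          using h tnorm_nonneg[of v] int tv by (intro mult_mono) (auto simp: h_def)
        then have hv: "h * tnorm v \<le> \<delta> - tdist y ?W" using tv by simp
        define y' where "y' i = y i + smult (of_real h) (v i)" for i
        have y'y: "(\<lambda>i. y' i - y i) = (\<lambda>i. smult (of_real h) (v i))" by (simp add: y'_def)
        have dist: "tdist y' y = h * tnorm v" unfolding tdist_eq_tnorm y'y tnorm_smult using h by simp
        have tup: "tuple y'" unfolding y'_def by (intro tuple_add tuple_smult y v)
        have in_ball: "tdist y' ?W \<le> \<delta>" using tdist_triangle[of y' ?W y] dist hv by linarith
        let ?e = "residual c y' - residual c y - ?L (\<lambda>i. y' i - y i)"
        have "pnorm ?e \<le> tdist y' y / (2 * K)"
          using in_ball y \<delta> by (intro res c tup) auto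
        also have "\<dots> \<le> h * (K * pnorm \<rho>) / (2 * K)"
          unfolding dist using Kv h \<open>K > 0\<close> by (intro divide_right_mono mult_left_mono) auto
        \<comment> \<open>The linear part shrinks the residual by the factor \<open>1 - h\<close>
          and the error gives back at most \<open>h / 2\<close>, so the norm strictly
          decreases.\<close>
        finally have e: "pnorm ?e \<le> h / 2 * pnorm \<rho>" using \<open>K > 0\<close> by simp
        have "?L (\<lambda>i. y' i - y i) = smult (of_real h) (- \<rho>)"
          unfolding y'y model_deriv_smult v by simp
        then have "residual c y' = smult (of_real (1 - h)) \<rho> + ?e"
          by (simp add: \<rho>_def smult_diff_left)
        then have "pnorm (residual c y') \<le> pnorm (smult (of_real (1 - h)) \<rho>) + pnorm ?e"
          by (metis pnorm_add)
        also have "\<dots> \<le> (1 - h) * pnorm \<rho> + h / 2 * pnorm \<rho>"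
          using e h unfolding pnorm_smult norm_of_real by simp
        also have "\<dots> = (1 - h / 2) * pnorm \<rho>" by (simp add: algebra_simps)
        also have "\<dots> < 1 * pnorm \<rho>" using h pos by (intro mult_strict_right_mono) auto
        finally show False using min[OF tup in_ball] by (simp add: \<rho>_def)
      qed
      then show "\<exists>x. solution c x \<and> tdist x ?W < \<delta>"
        using y int by (auto simp: \<rho>_def solution_iff_residual)
    qed
  qed
  ultimately show ?thesis using \<open>\<delta>0 > 0\<close> by blast
qed

end

lemma polyfun_poly_var: "v \<in> V \<Longrightarrow> polyfun V (\<lambda>e. poly p (e v))"
  unfolding poly_altdef by (intro polyfun_sum polyfun.mult polyfun.const polyfun_power polyfun.var)

text \<open>The set of parameters with a second preimage is constructible in one variable, so if it
  is infinite its complement is finite.\<close>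

lemma not_one_fold_cofinite:
  assumes "\<not> one_fold n x"
  shows "finite {t. \<not> (\<exists>s. s \<noteq> t \<and> param n x s = param n x t)}"
proof -
  \<comment> \<open>The two variables are indexed by \<open>bool\<close>: \<open>True\<close> holds
    the parameter \<open>t\<close>, and \<open>False\<close> its partner \<open>s\<close>, which is
    eliminated.\<close>
  let ?P = "\<lambda>e :: bool \<Rightarrow> complex. \<not> e False = e True \<and> (\<forall>i\<in>{..<n}. poly (x i) (e False) = poly (x i) (e True))"
  have "constructible UNIV ?P"
    by (intro constructible.conj constructible.neg constructible_all_finite constructible_eq
        polyfun_poly_var polyfun.var) auto
  from constructible_ex[OF this, of False]
  have fin: "finite {t. \<exists>s. ?P ((\<lambda>_. 0)(True := t, False := s))} \<or>
      finite {t. \<not> (\<exists>s. ?P ((\<lambda>_. 0)(True := t, False := s)))}"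
    by (rule constructible_finite_or_cofinite)
  have "?P ((\<lambda>_. 0)(True := t, False := s)) \<longleftrightarrow> s \<noteq> t \<and> param n x s = param n x t" for s t
    by (auto simp: param_eq_iff)
  with fin have "finite {t. \<exists>s. s \<noteq> t \<and> param n x s = param n x t} \<or>
      finite {t. \<not> (\<exists>s. s \<noteq> t \<and> param n x s = param n x t)}" by (simp only:)
  with assms show ?thesis unfolding one_fold_def by blast
qed

lemma ex_near_not_in_finite:
  assumes "finite A" "e > 0"
  shows "\<exists>t. t \<notin> A \<and> cmod (t - t0) < e"
proof -
  have "\<forall>\<^sub>F t in at t0. t \<notin> A"
    using islimpt_finite[OF assms(1)] islimpt_iff_eventually by blast
  moreover have "\<forall>\<^sub>F t in at t0. dist t t0 < e"
    using assms(2) eventually_at by blast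
  ultimately have "\<forall>\<^sub>F t in at t0. t \<notin> A \<and> dist t t0 < e" by eventually_elim auto
  then show ?thesis using eventually_happens'[OF at_neq_bot] by (auto simp: dist_norm)
qed

lemma poly_pderiv_sum:
  fixes t :: complex
  assumes "degree p \<le> N"
  shows "poly (pderiv p) t = (\<Sum>k\<le>N. coeff p k * (of_nat k * t ^ (k - 1)))"
proof (cases N)
  case 0
  then have "pderiv p = 0" using assms by (simp add: pderiv_eq_0_iff)
  with 0 show ?thesis by simp
next
  case (Suc M)
  have "degree (pderiv p) \<le> M" using assms Suc by (simp add: degree_pderiv)
  then show ?thesis unfolding Suc sum.atMost_Suc_shift
    by (simp add: poly_degree_le_sum coeff_pderiv mult_ac)
qed

text \<open>The divided difference is itself polynomial in \<open>s\<close> and \<open>t\<close>, so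
  it keeps a meaning when the two parameters merge and then becomes the derivative.\<close>

lemma poly_eq_divided_diff:
  fixes s t :: complex
  assumes "degree p \<le> N"
  shows "poly p s - poly p t = (s - t) * (\<Sum>k\<le>N. coeff p k * (\<Sum>l<k. t ^ (k - Suc l) * s ^ l))"
proof -
  have "poly p s - poly p t = (\<Sum>k\<le>N. coeff p k * (s ^ k - t ^ k))"
    unfolding poly_degree_le_sum[OF assms] by (simp add: sum_subtractf right_diff_distrib)
  also have "\<dots> = (\<Sum>k\<le>N. coeff p k * ((s - t) * (\<Sum>l<k. t ^ (k - Suc l) * s ^ l)))"
    by (subst power_diff_sumr2) simp
  also have "\<dots> = (s - t) * (\<Sum>k\<le>N. coeff p k * (\<Sum>l<k. t ^ (k - Suc l) * s ^ l))"
    unfolding sum_distrib_left[of "s - t" "\<lambda>k. coeff p k * (\<Sum>l<k. t ^ (k - Suc l) * s ^ l)" "{..N}"]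
    by (simp only: mult.left_commute)
  finally show ?thesis .
qed

lemma infinite_poly_eqI:
  fixes p q :: "complex poly"
  assumes "infinite A" "\<And>t. t \<in> A \<Longrightarrow> poly p t = poly q t"
  shows "p = q"
proof (rule ccontr)
  assume "p \<noteq> q"
  then have "finite {t. poly (p - q) t = 0}" by (intro poly_roots_finite) simp
  moreover have "A \<subseteq> {t. poly (p - q) t = 0}" using assms(2) by auto
  ultimately show False using assms(1) finite_subset by blast
qed

section \<open>Bounds and compactness for solutions near the model\<close>

context osculation
begin

lemma pnorm_rescale_real:
  assumes "a \<ge> 0" "degree p \<le> N"
  shows "pnorm (rescale (of_real a) p) = (\<Sum>k\<le>N. a ^ k * cmod (coeff p k))"
  using assms degree_rescale_le[of "of_real a" p]
  by (subst pnorm_degree_le[of _ N]) (auto simp: coeff_rescale norm_mult norm_power)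

lemma tnorm_rescale_real:
  assumes "a \<ge> 0" "tuple x"
  shows "tnorm (\<lambda>i. rescale (of_real a) (x i)) = (\<Sum>i<n. \<Sum>k\<le>d i. a ^ k * cmod (coeff (x i) k))"
  unfolding tnorm_def using assms
  by (intro sum.cong refl pnorm_rescale_real) (auto simp: tuple_def)

lemma tnorm_tuple: "tuple x \<Longrightarrow> tnorm x = (\<Sum>i<n. \<Sum>k\<le>d i. cmod (coeff (x i) k))"
  unfolding tnorm_def by (intro sum.cong refl pnorm_degree_le) (auto simp: tuple_def)

text \<open>A tuple has no constant terms, so every nonzero coefficient is multiplied by at least
  the first power of \<open>a\<close>.\<close>

lemma tnorm_rescale_ge:
  assumes "a \<ge> 1" "tuple x"
  shows "a * tnorm x \<le> tnorm (\<lambda>i. rescale (of_real a) (x i))"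
proof -
  have "a * cmod (coeff (x i) k) \<le> a ^ k * cmod (coeff (x i) k)" if "i < n" for i k
  proof (cases k)
    case 0
    then show ?thesis using assms(2) that by (simp add: tuple_def)
  next
    case (Suc k)
    then show ?thesis using assms(1) self_le_power[of a "Suc k"] by (intro mult_right_mono) auto
  qed
  moreover have "tnorm (\<lambda>i. rescale (of_real a) (x i)) = (\<Sum>i<n. \<Sum>k\<le>d i. a ^ k * cmod (coeff (x i) k))"
    using assms by (intro tnorm_rescale_real) auto
  ultimately show ?thesis unfolding tnorm_tuple[OF assms(2)] sum_distrib_left
    by (auto intro!: sum_mono)
qed

lemma tnorm_rescale_ge_power:
  assumes "0 \<le> a" "a \<le> 1" "tuple x"
  shows "a ^ D * tnorm x \<le> tnorm (\<lambda>i. rescale (of_real a) (x i))"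
  unfolding tnorm_tuple[OF assms(3)] tnorm_rescale_real[OF assms(1,3)] sum_distrib_left
proof (intro sum_mono mult_right_mono power_decreasing)
  fix i k assume "i \<in> {..<n}" "k \<in> {..d i}"
  then show "k \<le> D" using d_le_D[of i] by simp
qed (use assms in auto)

text \<open>By the intermediate value theorem every nonzero tuple can be moved onto the unit sphere
  by rescaling \<open>t\<close>, as in a weighted projective space. The endpoint \<open>M\<close> is
  large enough for the linear lower bound to reach 1.\<close>

lemma unit_rescaling:
  assumes "tuple x" "tnorm x > 0"
  shows "\<exists>a>0. tnorm (\<lambda>i. rescale (of_real a) (x i)) = 1"
proof -
  let ?f = "\<lambda>a. \<Sum>i<n. \<Sum>k\<le>d i. a ^ k * cmod (coeff (x i) k)"
  define M where "M = max 1 (1 / tnorm x)"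
  have "?f 0 = 0" using assms(1)
    by (intro sum.neutral ballI) (auto simp: tuple_def power_0_left)
  moreover have "1 \<le> ?f M"
  proof -
    have "1 \<le> M * tnorm x" using assms(2) by (simp add: M_def field_simps max_def)
    also have "\<dots> \<le> tnorm (\<lambda>i. rescale (of_real M) (x i))"
      by (rule tnorm_rescale_ge[OF _ assms(1)]) (simp add: M_def)
    also have "\<dots> = ?f M" using assms(1) by (intro tnorm_rescale_real) (auto simp: M_def)
    finally show ?thesis .
  qed
  moreover have "continuous_on {0..M} ?f" by (intro continuous_intros)
  moreover have "0 \<le> M" by (simp add: M_def)
  ultimately obtain a where a: "0 \<le> a" "a \<le> M" "?f a = 1"
    using IVT'[of ?f 0 1 M] by auto
  with \<open>?f 0 = 0\<close> have "a > 0" by (cases "a = 0") auto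
  with a assms(1) show ?thesis using tnorm_rescale_real[of a x] by auto
qed

text \<open>A quantitative form of \<open>tuple_model_zero\<close>: a sequence of counterexamples
  would converge on the compact unit sphere to a nonzero tuple that solves the homogeneous model
  equations.\<close>

lemma sphere_residual:
  "\<exists>\<eta>>0. near (\<lambda>c. \<forall>x. tuple x \<and> tnorm x = 1 \<longrightarrow> (\<exists>k\<le>D. \<eta> \<le> cmod (coeff (fcomp n D c x) k)))"
proof (rule ccontr)
  assume neg: "\<not> ?thesis"
  define bad where "bad m c x \<longleftrightarrow> (\<forall>\<alpha>\<in>mons n D. cmod (c \<alpha> - model_coeff \<alpha>) < inverse (real (Suc m))) \<and>
    tuple x \<and> tnorm x = 1 \<and> (\<forall>k\<le>D. cmod (coeff (fcomp n D c x) k) < inverse (real (Suc m)))" for m c x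
  have "\<exists>c x. bad m c x" for m
  proof -
    have pos: "inverse (real (Suc m)) > 0" by simp
    with neg have "\<not> near (\<lambda>c. \<forall>x. tuple x \<and> tnorm x = 1 \<longrightarrow>
      (\<exists>k\<le>D. inverse (real (Suc m)) \<le> cmod (coeff (fcomp n D c x) k)))" by blast
    with pos obtain c where
      "\<forall>\<alpha>\<in>mons n D. cmod (c \<alpha> - model_coeff \<alpha>) < inverse (real (Suc m))"
      "\<not> (\<forall>x. tuple x \<and> tnorm x = 1 \<longrightarrow>
        (\<exists>k\<le>D. inverse (real (Suc m)) \<le> cmod (coeff (fcomp n D c x) k)))"
      unfolding near_def by blast
    then show ?thesis unfolding bad_def not_le[symmetric] by blast
  qed
  then obtain cs xs where "\<And>m. bad m (cs m) (xs m)" by metis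
  then have cs: "\<And>m. \<forall>\<alpha>\<in>mons n D. cmod (cs m \<alpha> - model_coeff \<alpha>) < inverse (real (Suc m))"
    and xs: "\<And>m. tuple (xs m)" "\<And>m. tnorm (xs m) = 1"
    and small: "\<And>m k. k \<le> D \<Longrightarrow> cmod (coeff (fcomp n D (cs m) (xs m)) k) < inverse (real (Suc m))"
    unfolding bad_def by blast+
  have model: "to_model cs" using cs by (intro to_modelI) auto
  obtain r y where r: "strict_mono r" "tuple y"
    and y: "\<And>i. i < n \<Longrightarrow> pconv (\<lambda>m. xs (r m) i) (y i) sequentially"
    using tuple_bounded_subseq[of xs 1] xs by auto
  have lim: "pconv (\<lambda>m. fcomp n D (cs (r m)) (xs (r m))) (fcomp n D model_coeff y) sequentially"
    using to_model_subseq[OF model r(1)] by (intro fcomp_conv y) (auto simp: to_model_def)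
  have inv: "(\<lambda>m. inverse (real (Suc (r m)))) \<longlonglongrightarrow> 0"
    using LIMSEQ_subseq_LIMSEQ[OF LIMSEQ_inverse_real_of_nat r(1)] by (simp add: o_def)
  have "coeff (fcomp n D model_coeff y) k = 0" if "k \<le> D" for k
  proof (rule LIMSEQ_unique[OF pconvD[OF lim]])
    show "(\<lambda>m. coeff (fcomp n D (cs (r m)) (xs (r m))) k) \<longlonglongrightarrow> 0"
      by (rule Lim_null_comparison[OF always_eventually inv])
        (use small[OF that] less_imp_le in blast)
  qed
  then have "tnorm y = 0" using tuple_model_zero[OF r(2)] by (simp add: tnorm_eq_0_iff)
  moreover have "(\<lambda>m. tnorm (xs (r m))) \<longlonglongrightarrow> tnorm y" by (intro tendsto_tnorm xs r y)
  ultimately show False by (simp add: xs(2) LIMSEQ_const_iff)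
qed

text \<open>Rescaling multiplies the coefficient at \<open>t^k\<close> by \<open>a ^ k\<close>, so a
  nonzero tuple with vanishing coefficients could be moved to the unit sphere. The lemma guarantees
  that an osculating curve has a nonzero coefficient at \<open>t^D\<close> to normalise.\<close>

lemma near_only_zero:
  "near (\<lambda>c. \<forall>x. tuple x \<and> (\<forall>k\<le>D. coeff (fcomp n D c x) k = 0) \<longrightarrow> (\<forall>i<n. x i = 0))"
proof -
  obtain \<eta> where "\<eta> > 0" and near: "near (\<lambda>c. \<forall>x. tuple x \<and> tnorm x = 1 \<longrightarrow>
      (\<exists>k\<le>D. \<eta> \<le> cmod (coeff (fcomp n D c x) k)))"
    using sphere_residual by blast
  show ?thesis
  proof (rule near_mono[OF near], intro allI impI, rule ccontr)
    fix c x i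
    assume c: "\<forall>x. tuple x \<and> tnorm x = 1 \<longrightarrow> (\<exists>k\<le>D. \<eta> \<le> cmod (coeff (fcomp n D c x) k))"
      and x: "tuple x \<and> (\<forall>k\<le>D. coeff (fcomp n D c x) k = 0)" and "i < n" "x i \<noteq> 0"
    then have "tnorm x > 0" using tnorm_eq_0_iff[of x] tnorm_nonneg[of x] by fastforce
    then obtain a where "tnorm (\<lambda>i. rescale (of_real a) (x i)) = 1" using unit_rescaling x by blast
    then obtain k where "k \<le> D" "\<eta> \<le> cmod (coeff (fcomp n D c (\<lambda>i. rescale (of_real a) (x i))) k)"
      using c tuple_rescale x by blast
    then show False using x \<open>\<eta> > 0\<close> unfolding fcomp_rescale by (simp add: coeff_rescale)
  qed
qed

text \<open>On moving a solution to the unit sphere by a factor \<open>a\<close>, its only nonzero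
  coefficient up to \<open>D\<close> acquires modulus \<open>a ^ D\<close>, so
  \<open>\<eta> \<le> a ^ D\<close>. If the norm exceeds 1, then \<open>a \<le> 1\<close> and
  \<open>a ^ D * tnorm x \<le> 1\<close>, which gives the bound \<open>1 / \<eta>\<close>.\<close>

lemma near_bounded: "\<exists>B. near (\<lambda>c. \<forall>x. solution c x \<longrightarrow> tnorm x \<le> B)"
proof -
  obtain \<eta> where "\<eta> > 0" and near: "near (\<lambda>c. \<forall>x. tuple x \<and> tnorm x = 1 \<longrightarrow>
      (\<exists>k\<le>D. \<eta> \<le> cmod (coeff (fcomp n D c x) k)))"
    using sphere_residual by blast
  have "near (\<lambda>c. \<forall>x. solution c x \<longrightarrow> tnorm x \<le> max 1 (1 / \<eta>))"
  proof (rule near_mono[OF near], intro allI impI, rule ccontr)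
    fix c x
    assume c: "\<forall>x. tuple x \<and> tnorm x = 1 \<longrightarrow> (\<exists>k\<le>D. \<eta> \<le> cmod (coeff (fcomp n D c x) k))"
      and x: "solution c x" and "\<not> tnorm x \<le> max 1 (1 / \<eta>)"
    then have big: "tnorm x > 1" "tnorm x > 1 / \<eta>" by auto
    have tup: "tuple x" using x by (simp add: solution_def)
    obtain a where a: "a > 0" "tnorm (\<lambda>i. rescale (of_real a) (x i)) = 1"
      using unit_rescaling[OF tup] big by auto
    then obtain k where k: "k \<le> D" "\<eta> \<le> cmod (coeff (fcomp n D c (\<lambda>i. rescale (of_real a) (x i))) k)"
      using c tuple_rescale tup by blast
    then have "k = D" using x \<open>\<eta> > 0\<close> unfolding fcomp_rescale
      by (cases "k < D") (auto simp: coeff_rescale solution_def)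
    then have "\<eta> \<le> a ^ D" using k x a unfolding fcomp_rescale
      by (simp add: coeff_rescale solution_def norm_power)
    have "a \<le> 1"
    proof (rule ccontr)
      assume "\<not> a \<le> 1"
      then have "a * tnorm x \<le> 1" using tnorm_rescale_ge[of a x] tup a by simp
      moreover have "a * tnorm x > 1 * 1" using \<open>\<not> a \<le> 1\<close> big by (intro mult_strict_mono) auto
      ultimately show False by simp
    qed
    then have "a ^ D * tnorm x \<le> 1" using tnorm_rescale_ge_power[of a x] tup a by simp
    moreover have "\<eta> * tnorm x \<le> a ^ D * tnorm x"
      using \<open>\<eta> \<le> a ^ D\<close> tnorm_nonneg by (rule mult_right_mono)
    ultimately show False using big(2) \<open>\<eta> > 0\<close> by (simp add: field_simps)
  qed
  then show ?thesis by blast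
qed

text \<open>Common source of the compactness arguments that follow: solutions are bounded near the
  model, and a limit of them solves the model equation, hence comes from a word.\<close>

lemma solution_limit:
  assumes cs: "to_model cs" and sol: "\<And>m. solution (cs m) (xs m)"
  shows "\<exists>r w. strict_mono r \<and> w \<in> d_words n d \<and>
    (\<forall>i<n. pconv (\<lambda>m. xs (r m) i) (word_tuple w i) sequentially)"
proof -
  obtain B where "near (\<lambda>c. \<forall>x. solution c x \<longrightarrow> tnorm x \<le> B)" using near_bounded by blast
  from near_seq[OF this cs] have "\<forall>\<^sub>F m in sequentially. tnorm (xs m) \<le> B"
    by eventually_elim (use sol in blast)
  then obtain M where M: "\<And>m. m \<ge> M \<Longrightarrow> tnorm (xs m) \<le> B" by (auto simp: eventually_sequentially)
  \<comment> \<open>Discards the initial indices, where the bound on the norm need not hold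
    yet.\<close>
  define q where "q m = m + M" for m
  have q: "strict_mono q" by (auto simp: q_def strict_mono_def)
  have tup: "tuple (xs m)" for m using sol by (simp add: solution_def)
  obtain r y where r: "strict_mono r" "tuple y"
    and y: "\<And>i. i < n \<Longrightarrow> pconv (\<lambda>m. xs (q (r m)) i) (y i) sequentially"
    using tuple_bounded_subseq[of "\<lambda>m. xs (q m)" B] tup M by (auto simp: q_def)
  have qr: "strict_mono (\<lambda>m. q (r m))" using strict_mono_o[OF q r(1)] by (simp add: o_def)
  have "(\<lambda>m. pnorm (residual (cs (q (r m))) (xs (q (r m))))) \<longlonglongrightarrow> pnorm (residual model_coeff y)"
    using to_model_subseq[OF cs qr] by (intro tendsto_pnorm_residual y) (auto simp: to_model_def)
  moreover have "residual (cs (q (r m))) (xs (q (r m))) = 0" for m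
    using sol by (simp add: solution_iff_residual)
  ultimately have "residual model_coeff y = 0" by (simp add: LIMSEQ_const_iff)
  then have "solution model_coeff y" using r by (simp add: solution_iff_residual)
  then obtain w where w: "w \<in> d_words n d" "\<forall>i<n. y i = word_tuple w i"
    using solution_model_is_word_tuple by blast
  then show ?thesis using qr y by (intro exI[of _ "\<lambda>m. q (r m)"] exI[of _ w]) auto
qed

lemma tdist_word_tuple_tendsto_0:
  assumes "\<And>m. tuple (xs m)" "w \<in> d_words n d"
    "\<And>i. i < n \<Longrightarrow> pconv (\<lambda>m. xs m i) (word_tuple w i) sequentially"
  shows "(\<lambda>m. tdist (xs m) (word_tuple w)) \<longlonglongrightarrow> 0"
  using tendsto_tdist[of xs "word_tuple w" "word_tuple w"] assms tuple_word_tuple[OF assms(2)]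
  by (simp add: tdist_self)

lemma near_solutions_near_words:
  assumes "\<delta> > 0"
  shows "near (\<lambda>c. \<forall>x. solution c x \<longrightarrow> (\<exists>w\<in>d_words n d. tdist x (word_tuple w) < \<delta>))"
proof (rule nearI_seq)
  fix cs assume cs: "to_model cs"
    and "\<And>m. \<not> (\<forall>x. solution (cs m) x \<longrightarrow> (\<exists>w\<in>d_words n d. tdist x (word_tuple w) < \<delta>))"
  then obtain xs where xs: "\<And>m. solution (cs m) (xs m)"
    "\<And>m w. w \<in> d_words n d \<Longrightarrow> \<not> tdist (xs m) (word_tuple w) < \<delta>" by metis
  obtain r w where r: "strict_mono r" and w: "w \<in> d_words n d"
    and lim: "\<And>i. i < n \<Longrightarrow> pconv (\<lambda>m. xs (r m) i) (word_tuple w i) sequentially"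
    using solution_limit[OF cs xs(1)] by blast
  have "(\<lambda>m. tdist (xs (r m)) (word_tuple w)) \<longlonglongrightarrow> 0"
    using xs(1) w lim by (intro tdist_word_tuple_tendsto_0) (auto simp: solution_def)
  then have "\<forall>\<^sub>F m in sequentially. tdist (xs (r m)) (word_tuple w) < \<delta>"
    using assms by (rule order_tendstoD(2))
  with xs(2)[OF w] show False by simp
qed

text \<open>The coefficients at \<open>d i\<close> of a word tuple are nonzero, which persists along
  convergent sequences; this turns the degree bounds of \<open>tuple\<close> into the equalities
  required by \<open>d_param\<close>.\<close>

lemma near_solutions_degree:
  "near (\<lambda>c. \<forall>x. solution c x \<longrightarrow> (\<forall>i<n. degree (x i) = d i))"
proof (rule nearI_seq)
  fix cs assume cs: "to_model cs"
    and "\<And>m. \<not> (\<forall>x. solution (cs m) x \<longrightarrow> (\<forall>i<n. degree (x i) = d i))"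
  then obtain xs where xs: "\<And>m. solution (cs m) (xs m)"
    and bad: "\<And>m. \<not> (\<forall>i<n. degree (xs m i) = d i)" by metis
  obtain r w where r: "strict_mono r" and w: "w \<in> d_words n d"
    and lim: "\<And>i. i < n \<Longrightarrow> pconv (\<lambda>m. xs (r m) i) (word_tuple w i) sequentially"
    using solution_limit[OF cs xs(1)] by blast
  have "\<forall>\<^sub>F m in sequentially. \<forall>i\<in>{..<n}. coeff (xs (r m) i) (d i) \<noteq> 0"
  proof (intro eventually_ball_finite ballI)
    fix i assume "i \<in> {..<n}"
    then have i: "i < n" by simp
    have "coeff (word_tuple w i) (d i) \<noteq> 0"
      using degree_word_tuple[OF w i] d_pos[OF i] by (metis degree_0 leading_coeff_0_iff less_irrefl)
    with pconvD[OF lim[OF i], of "d i"] show "\<forall>\<^sub>F m in sequentially. coeff (xs (r m) i) (d i) \<noteq> 0"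
      by (rule tendsto_imp_eventually_ne)
  qed auto
  then obtain m where m: "\<And>i. i < n \<Longrightarrow> coeff (xs (r m) i) (d i) \<noteq> 0"
    using eventually_happens'[OF sequentially_bot] by blast
  have "degree (xs (r m) i) = d i" if "i < n" for i
    using le_degree[OF m[OF that]] xs(1)[of "r m"] that
    unfolding solution_def tuple_def by (blast intro: le_antisym)
  then show False using bad by blast
qed

section \<open>Generic injectivity and equality of images in the limit\<close>

definition primitive_word :: "nat list \<Rightarrow> bool" where
  "primitive_word w \<longleftrightarrow> (\<forall>r. 0 < r \<and> r < D \<longrightarrow> rotate r w \<noteq> w)"

text \<open>Parameters of the same point differ by a factor \<open>\<omega> ^ r\<close>. For
  \<open>r \<noteq> 0\<close>, rotating a primitive word changes it, so the two corresponding tuples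
  are different polynomials and agree at only finitely many parameters.\<close>

lemma primitive_word_tuple_injective:
  assumes w: "w \<in> d_words n d" "primitive_word w"
  shows "finite {t. \<exists>s. s \<noteq> t \<and> (\<forall>i<n. poly (word_tuple w i) s = poly (word_tuple w i) t)}"
proof (rule finite_subset)
  let ?A = "\<lambda>r. {t. \<forall>i<n. poly (word_tuple w i) (\<omega> ^ r * t) = poly (word_tuple w i) t}"
  show "{t. \<exists>s. s \<noteq> t \<and> (\<forall>i<n. poly (word_tuple w i) s = poly (word_tuple w i) t)} \<subseteq> (\<Union>r\<in>{0<..<D}. ?A r)"
  proof safe
    fix t s assume st: "s \<noteq> t" "\<forall>i<n. poly (word_tuple w i) s = poly (word_tuple w i) t"
    then have "s ^ D = t ^ D" using word_tuple_power_D_eq[OF w(1) w(1)] by blast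
    then obtain r where r: "r < D" "s = \<omega> ^ r * t" by (rule power_D_eqE)
    then have "r \<noteq> 0" using st(1) by (intro notI) simp
    then show "t \<in> (\<Union>r\<in>{0<..<D}. ?A r)" using r st(2) by auto
  qed
  have "finite (?A r)" if "r \<in> {0<..<D}" for r
  proof -
    have "rotate r w \<noteq> w" using w(2) that by (simp add: primitive_word_def)
    then obtain i where i: "i < n" "rescale (\<omega> ^ r) (word_tuple w i) \<noteq> word_tuple w i"
      using word_tuple_inj[OF rotate_d_word[OF w(1)] w(1), of r] word_tuple_rotate[OF w(1)] by metis
    then have "finite {t. poly (rescale (\<omega> ^ r) (word_tuple w i) - word_tuple w i) t = 0}"
      by (intro poly_roots_finite) simp
    then show ?thesis by (rule rev_finite_subset) (use i in \<open>auto simp: poly_rescale\<close>)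
  qed
  then show "finite (\<Union>r\<in>{0<..<D}. ?A r)" by blast
qed

text \<open>Failing to be one-to-one is a closed condition near a primitive word: the set of parameters
  with a second preimage is cofinite, so a generic \<open>t\<close> is a limit of such parameters, and the second
  preimages accumulate either at a second preimage of \<open>t\<close> or at a critical point \<open>t\<close>.\<close>

lemma primitive_limit_one_fold:
  assumes w: "w \<in> d_words n d" "primitive_word w" and xs: "\<And>m. tuple (xs m)"
    and lim: "\<And>i. i < n \<Longrightarrow> pconv (\<lambda>m. xs m i) (word_tuple w i) sequentially"
    and bad: "\<And>m. \<not> one_fold n (xs m)"
  shows False
proof -
  let ?W = "word_tuple w"
  have n0: "0 < n" using n_pos by simp
  have deg: "degree (xs m i) \<le> d i" "degree (?W i) \<le> d i" if "i < n" for m i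
    using xs[of m] tuple_word_tuple[OF w(1)] that by (auto simp: tuple_def)
  have "pderiv (?W 0) \<noteq> 0" using degree_word_tuple[OF w(1) n0] d_pos[OF n0] by (simp add: pderiv_eq_0_iff)
  then have "finite ({t. \<exists>s. s \<noteq> t \<and> (\<forall>i<n. poly (?W i) s = poly (?W i) t)} \<union> {t. poly (pderiv (?W 0)) t = 0})"
    using primitive_word_tuple_injective[OF w] poly_roots_finite by blast
  \<comment> \<open>A good test parameter: its image has no other preimage on the limit curve, and
    the first coordinate is not critical there. Only finitely many parameters are excluded.\<close>
  then obtain t where t: "\<And>s. \<forall>i<n. poly (?W i) s = poly (?W i) t \<Longrightarrow> s = t" "poly (pderiv (?W 0)) t \<noteq> 0"
    using ex_new_if_finite[OF infinite_UNIV_char_0] by (smt (verit) UnCI mem_Collect_eq)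
  have "\<exists>u s. cmod (u - t) < inverse (real (Suc m)) \<and> s \<noteq> u \<and> param n (xs m) s = param n (xs m) u" for m
    using ex_near_not_in_finite[OF not_one_fold_cofinite[OF bad[of m]], of "inverse (real (Suc m))" t] by auto
  then obtain us ss where us: "\<And>m. cmod (us m - t) < inverse (real (Suc m))"
    and ne: "\<And>m. ss m \<noteq> us m" and eq: "\<And>m. param n (xs m) (ss m) = param n (xs m) (us m)"
    by metis
  have "\<forall>m. norm (us m - t) \<le> inverse (real (Suc m))" using us less_imp_le by blast
  then have "(\<lambda>m. us m - t) \<longlonglongrightarrow> 0"
    by (intro Lim_null_comparison[OF always_eventually LIMSEQ_inverse_real_of_nat])
  then have ut: "us \<longlonglongrightarrow> t" by (rule LIM_zero_cancel)
  have peq: "poly (xs m i) (ss m) = poly (xs m i) (us m)" if "i < n" for m i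
    using eq[of m] that by (simp add: param_eq_iff)
  have "(\<lambda>m. poly (xs m 0) (us m)) \<longlonglongrightarrow> poly (?W 0) t"
    by (rule tendsto_poly[OF lim[OF n0] ut deg[OF n0]])
  then have "Bseq (\<lambda>m. poly (xs m 0) (us m))" by (intro convergent_imp_Bseq convergentI)
  then obtain C where "\<And>m. cmod (poly (xs m 0) (us m)) \<le> C" unfolding Bseq_def by blast
  then have "bounded (range ss)"
    using d_pos[OF n0] degree_word_tuple[OF w(1) n0] deg(1)[OF n0] peq[OF n0]
    by (intro pconv_preimage_bounded[OF lim[OF n0]]) auto
  then obtain s r where r: "strict_mono r" and "(ss \<circ> r) \<longlonglongrightarrow> s"
    using bounded_imp_convergent_subsequence by blast
  then have sl: "(\<lambda>m. ss (r m)) \<longlonglongrightarrow> s" by (simp add: o_def)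
  have ul: "(\<lambda>m. us (r m)) \<longlonglongrightarrow> t" using LIMSEQ_subseq_LIMSEQ[OF ut r] by (simp add: o_def)
  have lim': "pconv (\<lambda>m. xs (r m) i) (?W i) sequentially" if "i < n" for i
    by (rule pconv_subseq[OF lim[OF that] r])
  have "poly (?W i) s = poly (?W i) t" if i: "i < n" for i
  proof (rule LIMSEQ_unique)
    show "(\<lambda>m. poly (xs (r m) i) (ss (r m))) \<longlonglongrightarrow> poly (?W i) s"
      by (rule tendsto_poly[OF lim'[OF i] sl deg[OF i]])
    show "(\<lambda>m. poly (xs (r m) i) (ss (r m))) \<longlonglongrightarrow> poly (?W i) t"
      unfolding peq[OF i] by (rule tendsto_poly[OF lim'[OF i] ul deg[OF i]])
  qed
  then have "s = t" using t(1) by blast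
  \<comment> \<open>The divided difference of the first coordinate at two distinct parameters of the
    same point, hence 0; with both parameters tending to \<open>t\<close>, its limit is the
    derivative at \<open>t\<close>.\<close>
  let ?g = "\<lambda>m. \<Sum>k\<le>d 0. coeff (xs (r m) 0) k * (\<Sum>l<k. us (r m) ^ (k - Suc l) * ss (r m) ^ l)"
  have "?g m = 0" for m
    using poly_eq_divided_diff[OF deg(1)[OF n0], of "r m" "ss (r m)" "us (r m)"] peq[OF n0, of "r m"] ne[of "r m"]
    by simp
  moreover have "?g \<longlonglongrightarrow> (\<Sum>k\<le>d 0. coeff (?W 0) k * (\<Sum>l<k. t ^ (k - Suc l) * s ^ l))"
    by (intro tendsto_intros pconvD[OF lim'[OF n0]] ul sl)
  ultimately have "(\<Sum>k\<le>d 0. coeff (?W 0) k * (\<Sum>l<k. t ^ (k - Suc l) * s ^ l)) = 0"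
    by (simp add: LIMSEQ_const_iff)
  moreover have "(\<Sum>l<k. t ^ (k - Suc l) * s ^ l) = of_nat k * t ^ (k - 1)" for k
  proof -
    have "t ^ (k - Suc l) * s ^ l = t ^ (k - 1)" if "l < k" for l
      using that \<open>s = t\<close> by (simp flip: power_add)
    then show ?thesis by simp
  qed
  ultimately have "poly (pderiv (?W 0)) t = 0" using poly_pderiv_sum[OF deg(2)[OF n0]] by simp
  with t(2) show False by simp
qed

text \<open>For a fixed \<open>t\<close>, the parameters on the curves \<open>xs m\<close> matching
  \<open>t\<close> on \<open>ys m\<close> stay bounded, and a limit of them has the form
  \<open>\<omega> ^ r * t\<close>. Infinitely many \<open>t\<close> share one \<open>r\<close>, and
  agreement at infinitely many parameters is an identity of polynomials, hence of words.\<close>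

lemma equal_range_limit:
  assumes w: "w \<in> d_words n d" and w': "w' \<in> d_words n d"
    and xs: "\<And>m. tuple (xs m)" and ys: "\<And>m. tuple (ys m)"
    and xlim: "\<And>i. i < n \<Longrightarrow> pconv (\<lambda>m. xs m i) (word_tuple w i) sequentially"
    and ylim: "\<And>i. i < n \<Longrightarrow> pconv (\<lambda>m. ys m i) (word_tuple w' i) sequentially"
    and range: "\<And>m. range (param n (xs m)) = range (param n (ys m))"
  shows "\<exists>r. w' = rotate r w"
proof -
  let ?W = "word_tuple w" and ?W' = "word_tuple w'"
  have n0: "0 < n" using n_pos by simp
  have deg: "degree (xs m i) \<le> d i" "degree (?W i) \<le> d i" "degree (ys m i) \<le> d i" "degree (?W' i) \<le> d i"
    if "i < n" for m i
    using xs[of m] ys[of m] tuple_word_tuple[OF w] tuple_word_tuple[OF w'] that by (auto simp: tuple_def)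
  have key: "\<exists>r<D. \<forall>i<n. poly (?W i) (\<omega> ^ r * t) = poly (?W' i) t" for t
  proof -
    have "\<exists>s. param n (xs m) s = param n (ys m) t" for m
      using range[of m] by (metis rangeE rangeI)
    then obtain ss where "\<And>m. param n (xs m) (ss m) = param n (ys m) t" by metis
    then have peq: "poly (xs m i) (ss m) = poly (ys m i) t" if "i < n" for m i
      using that by (simp add: param_eq_iff)
    have yt: "(\<lambda>m. poly (ys m i) t) \<longlonglongrightarrow> poly (?W' i) t" if "i < n" for i
      by (rule tendsto_poly[OF ylim[OF that] tendsto_const deg(3,4)[OF that]])
    have "Bseq (\<lambda>m. poly (ys m 0) t)" using yt[OF n0] by (intro convergent_imp_Bseq convergentI)
    then obtain C where "\<And>m. cmod (poly (ys m 0) t) \<le> C" unfolding Bseq_def by blast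
    then have "bounded (range ss)"
      using d_pos[OF n0] degree_word_tuple[OF w n0] deg(1)[OF n0] peq[OF n0]
      by (intro pconv_preimage_bounded[OF xlim[OF n0]]) auto
    then obtain s r where r: "strict_mono r" and "(ss \<circ> r) \<longlonglongrightarrow> s"
      using bounded_imp_convergent_subsequence by blast
    then have sl: "(\<lambda>m. ss (r m)) \<longlonglongrightarrow> s" by (simp add: o_def)
    have eq: "poly (?W i) s = poly (?W' i) t" if i: "i < n" for i
    proof (rule LIMSEQ_unique)
      show "(\<lambda>m. poly (xs (r m) i) (ss (r m))) \<longlonglongrightarrow> poly (?W i) s"
        by (rule tendsto_poly[OF pconv_subseq[OF xlim[OF i] r] sl deg(1,2)[OF i]])
      show "(\<lambda>m. poly (xs (r m) i) (ss (r m))) \<longlonglongrightarrow> poly (?W' i) t"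
        unfolding peq[OF i] using LIMSEQ_subseq_LIMSEQ[OF yt[OF i] r] by (simp add: o_def)
    qed
    then have "s ^ D = t ^ D" by (rule word_tuple_power_D_eq[OF w w'])
    then obtain r where "r < D" "s = \<omega> ^ r * t" by (rule power_D_eqE)
    with eq show ?thesis by blast
  qed
  let ?A = "\<lambda>r. {t. \<forall>i<n. poly (?W i) (\<omega> ^ r * t) = poly (?W' i) t}"
  have "(\<Union>r<D. ?A r) = UNIV" using key by auto
  then have "infinite (\<Union>r<D. ?A r)" using infinite_UNIV_char_0[where 'a = complex] by simp
  then obtain r where r: "infinite (?A r)" by blast
  have "word_tuple (rotate r w) i = ?W' i" if "i < n" for i
    unfolding word_tuple_rotate[OF w that]
    by (rule infinite_poly_eqI[OF r]) (use that in \<open>auto simp: poly_rescale\<close>)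
  then have "rotate r w = w'" by (rule word_tuple_inj[OF rotate_d_word[OF w] w'])
  then show ?thesis by blast
qed

text \<open>Limits of tuples that are not one-fold cannot be primitive, so such solutions accumulate
  only at the remaining words. That solutions near those words do fail to be one-fold follows later
  from rotational symmetry.\<close>

lemma near_one_fold:
  assumes "\<delta> > 0"
  shows "near (\<lambda>c. \<forall>x. solution c x \<and> \<not> one_fold n x \<longrightarrow>
    (\<exists>w\<in>d_words n d. \<not> primitive_word w \<and> tdist x (word_tuple w) < \<delta>))"
proof (rule nearI_seq)
  fix cs assume cs: "to_model cs" and "\<And>m. \<not> (\<forall>x. solution (cs m) x \<and> \<not> one_fold n x \<longrightarrow>
    (\<exists>w\<in>d_words n d. \<not> primitive_word w \<and> tdist x (word_tuple w) < \<delta>))"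
  then obtain xs where xs: "\<And>m. solution (cs m) (xs m)" "\<And>m. \<not> one_fold n (xs m)"
    and far: "\<And>m w. w \<in> d_words n d \<Longrightarrow> \<not> primitive_word w \<Longrightarrow> \<not> tdist (xs m) (word_tuple w) < \<delta>" by metis
  obtain r w where r: "strict_mono r" and w: "w \<in> d_words n d"
    and lim: "\<And>i. i < n \<Longrightarrow> pconv (\<lambda>m. xs (r m) i) (word_tuple w i) sequentially"
    using solution_limit[OF cs xs(1)] by blast
  have tup: "tuple (xs m)" for m using xs(1) by (simp add: solution_def)
  show False
  proof (cases "primitive_word w")
    case True
    show False by (rule primitive_limit_one_fold[OF w True tup lim xs(2)])
  next
    case False
    have "(\<lambda>m. tdist (xs (r m)) (word_tuple w)) \<longlonglongrightarrow> 0"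
      using tup w lim by (intro tdist_word_tuple_tendsto_0)
    then have "\<forall>\<^sub>F m in sequentially. tdist (xs (r m)) (word_tuple w) < \<delta>"
      using assms by (rule order_tendstoD(2))
    with far[OF w False] show False by simp
  qed
qed

lemma near_equal_range:
  assumes "\<delta> > 0"
  shows "near (\<lambda>c. \<forall>x y. solution c x \<and> solution c y \<and> range (param n x) = range (param n y) \<longrightarrow>
    (\<exists>w\<in>d_words n d. \<exists>r. tdist x (word_tuple w) < \<delta> \<and> tdist y (word_tuple (rotate r w)) < \<delta>))"
proof (rule nearI_seq)
  fix cs
  let ?far = "\<lambda>x y. \<not> (\<exists>w\<in>d_words n d. \<exists>r. tdist x (word_tuple w) < \<delta> \<and> tdist y (word_tuple (rotate r w)) < \<delta>)"
  assume cs: "to_model cs" and "\<And>m. \<not> (\<forall>x y. solution (cs m) x \<and> solution (cs m) y \<and>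
    range (param n x) = range (param n y) \<longrightarrow>
    (\<exists>w\<in>d_words n d. \<exists>r. tdist x (word_tuple w) < \<delta> \<and> tdist y (word_tuple (rotate r w)) < \<delta>))"
  then have "\<exists>x y. solution (cs m) x \<and> solution (cs m) y \<and> range (param n x) = range (param n y) \<and> ?far x y" for m
    by blast
  then obtain xs ys where sol: "\<And>m. solution (cs m) (xs m)" "\<And>m. solution (cs m) (ys m)"
    and range: "\<And>m. range (param n (xs m)) = range (param n (ys m))" and far: "\<And>m. ?far (xs m) (ys m)" by metis
  obtain r w where r: "strict_mono r" and w: "w \<in> d_words n d"
    and lim: "\<And>i. i < n \<Longrightarrow> pconv (\<lambda>m. xs (r m) i) (word_tuple w i) sequentially"
    using solution_limit[OF cs sol(1)] by blast
  \<comment> \<open>Extracted from the first subsequence, so that both limits are taken along the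
    same indices.\<close>
  obtain q w' where q: "strict_mono q" and w': "w' \<in> d_words n d"
    and ylim: "\<And>i. i < n \<Longrightarrow> pconv (\<lambda>m. ys (r (q m)) i) (word_tuple w' i) sequentially"
    using solution_limit[OF to_model_subseq[OF cs r] sol(2)] by blast
  have xlim: "pconv (\<lambda>m. xs (r (q m)) i) (word_tuple w i) sequentially" if "i < n" for i
    by (rule pconv_subseq[OF lim[OF that] q])
  have tup: "tuple (xs m)" "tuple (ys m)" for m using sol by (simp_all add: solution_def)
  obtain k where k: "w' = rotate k w"
    using equal_range_limit[OF w w' tup(1) tup(2) xlim ylim range] by blast
  have "(\<lambda>m. tdist (xs (r (q m))) (word_tuple w)) \<longlonglongrightarrow> 0" "(\<lambda>m. tdist (ys (r (q m))) (word_tuple w')) \<longlonglongrightarrow> 0"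
    by (rule tdist_word_tuple_tendsto_0[OF tup(1) w xlim], assumption)
      (rule tdist_word_tuple_tendsto_0[OF tup(2) w' ylim])
  then have "\<forall>\<^sub>F m in sequentially. tdist (xs (r (q m))) (word_tuple w) < \<delta>"
    "\<forall>\<^sub>F m in sequentially. tdist (ys (r (q m))) (word_tuple w') < \<delta>"
    using assms order_tendstoD(2) by blast+
  then have "\<forall>\<^sub>F m in sequentially. tdist (xs (r (q m))) (word_tuple w) < \<delta> \<and>
      tdist (ys (r (q m))) (word_tuple (rotate k w)) < \<delta>"
    unfolding k[symmetric] by eventually_elim simp
  then obtain m where "tdist (xs (r (q m))) (word_tuple w) < \<delta>"
      "tdist (ys (r (q m))) (word_tuple (rotate k w)) < \<delta>"
    using eventually_happens'[OF sequentially_bot] by blast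
  with far w show False by blast
qed

section \<open>Rotation classes of words\<close>

lemma finite_d_words: "finite (d_words n d)"
proof (rule finite_subset)
  show "d_words n d \<subseteq> {w. set w \<subseteq> {..<n} \<and> length w = D}"
    using length_d_word by (auto simp: d_words_def)
qed (rule finite_lists_length_eq, simp)

lemma rotation_class_eq_iff:
  "{rotate k w | k. True} = {rotate k w' | k. True} \<longleftrightarrow> (\<exists>r. w' = rotate r w)"
proof
  assume "{rotate k w | k. True} = {rotate k w' | k. True}"
  moreover have "w' \<in> {rotate k w' | k. True}" by (auto intro: exI[of _ 0])
  ultimately have "w' \<in> {rotate k w | k. True}" by simp
  then show "\<exists>r. w' = rotate r w" by auto
next
  assume "\<exists>r. w' = rotate r w"
  then obtain r where r: "w' = rotate r w" by blast
  have "\<exists>j. rotate k w = rotate j w'" for k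
  proof (cases "w = []")
    case False
    define L where "L = length w"
    \<comment> \<open>Rotation by \<open>L - r mod L\<close> undoes rotation by \<open>r\<close>,
      which makes the relation symmetric.\<close>
    have "(k + (L - r mod L) + r) mod L = k mod L"
    proof -
      have "r mod L \<le> L" using False by (simp add: L_def less_imp_le)
      then have "k + (L - r mod L) + r = k + L * Suc (r div L)"
        using mult_div_mod_eq[of L r] unfolding mult_Suc_right by linarith
      then show ?thesis by (simp only: mod_mult_self2)
    qed
    then have "rotate (k + (L - r mod L)) w' = rotate k w"
      unfolding r rotate_rotate L_def by (metis rotate_conv_mod)
    then show ?thesis by metis
  qed (simp add: r)
  moreover have "\<exists>j. rotate k w' = rotate j w" for k unfolding r rotate_rotate by blast
  ultimately show "{rotate k w | k. True} = {rotate k w' | k. True}" by blast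
qed

lemma card_rotation_class:
  assumes "w \<in> d_words n d"
  shows "card {rotate k w | k. True} = D \<longleftrightarrow> primitive_word w"
proof -
  have len: "length w = D" by (rule length_d_word[OF assms])
  have mod: "rotate k w = rotate (k mod D) w" for k using rotate_conv_mod[of k w] len by simp
  have "{rotate k w | k. True} = (\<lambda>k. rotate k w) ` {..<D}"
  proof safe
    fix k show "rotate k w \<in> (\<lambda>k. rotate k w) ` {..<D}"
      by (subst mod) (use D_pos in auto)
  qed auto
  then have "card {rotate k w | k. True} = D \<longleftrightarrow> inj_on (\<lambda>k. rotate k w) {..<D}"
    using inj_on_iff_eq_card[of "{..<D}" "\<lambda>k. rotate k w"] by simp
  also have "\<dots> \<longleftrightarrow> primitive_word w"
  proof
    assume inj: "inj_on (\<lambda>k. rotate k w) {..<D}"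
    show "primitive_word w" unfolding primitive_word_def
    proof (intro allI impI notI)
      fix r assume r: "0 < r \<and> r < D" "rotate r w = w"
      then have "r = 0" using inj_onD[OF inj, of r 0] D_pos by simp
      with r show False by simp
    qed
  next
    assume prim: "primitive_word w"
    have False if "j < k" "k < D" "rotate j w = rotate k w" for j k
    proof -
      have "rotate (D - j) (rotate j w) = rotate D w"
        unfolding rotate_rotate using that(1,2) by simp
      also have "\<dots> = w" using mod[of D] by simp
      finally have "rotate (D - j + k) w = w" unfolding that(3) rotate_rotate .
      moreover have "(D - j + k) mod D = k - j"
      proof -
        have "D - j + k = D + (k - j)" using that(1,2) by simp
        then have "(D - j + k) mod D = (k - j) mod D" by (simp only: mod_add_self1)
        then show ?thesis using that(1,2) by simp
      qed
      ultimately have "rotate (k - j) w = w" using mod[of "D - j + k"] by simp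
      then show False using prim that by (simp add: primitive_word_def)
    qed
    then show "inj_on (\<lambda>k. rotate k w) {..<D}"
      by (intro inj_onI) (metis lessThan_iff linorder_neqE_nat)
  qed
  finally show ?thesis .
qed

lemma primitive_necklaces_eq:
  "primitive_necklaces n d = (\<lambda>w. {rotate k w | k. True}) ` {w \<in> d_words n d. primitive_word w}"
  unfolding primitive_necklaces_def necklaces_def using card_rotation_class by auto

section \<open>The count for all coefficient vectors near the model\<close>

lemma tdist_rescale_unit: "cmod u = 1 \<Longrightarrow> tdist (\<lambda>i. rescale u (x i)) (\<lambda>i. rescale u (y i)) = tdist x y"
  unfolding tdist_def rescale_diff[symmetric] by (simp add: pnorm_rescale_unit)

lemma tdist_rotate:
  assumes "w \<in> d_words n d"
  shows "tdist (\<lambda>i. rescale (\<omega> ^ r) (x i)) (word_tuple (rotate r w)) = tdist x (word_tuple w)"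
proof -
  have "tdist (\<lambda>i. rescale (\<omega> ^ r) (x i)) (word_tuple (rotate r w)) =
      tdist (\<lambda>i. rescale (\<omega> ^ r) (x i)) (\<lambda>i. rescale (\<omega> ^ r) (word_tuple w i))"
    unfolding tdist_def by (intro sum.cong refl) (simp add: word_tuple_rotate[OF assms])
  then show ?thesis by (simp add: tdist_rescale_unit cmod_\<omega>)
qed

text \<open>Curves and necklaces are both images of the set of primitive words; comparing when two
  words have the same image avoids an explicit bijection.\<close>

lemma card_image_eq_if_same_kernel:
  assumes "\<And>u v. u \<in> A \<Longrightarrow> v \<in> A \<Longrightarrow> f u = f v \<longleftrightarrow> g u = g v"
  shows "card (f ` A) = card (g ` A)"
proof -
  let ?h = "\<lambda>y. g (SOME u. u \<in> A \<and> f u = y)"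
  have h: "?h (f u) = g u" if "u \<in> A" for u
  proof -
    have "(SOME v. v \<in> A \<and> f v = f u) \<in> A \<and> f (SOME v. v \<in> A \<and> f v = f u) = f u"
      by (rule someI[of _ u]) (use that in auto)
    then show ?thesis using assms that by blast
  qed
  then have "inj_on ?h (f ` A)" using assms by (auto simp: inj_on_def)
  moreover have "?h ` (f ` A) = g ` A" using h by (force simp: image_image)
  ultimately show ?thesis using card_image by fastforce
qed

text \<open>Close to the model each word \<open>w\<close> has a unique solution \<open>sol w\<close>
  beside it, and there are no other solutions. By uniqueness \<open>sol\<close> is equivariant under
  rotation, so primitivity of the word decides whether the curve is one-fold, and rotation classes
  decide which curves coincide.\<close>

lemma near_card_osculants:
  "near (\<lambda>c. finite (osculants n d c) \<and> card (osculants n d c) = card (primitive_necklaces n d))"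
proof -
  let ?T = word_tuple
  define uniq where "uniq w \<delta> c \<longleftrightarrow> (\<forall>x y. solution c x \<and> solution c y \<and> tdist x (?T w) \<le> \<delta> \<and>
      tdist y (?T w) \<le> \<delta> \<longrightarrow> (\<forall>i<n. x i = y i))" for w \<delta> c
  define ex where "ex w \<delta> c \<longleftrightarrow> (\<exists>x. solution c x \<and> tdist x (?T w) < \<delta>)" for w \<delta> c
  have "\<forall>w\<in>d_words n d. \<exists>\<delta>0>0. near (uniq w \<delta>0) \<and> (\<forall>\<delta>. 0 < \<delta> \<and> \<delta> \<le> \<delta>0 \<longrightarrow> near (ex w \<delta>))"
    using local_solution unfolding uniq_def ex_def by blast
  then obtain \<delta>0 where \<delta>0: "\<And>w. w \<in> d_words n d \<Longrightarrow> \<delta>0 w > 0"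
    "\<And>w. w \<in> d_words n d \<Longrightarrow> near (uniq w (\<delta>0 w))"
    "\<And>w \<delta>. w \<in> d_words n d \<Longrightarrow> 0 < \<delta> \<Longrightarrow> \<delta> \<le> \<delta>0 w \<Longrightarrow> near (ex w \<delta>)" by metis
  \<comment> \<open>Below all these radii, a solution near a word is unique, and it cannot be near
    two words because the half distances separate them. The element 1 inserted in the next
    definition keeps the set nonempty for \<open>Min\<close>.\<close>
  define S where "S = \<delta>0 ` d_words n d \<union>
    (\<lambda>(w, w'). tdist (?T w) (?T w') / 2) ` {(w, w') \<in> d_words n d \<times> d_words n d. w \<noteq> w'}"
  have "finite {(w, w') \<in> d_words n d \<times> d_words n d. w \<noteq> w'}"
    by (rule finite_subset[of _ "d_words n d \<times> d_words n d"]) (auto simp: finite_d_words)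
  then have finS: "finite S" unfolding S_def using finite_d_words by blast
  have sep: "tdist (?T w) (?T w') > 0" if "w \<in> d_words n d" "w' \<in> d_words n d" "w \<noteq> w'" for w w'
  proof -
    have "tdist (?T w) (?T w') \<noteq> 0"
      using word_tuple_inj[OF that(1,2)] that(3) unfolding tdist_eq_tnorm tnorm_eq_0_iff by auto
    then show ?thesis using tdist_nonneg[of "?T w" "?T w'"] by simp
  qed
  define \<delta> where "\<delta> = Min (insert 1 S)"
  have "\<delta> > 0" unfolding \<delta>_def using finS \<delta>0(1) sep by (subst Min_gr_iff) (auto simp: S_def)
  have \<delta>S: "\<delta> \<le> s" if "s \<in> S" for s unfolding \<delta>_def using finS that by simp
  have \<delta>1: "\<delta> \<le> \<delta>0 w" if "w \<in> d_words n d" for w using that by (intro \<delta>S) (auto simp: S_def)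
  have \<delta>2: "\<delta> \<le> tdist (?T w) (?T w') / 2" if "w \<in> d_words n d" "w' \<in> d_words n d" "w \<noteq> w'" for w w'
    using that by (intro \<delta>S) (force simp: S_def)
  have same: "w = w'" if "w \<in> d_words n d" "w' \<in> d_words n d" "tdist x (?T w) < \<delta>" "tdist x (?T w') < \<delta>" for w w' x
  proof (rule ccontr)
    assume "w \<noteq> w'"
    then show False using \<delta>2[OF that(1,2)] that(3,4) tdist_triangle[of "?T w" "?T w'" x] tdist_commute[of x "?T w"]
      by simp
  qed
  have "near (\<lambda>c. (\<forall>w\<in>d_words n d. uniq w (\<delta>0 w) c) \<and> (\<forall>w\<in>d_words n d. ex w \<delta> c) \<and>
    (\<forall>x. tuple x \<and> (\<forall>k\<le>D. coeff (fcomp n D c x) k = 0) \<longrightarrow> (\<forall>i<n. x i = 0)) \<and>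
    (\<forall>x. solution c x \<longrightarrow> (\<exists>w\<in>d_words n d. tdist x (?T w) < \<delta>)) \<and>
    (\<forall>x. solution c x \<longrightarrow> (\<forall>i<n. degree (x i) = d i)) \<and>
    (\<forall>x. solution c x \<and> \<not> one_fold n x \<longrightarrow>
      (\<exists>w\<in>d_words n d. \<not> primitive_word w \<and> tdist x (?T w) < \<delta>)) \<and>
    (\<forall>x y. solution c x \<and> solution c y \<and> range (param n x) = range (param n y) \<longrightarrow>
      (\<exists>w\<in>d_words n d. \<exists>r. tdist x (?T w) < \<delta> \<and> tdist y (?T (rotate r w)) < \<delta>)))"
    using \<open>\<delta> > 0\<close> \<delta>1
    by (intro near_conj near_ball finite_d_words \<delta>0 near_only_zero near_solutions_near_words
        near_solutions_degree near_one_fold near_equal_range) auto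
  then show ?thesis
  proof (rule near_mono, elim conjE)
    fix c
    assume uniq: "\<forall>w\<in>d_words n d. uniq w (\<delta>0 w) c" and ex: "\<forall>w\<in>d_words n d. ex w \<delta> c"
      and only0: "\<forall>x. tuple x \<and> (\<forall>k\<le>D. coeff (fcomp n D c x) k = 0) \<longrightarrow> (\<forall>i<n. x i = 0)"
      and all: "\<forall>x. solution c x \<longrightarrow> (\<exists>w\<in>d_words n d. tdist x (?T w) < \<delta>)"
      and deg: "\<forall>x. solution c x \<longrightarrow> (\<forall>i<n. degree (x i) = d i)"
      and of: "\<forall>x. solution c x \<and> \<not> one_fold n x \<longrightarrow>
        (\<exists>w\<in>d_words n d. \<not> primitive_word w \<and> tdist x (?T w) < \<delta>)"
      and er: "\<forall>x y. solution c x \<and> solution c y \<and> range (param n x) = range (param n y) \<longrightarrow>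
        (\<exists>w\<in>d_words n d. \<exists>r. tdist x (?T w) < \<delta> \<and> tdist y (?T (rotate r w)) < \<delta>)"
    obtain sol where sol: "\<And>w. w \<in> d_words n d \<Longrightarrow> solution c (sol w)"
        "\<And>w. w \<in> d_words n d \<Longrightarrow> tdist (sol w) (?T w) < \<delta>"
      using ex unfolding ex_def by metis
    have eq_sol: "x i = sol w i" if "solution c x" "w \<in> d_words n d" "tdist x (?T w) < \<delta>" "i < n" for x w i
      using uniq that sol[OF that(2)] \<delta>1[OF that(2)] unfolding uniq_def by fastforce
    \<comment> \<open>The rescaled tuple is again a solution and lies near the rotated word, so
      local uniqueness identifies it.\<close>
    have rot: "rescale (\<omega> ^ r) (sol w i) = sol (rotate r w) i" if "w \<in> d_words n d" "i < n" for w r i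
    proof (rule eq_sol)
      have "(\<omega> ^ r) ^ D = 1" using \<omega>_power_D by (metis mult.commute power_mult power_one)
      then show "solution c (\<lambda>i. rescale (\<omega> ^ r) (sol w i))" by (rule solution_rescale[OF sol(1)[OF that(1)]])
      show "tdist (\<lambda>i. rescale (\<omega> ^ r) (sol w i)) (?T (rotate r w)) < \<delta>"
        using tdist_rotate[OF that(1)] sol(2)[OF that(1)] by simp
    qed (use rotate_d_word that in auto)
    have of_iff: "one_fold n (sol w) \<longleftrightarrow> primitive_word w" if w: "w \<in> d_words n d" for w
    proof
      assume "primitive_word w"
      show "one_fold n (sol w)"
      proof (rule ccontr)
        assume "\<not> one_fold n (sol w)"
        then obtain w' where "w' \<in> d_words n d" "\<not> primitive_word w'" "tdist (sol w) (?T w') < \<delta>"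
          using of sol(1)[OF w] by blast
        then show False using same[OF w] sol(2)[OF w] \<open>primitive_word w\<close> by blast
      qed
    next
      assume of_w: "one_fold n (sol w)"
      \<comment> \<open>A word fixed by a proper rotation makes \<open>sol w\<close> invariant under
        \<open>t \<mapsto> \<omega> ^ r * t\<close>, so every nonzero parameter shares its point
        with another one.\<close>
      show "primitive_word w" unfolding primitive_word_def
      proof (intro allI impI notI)
        fix r assume r: "0 < r \<and> r < D" and "rotate r w = w"
        then have "rescale (\<omega> ^ r) (sol w i) = sol w i" if "i < n" for i using rot[OF w that, of r] by simp
        then have "poly (sol w i) (\<omega> ^ r * t) = poly (sol w i) t" if "i < n" for i t
          using that poly_rescale by metis
        then have "param n (sol w) (\<omega> ^ r * t) = param n (sol w) t" for t by (simp add: param_eq_iff)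
        moreover have "\<omega> ^ r \<noteq> 1" using \<omega>_power_inj[of r 0] r by auto
        ultimately have "UNIV - {0} \<subseteq> {t. \<exists>s. s \<noteq> t \<and> param n (sol w) s = param n (sol w) t}"
          by (auto intro!: exI[of _ "\<omega> ^ r * _"])
        then have "finite (UNIV - {0 :: complex})" using of_w unfolding one_fold_def by (rule finite_subset)
        then show False using infinite_UNIV_char_0[where 'a = complex] by simp
      qed
    qed
    let ?A = "{w \<in> d_words n d. primitive_word w}"
    have osc: "osculants n d c = (\<lambda>w. range (param n (sol w))) ` ?A"
    proof (intro set_eqI iffI)
      fix C assume "C \<in> osculants n d c"
      then obtain x where x: "C = range (param n x)" "d_param n d x" "one_fold n x" "approximates n D c x D"
        unfolding osculants_def by blast
      have tup: "tuple x" using x(2) by (auto simp: d_param_def tuple_def poly_0_coeff_0)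
      have low: "coeff (fcomp n D c x) k = 0" if "k < D" for k
      proof -
        have "[:0, 1:] ^ D = (monom 1 D :: complex poly)" by (simp add: monom_altdef)
        then show ?thesis using x(4) that unfolding approximates_def by (simp add: monom_1_dvd_iff')
      qed
      define a where "a = coeff (fcomp n D c x) D"
      \<comment> \<open>Since \<open>d 0\<close> is positive, \<open>x\<close> is a nonzero tuple,
        so by \<open>only0\<close> not all coefficients up to \<open>D\<close> vanish; only the one
        at \<open>D\<close> is left.\<close>
      have "x 0 \<noteq> 0" using x(2) n_pos d_pos[of 0] by (auto simp: d_param_def)
      then have "\<not> (\<forall>k\<le>D. coeff (fcomp n D c x) k = 0)" using only0 tup n_pos by force
      then have "a \<noteq> 0" using low le_neq_implies_less unfolding a_def by blast
      \<comment> \<open>Replacing \<open>t\<close> by \<open>u * t\<close> multiplies the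
        coefficient at \<open>t^D\<close> by \<open>u ^ D\<close>; such a \<open>u\<close> turns
        \<open>a\<close> into -1 and leaves the image of the curve unchanged.\<close>
      have "card {u. u ^ D = - 1 / a} = D" using \<open>a \<noteq> 0\<close> D_pos by (intro card_nth_roots) auto
      then have "{u. u ^ D = - 1 / a} \<noteq> {}" using D_pos by (metis card.empty less_irrefl)
      then obtain u where u: "u ^ D = - 1 / a" by blast
      then have "u \<noteq> 0" using \<open>a \<noteq> 0\<close> D_pos by (intro notI) (simp add: power_0_left)
      have sol_u: "solution c (\<lambda>i. rescale u (x i))"
        unfolding solution_def fcomp_rescale using low u \<open>a \<noteq> 0\<close> tup
        by (auto simp: coeff_rescale tuple_rescale a_def[symmetric])
      then obtain w where w: "w \<in> d_words n d" "tdist (\<lambda>i. rescale u (x i)) (?T w) < \<delta>" using all by blast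
      then have eq: "sol w i = rescale u (x i)" if "i < n" for i using eq_sol[OF sol_u w that] by simp
      have "one_fold n (sol w)" using eq by (rule one_fold_rescale[OF \<open>u \<noteq> 0\<close> _ x(3)])
      then have "primitive_word w" using of_iff[OF w(1)] by simp
      moreover have "range (param n (sol w)) = C"
        unfolding x(1) using eq by (rule range_param_rescale[OF \<open>u \<noteq> 0\<close>])
      ultimately show "C \<in> (\<lambda>w. range (param n (sol w))) ` ?A" using w(1) by blast
    next
      fix C assume "C \<in> (\<lambda>w. range (param n (sol w))) ` ?A"
      then obtain w where w: "w \<in> d_words n d" "primitive_word w" "C = range (param n (sol w))" by blast
      note s = sol(1)[OF w(1)]
      have "d_param n d (sol w)"
        using s deg unfolding d_param_def solution_def tuple_def by (auto simp: poly_0_coeff_0)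
      moreover have "one_fold n (sol w)" using of_iff w by simp
      moreover have "approximates n D c (sol w) D"
      proof -
        have "[:0, 1:] ^ D = (monom 1 D :: complex poly)" by (simp add: monom_altdef)
        then show ?thesis using s unfolding approximates_def by (simp add: monom_1_dvd_iff' solution_def)
      qed
      ultimately show "C \<in> osculants n d c" unfolding osculants_def w(3) by blast
    qed
    have "range (param n (sol w)) = range (param n (sol w')) \<longleftrightarrow>
        {rotate k w | k. True} = {rotate k w' | k. True}" if "w \<in> ?A" "w' \<in> ?A" for w w'
    proof -
      have w: "w \<in> d_words n d" "w' \<in> d_words n d" using that by auto
      show ?thesis unfolding rotation_class_eq_iff
      proof
        assume "range (param n (sol w)) = range (param n (sol w'))"
        then obtain v r where v: "v \<in> d_words n d" "tdist (sol w) (?T v) < \<delta>" "tdist (sol w') (?T (rotate r v)) < \<delta>"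
          using er sol(1) w by blast
        have "w = v" using same[OF w(1) v(1) sol(2)[OF w(1)] v(2)] .
        moreover have "w' = rotate r v" using same[OF w(2) rotate_d_word[OF v(1)] sol(2)[OF w(2)] v(3)] .
        ultimately show "\<exists>r. w' = rotate r w" by blast
      next
        assume "\<exists>r. w' = rotate r w"
        then obtain r where r: "w' = rotate r w" by blast
        have "range (param n (sol w')) = range (param n (sol w))"
          by (rule range_param_rescale[of "\<omega> ^ r"]) (use \<omega>_nonzero rot[OF w(1)] r in auto)
        then show "range (param n (sol w)) = range (param n (sol w'))" by simp
      qed
    qed
    then have "card (osculants n d c) = card (primitive_necklaces n d)"
      unfolding primitive_necklaces_eq osc by (rule card_image_eq_if_same_kernel)
    moreover have "finite (osculants n d c)" unfolding osc using finite_d_words by simp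
    ultimately show "finite (osculants n d c) \<and> card (osculants n d c) = card (primitive_necklaces n d)"
      by blast
  qed
qed

end

section \<open>Counting osculants is a constructible condition\<close>

text \<open>\<open>Coef \<alpha>\<close> is the coefficient of the hypersurface at the monomial \<open>\<alpha>\<close>, \<open>Par k i j\<close> the
  coefficient at \<open>t\<^sup>j\<close> of the \<open>i\<close>-th coordinate of the \<open>k\<close>-th parametrization, and \<open>Src\<close>, \<open>Tgt\<close>
  are parameter values on two curves.\<close>

datatype osc_var = Coef "nat \<Rightarrow> nat" | Par nat nat nat | Src | Tgt

text \<open>The index starts at 1, which builds in \<open>x(0) = 0\<close>. The coefficient at
  \<open>d i\<close> may be 0, so the exact degree remains a condition to be imposed.\<close>

definition env_poly :: "(nat \<Rightarrow> nat) \<Rightarrow> (osc_var \<Rightarrow> complex) \<Rightarrow> nat \<Rightarrow> nat \<Rightarrow> complex poly" where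
  "env_poly d e k i = (\<Sum>j\<in>{1..d i}. monom (e (Par k i j)) j)"

definition osculates :: "nat \<Rightarrow> (nat \<Rightarrow> nat) \<Rightarrow> ((nat \<Rightarrow> nat) \<Rightarrow> complex) \<Rightarrow> (nat \<Rightarrow> complex poly) \<Rightarrow> bool" where
  "osculates n d c x \<longleftrightarrow> d_param n d x \<and> one_fold n x \<and> approximates n (dsum n d) c x (dsum n d)"

definition block :: "nat \<Rightarrow> (nat \<Rightarrow> nat) \<Rightarrow> nat \<Rightarrow> osc_var set" where
  "block n d k = (\<lambda>(i, j). Par k i j) ` (SIGMA i:{..<n}. {1..d i})"

lemma finite_block: "finite (block n d k)"
  unfolding block_def by blast

lemma param_cong: "(\<And>i. i < n \<Longrightarrow> x i = y i) \<Longrightarrow> param n x = param n y"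
  unfolding param_def by fastforce

lemma fcomp_cong:
  "(\<And>i. i < n \<Longrightarrow> x i = y i) \<Longrightarrow> (\<And>\<alpha>. \<alpha> \<in> mons n D \<Longrightarrow> c \<alpha> = c' \<alpha>) \<Longrightarrow> fcomp n D c x = fcomp n D c' y"
  unfolding fcomp_def by (intro sum.cong refl arg_cong2[of _ _ _ _ smult] prod.cong) auto

lemma osculates_cong:
  assumes "\<And>i. i < n \<Longrightarrow> x i = y i" "\<And>\<alpha>. \<alpha> \<in> mons n (dsum n d) \<Longrightarrow> c \<alpha> = c' \<alpha>"
  shows "osculates n d c x \<longleftrightarrow> osculates n d c' y"
proof -
  have "param n x = param n y" using assms(1) by (rule param_cong)
  moreover have "fcomp n (dsum n d) c x = fcomp n (dsum n d) c' y" using assms by (rule fcomp_cong)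
  moreover have "d_param n d x \<longleftrightarrow> d_param n d y" using assms(1) by (auto simp: d_param_def)
  ultimately show ?thesis unfolding osculates_def one_fold_def approximates_def by simp
qed

lemma osculants_eq: "osculants n d c = (\<lambda>x. range (param n x)) ` {x. osculates n d c x}"
  unfolding osculants_def osculates_def by auto

lemma coeff_env_poly: "coeff (env_poly d e k i) j = (if 1 \<le> j \<and> j \<le> d i then e (Par k i j) else 0)"
  unfolding env_poly_def coeff_sum coeff_monom by (simp add: sum.delta)

lemma env_poly_cong:
  "(\<And>j. 1 \<le> j \<Longrightarrow> j \<le> d i \<Longrightarrow> e (Par k i j) = e' (Par k i j)) \<Longrightarrow> env_poly d e k i = env_poly d e' k i"
  by (auto simp: poly_eq_iff coeff_env_poly)

lemma env_poly_eqI: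
  assumes "d_param n d x" "i < n" "\<And>j. 1 \<le> j \<Longrightarrow> j \<le> d i \<Longrightarrow> e (Par k i j) = coeff (x i) j"
  shows "env_poly d e k i = x i"
proof (rule poly_eqI)
  fix j
  have "coeff (x i) j = 0" if "j = 0 \<or> j > d i"
    using assms(1,2) that by (auto simp: d_param_def coeff_eq_0 poly_0_coeff_0)
  then show "coeff (env_poly d e k i) j = coeff (x i) j"
    using assms(3)[of j] by (auto simp: coeff_env_poly Suc_le_eq not_less[symmetric])
qed

lemma polyfun_coeff_env_poly: "polyfun UNIV (\<lambda>e. coeff (env_poly d e k i) j)"
  unfolding coeff_env_poly by (cases "1 \<le> j \<and> j \<le> d i") (auto intro: polyfun.intros)

lemma polyfun_poly_env_poly: "polyfun UNIV (\<lambda>e. poly (env_poly d e k i) (e v))"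
  unfolding env_poly_def poly_sum poly_monom
  by (intro polyfun_sum polyfun.mult polyfun_power polyfun.var) auto

lemma polyfun_coeff_mult:
  assumes "\<And>j. polyfun V (\<lambda>e. coeff (f e) j)" "\<And>j. polyfun V (\<lambda>e. coeff (g e) j)"
  shows "polyfun V (\<lambda>e. coeff (f e * g e) j)"
  unfolding coeff_mult by (intro polyfun_sum polyfun.mult assms)

lemma polyfun_coeff_power:
  assumes "\<And>j. polyfun V (\<lambda>e. coeff (f e) j)"
  shows "polyfun V (\<lambda>e. coeff (f e ^ m) j)"
proof (induction m arbitrary: j)
  case 0
  show ?case by (simp add: polyfun.const)
next
  case (Suc m)
  then show ?case unfolding power_Suc by (intro polyfun_coeff_mult assms)
qed

lemma polyfun_coeff_prod:
  assumes "\<And>i j. i \<in> A \<Longrightarrow> polyfun V (\<lambda>e. coeff (f i e) j)"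
  shows "polyfun V (\<lambda>e. coeff (\<Prod>i\<in>A. f i e) j)"
  using assms
proof (induction A arbitrary: j rule: infinite_finite_induct)
  case (insert i A)
  have "polyfun V (\<lambda>e. coeff (f i e * (\<Prod>i\<in>A. f i e)) j)"
    by (intro polyfun_coeff_mult insert) auto
  then show ?case using insert.hyps by simp
qed (simp_all add: polyfun.const)

text \<open>Exact degrees are inequations on leading coefficients, and approximation is the
  vanishing of \<open>D\<close> coefficients. Generic injectivity is the condition that calls for
  elimination of quantifiers.\<close>

lemma constructible_osculates:
  assumes "\<And>i. i < n \<Longrightarrow> d i > 0"
  shows "constructible UNIV (\<lambda>e. osculates n d (\<lambda>\<alpha>. e (Coef \<alpha>)) (env_poly d e k))"
  unfolding osculates_def
proof (intro constructible.conj)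
  let ?D = "dsum n d"
  have "d_param n d (env_poly d e k) \<longleftrightarrow> (\<forall>i\<in>{..<n}. \<not> e (Par k i (d i)) = 0)" for e
  proof -
    have "poly (env_poly d e k i) 0 = 0" for i by (simp add: poly_0_coeff_0 coeff_env_poly)
    moreover have "degree (env_poly d e k i) = d i \<longleftrightarrow> e (Par k i (d i)) \<noteq> 0" if "i < n" for i
    proof
      assume "degree (env_poly d e k i) = d i"
      then have "coeff (env_poly d e k i) (d i) \<noteq> 0"
        using assms[OF that] by (metis degree_0 leading_coeff_0_iff less_irrefl)
      then show "e (Par k i (d i)) \<noteq> 0" using assms[OF that] by (simp add: coeff_env_poly)
    next
      assume "e (Par k i (d i)) \<noteq> 0"
      then have "coeff (env_poly d e k i) (d i) \<noteq> 0"
        using assms[OF that] by (simp add: coeff_env_poly Suc_le_eq)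
      moreover have "degree (env_poly d e k i) \<le> d i" by (intro degree_le) (simp add: coeff_env_poly)
      ultimately show "degree (env_poly d e k i) = d i" by (intro antisym le_degree)
    qed
    ultimately show ?thesis by (auto simp: d_param_def)
  qed
  moreover have "constructible UNIV (\<lambda>e. \<forall>i\<in>{..<n}. \<not> e (Par k i (d i)) = 0)"
    by (intro constructible_all_finite constructible.neg constructible.zero polyfun.var) auto
  ultimately show "constructible UNIV (\<lambda>e. d_param n d (env_poly d e k))" by simp

  let ?P = "\<lambda>e. \<not> e Src = e Tgt \<and> (\<forall>i\<in>{..<n}. poly (env_poly d e k i) (e Src) = poly (env_poly d e k i) (e Tgt))"
  have "constructible UNIV ?P"
    by (intro constructible.conj constructible.neg constructible_all_finite constructible_eq
        polyfun_poly_env_poly polyfun.var) auto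
  \<comment> \<open>The partner \<open>Src\<close> is quantified first, and then the set of values
    of \<open>Tgt\<close> is tested for finiteness. Updating these two variables does not change
    \<open>env_poly\<close>.\<close>
  from constructible_finite[OF constructible_ex[OF this, of Src], of Tgt]
  have cons: "constructible UNIV (\<lambda>e. finite {t. \<exists>s. ?P (e(Tgt := t, Src := s))})" .
  have "?P (e(Tgt := t, Src := s)) \<longleftrightarrow> s \<noteq> t \<and> param n (env_poly d e k) s = param n (env_poly d e k) t" for e s t
  proof -
    have "env_poly d (e(Tgt := t, Src := s)) k i = env_poly d e k i" for i by (rule env_poly_cong) simp
    then show ?thesis by (auto simp: param_eq_iff)
  qed
  with cons show "constructible UNIV (\<lambda>e. one_fold n (env_poly d e k))"
    unfolding one_fold_def by (simp only:)

  have "approximates n ?D c x ?D \<longleftrightarrow> (\<forall>j\<in>{..<?D}. coeff (fcomp n ?D c x) j = 0)" for c x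
  proof -
    have "[:0, 1:] ^ ?D = (monom 1 ?D :: complex poly)" by (simp add: monom_altdef)
    then show ?thesis unfolding approximates_def by (simp add: monom_1_dvd_iff' lessThan_def)
  qed
  moreover have "constructible UNIV (\<lambda>e. \<forall>j\<in>{..<?D}. coeff (fcomp n ?D (\<lambda>\<alpha>. e (Coef \<alpha>)) (env_poly d e k)) j = 0)"
    unfolding fcomp_def coeff_sum coeff_smult
    by (intro constructible_all_finite constructible.zero polyfun_sum polyfun.mult polyfun.var
        polyfun_coeff_prod polyfun_coeff_power polyfun_coeff_env_poly) auto
  ultimately show "constructible UNIV (\<lambda>e. approximates n ?D (\<lambda>\<alpha>. e (Coef \<alpha>)) (env_poly d e k) ?D)"
    by simp
qed

text \<open>Each inclusion of images is a statement of the form "for all parameters there is a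
  parameter", whose two quantifiers are eliminated in turn.\<close>

lemma constructible_range_eq:
  "constructible UNIV (\<lambda>e. range (param n (env_poly d e k)) = range (param n (env_poly d e l)))"
proof -
  have sub: "constructible UNIV (\<lambda>e. range (param n (env_poly d e k)) \<subseteq> range (param n (env_poly d e l)))" for k l
  proof -
    let ?P = "\<lambda>e. \<forall>i\<in>{..<n}. poly (env_poly d e l i) (e Src) = poly (env_poly d e k i) (e Tgt)"
    have "constructible UNIV ?P"
      by (intro constructible_all_finite constructible_eq polyfun_poly_env_poly) auto
    from constructible_all[OF constructible_ex[OF this, of Src], of Tgt]
    have cons: "constructible UNIV (\<lambda>e. \<forall>t. \<exists>s. ?P (e(Tgt := t, Src := s)))" .
    have "?P (e(Tgt := t, Src := s)) \<longleftrightarrow> param n (env_poly d e l) s = param n (env_poly d e k) t" for e s t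
    proof -
      have "env_poly d (e(Tgt := t, Src := s)) k' i = env_poly d e k' i" for k' i by (rule env_poly_cong) simp
      then show ?thesis by (auto simp: param_eq_iff)
    qed
    with cons have "constructible UNIV (\<lambda>e. \<forall>t. \<exists>s. param n (env_poly d e l) s = param n (env_poly d e k) t)"
      by (simp only:)
    moreover have "range (param n (env_poly d e k)) \<subseteq> range (param n (env_poly d e l)) \<longleftrightarrow>
        (\<forall>t. \<exists>s. param n (env_poly d e l) s = param n (env_poly d e k) t)" for e
      by (auto simp: subset_iff image_iff) metis+
    ultimately show ?thesis by simp
  qed
  show ?thesis unfolding set_eq_subset by (intro constructible.conj sub)
qed

text \<open>Having exactly \<open>K\<close> osculants is expressed in first-order terms: some
  \<open>K\<close> osculating parametrizations have pairwise different images, and no further one,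
  stored in the fresh block \<open>K\<close>, has an image different from all of these.\<close>

lemma constructible_card_osculants:
  assumes pos: "\<And>i. i < n \<Longrightarrow> d i > 0"
  shows "constructible UNIV (\<lambda>e. finite (osculants n d (\<lambda>\<alpha>. e (Coef \<alpha>))) \<and>
    card (osculants n d (\<lambda>\<alpha>. e (Coef \<alpha>))) = K)"
proof -
  let ?osc = "\<lambda>e k. osculates n d (\<lambda>\<alpha>. e (Coef \<alpha>)) (env_poly d e k)"
  let ?R = "\<lambda>e k. range (param n (env_poly d e k))"
  let ?V = "\<Union>k<K. block n d k"
  let ?more = "\<lambda>e. \<exists>z. ?osc (override_on e z (block n d K)) K \<and>
    (\<forall>k\<in>{..<K}. \<not> ?R (override_on e z (block n d K)) k = ?R (override_on e z (block n d K)) K)"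
  let ?list = "\<lambda>e. (\<forall>k\<in>{..<K}. ?osc e k) \<and> (\<forall>k\<in>{..<K}. \<forall>l\<in>{..<k}. \<not> ?R e k = ?R e l) \<and> \<not> ?more e"
  have "constructible UNIV ?more"
    by (rule constructible_ex_block[OF finite_block], intro constructible.conj constructible_all_finite
        constructible.neg constructible_osculates constructible_range_eq pos) auto
  then have "constructible UNIV ?list"
    by (intro constructible.conj constructible_all_finite constructible.neg constructible_osculates
        constructible_range_eq pos) auto
  then have cons: "constructible UNIV (\<lambda>e. \<exists>z. ?list (override_on e z ?V))"
    by (rule constructible_ex_block[rotated]) (simp add: finite_block)
  \<comment> \<open>Writes given parametrizations into the blocks; the default 0 is never read, as
    \<open>override_on\<close> changes only \<open>Par\<close> variables.\<close>
  have realize: "env_poly d (override_on e (\<lambda>v. case v of Par k i j \<Rightarrow> coeff (x k i) j | _ \<Rightarrow> 0) (\<Union>k\<in>A. block n d k)) k i = x k i"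
    if "d_param n d (x k)" "i < n" "k \<in> A" for e x k i A
    using that(1,2) by (rule env_poly_eqI) (use that in \<open>force simp: override_on_def block_def\<close>)
  have coef: "override_on e z (\<Union>k\<in>A. block n d k) (Coef \<alpha>) = e (Coef \<alpha>)" for e z A \<alpha>
    by (auto simp: override_on_def block_def)
  have other: "env_poly d (override_on e z (block n d K)) k i = env_poly d e k i" if "k < K" for e z k i
    by (rule env_poly_cong) (use that in \<open>auto simp: override_on_def block_def\<close>)
  have "(\<exists>z. ?list (override_on e z ?V)) \<longleftrightarrow> finite (osculants n d (\<lambda>\<alpha>. e (Coef \<alpha>))) \<and>
      card (osculants n d (\<lambda>\<alpha>. e (Coef \<alpha>))) = K" (is "?lhs \<longleftrightarrow> ?rhs") for e
  proof
    let ?O = "osculants n d (\<lambda>\<alpha>. e (Coef \<alpha>))"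
    assume ?lhs
    then obtain z where list: "?list (override_on e z ?V)" by blast
    define e' where "e' = override_on e z ?V"
    have ce: "e' (Coef \<alpha>) = e (Coef \<alpha>)" for \<alpha> unfolding e'_def by (rule coef)
    have osc: "?osc e' k" if "k < K" for k using list that unfolding e'_def by blast
    have inj: "inj_on (?R e') {..<K}"
    proof (rule linorder_inj_onI)
      fix k l assume "k < l" "k \<in> {..<K}" "l \<in> {..<K}"
      then show "?R e' k \<noteq> ?R e' l" using list unfolding e'_def by blast
    qed auto
    have "?O = ?R e' ` {..<K}"
    proof (intro set_eqI iffI)
      fix C assume "C \<in> ?O"
      then obtain x where x: "osculates n d (\<lambda>\<alpha>. e (Coef \<alpha>)) x" "C = range (param n x)"
        unfolding osculants_eq by blast
      then have dp: "d_param n d x" by (simp add: osculates_def)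
      let ?z = "\<lambda>v. case v of Par k i j \<Rightarrow> coeff (x i) j | _ \<Rightarrow> 0"
      let ?e = "override_on e' ?z (block n d K)"
      have eq: "env_poly d ?e K i = x i" if "i < n" for i
        using realize[of "\<lambda>_. x" K i "{K}" e'] dp that by simp
      have "?osc ?e K \<longleftrightarrow> osculates n d (\<lambda>\<alpha>. e (Coef \<alpha>)) x"
        by (rule osculates_cong[OF eq]) (use coef[of e' ?z "{K}"] ce in simp_all)
      moreover have "\<not> ?more e'" using list unfolding e'_def by blast
      ultimately obtain k where k: "k < K" "?R ?e k = ?R ?e K" using x(1) by blast
      have "?R ?e K = C" unfolding x(2) using param_cong[of n, OF eq] by simp
      moreover have "?R ?e k = ?R e' k" using other[OF k(1)] param_cong[of n "env_poly d ?e k" "env_poly d e' k"] by simp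
      ultimately show "C \<in> ?R e' ` {..<K}" using k by blast
    next
      fix C assume "C \<in> ?R e' ` {..<K}"
      then show "C \<in> ?O" using osc unfolding osculants_eq ce by blast
    qed
    then show ?rhs using card_image[OF inj] by simp
  next
    let ?O = "osculants n d (\<lambda>\<alpha>. e (Coef \<alpha>))"
    assume ?rhs
    then obtain h where h: "bij_betw h {..<K} ?O"
      using ex_bij_betw_nat_finite[of ?O] by (auto simp: lessThan_atLeast0)
    have "\<exists>x. osculates n d (\<lambda>\<alpha>. e (Coef \<alpha>)) x \<and> h k = range (param n x)" if "k < K" for k
      using bij_betwE[OF h] that unfolding osculants_eq by blast
    then obtain x where x: "\<And>k. k < K \<Longrightarrow> osculates n d (\<lambda>\<alpha>. e (Coef \<alpha>)) (x k)"
      "\<And>k. k < K \<Longrightarrow> h k = range (param n (x k))" by metis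
    define z where "z = (\<lambda>v. case v of Par k i j \<Rightarrow> coeff (x k i) j | _ \<Rightarrow> 0)"
    define e' where "e' = override_on e z ?V"
    have ce: "e' (Coef \<alpha>) = e (Coef \<alpha>)" for \<alpha> unfolding e'_def by (rule coef)
    have eq: "env_poly d e' k i = x k i" if "k < K" "i < n" for k i
      unfolding e'_def z_def using x(1)[OF that(1)] that by (intro realize) (auto simp: osculates_def)
    have R: "?R e' k = h k" if "k < K" for k
      using param_cong[of n "env_poly d e' k" "x k"] eq[OF that] x(2)[OF that] by simp
    have "?osc e' k" if "k < K" for k
      using osculates_cong[of n "env_poly d e' k" "x k" d "\<lambda>\<alpha>. e' (Coef \<alpha>)" "\<lambda>\<alpha>. e (Coef \<alpha>)"]
        eq[OF that] x(1)[OF that] ce by simp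
    moreover have "?R e' k \<noteq> ?R e' l" if "k < K" "l < k" for k l
    proof
      assume "?R e' k = ?R e' l"
      then have "h k = h l" using R[of k] R[of l] that by simp
      then have "k = l" using inj_onD[OF bij_betw_imp_inj_on[OF h], of k l] that by simp
      with that show False by simp
    qed
    moreover have "\<not> ?more e'"
    proof
      assume "?more e'"
      then obtain y where more: "?osc (override_on e' y (block n d K)) K \<and>
        (\<forall>k\<in>{..<K}. \<not> ?R (override_on e' y (block n d K)) k = ?R (override_on e' y (block n d K)) K)"
        by (rule exE)
      let ?e = "override_on e' y (block n d K)"
      have y: "?osc ?e K" "\<And>k. k < K \<Longrightarrow> ?R ?e k \<noteq> ?R ?e K" using more by auto
      have "(\<lambda>\<alpha>. ?e (Coef \<alpha>)) = (\<lambda>\<alpha>. e (Coef \<alpha>))" using coef[of e' y "{K}"] ce by simp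
      then have "?R ?e K \<in> ?O" using y(1) unfolding osculants_eq by auto
      then have "?R ?e K \<in> h ` {..<K}" by (simp only: bij_betw_imp_surj_on[OF h])
      then obtain k where "?R ?e K = h k" "k \<in> {..<K}" by (rule imageE)
      then have k: "k < K" "h k = ?R ?e K" by simp_all
      have "?R ?e k = ?R e' k" using other[OF k(1)] param_cong[of n "env_poly d ?e k" "env_poly d e' k"] by simp
      then show False using y(2)[OF k(1)] R[OF k(1)] k(2) by simp
    qed
    ultimately have "?list e'" by blast
    then show ?lhs unfolding e'_def by blast
  qed
  with cons show ?thesis by simp
qed

theorem theorem1p1:
  fixes n :: nat and d :: "nat \<Rightarrow> nat"
  assumes "n \<ge> 1" and "\<forall>i<n. d i > 0"
  shows "\<exists>g. poly_fun (mons n (dsum n d)) g \<and> (\<exists>c. g c \<noteq> 0) \<and>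
           (\<forall>c. g c \<noteq> 0 \<longrightarrow>
              finite (osculants n d c) \<and>
              card (osculants n d c) = card (primitive_necklaces n d))"
proof -
  interpret osculation n d by unfold_locales (use assms in auto)
  let ?P = "\<lambda>c. finite (osculants n d c) \<and> card (osculants n d c) = card (primitive_necklaces n d)"
  \<comment> \<open>Coefficients outside \<open>mons n D\<close> do not enter \<open>fcomp\<close>,
    and the parametrization variables are bound in the counting predicate, so setting all of them to
    0 leaves a predicate in the finitely many coefficients that matter.\<close>
  define env where "env c v = (case v of Coef \<alpha> \<Rightarrow> if \<alpha> \<in> mons n D then c \<alpha> else 0 | _ \<Rightarrow> 0)"
    for c :: "(nat \<Rightarrow> nat) \<Rightarrow> complex" and v
  have "constructible (mons n D) (\<lambda>c. ?P (\<lambda>\<alpha>. env c (Coef \<alpha>)))"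
  proof (rule constructible_subst[OF constructible_card_osculants])
    show "polyfun (mons n D) (\<lambda>c. env c v)" for v
    proof (cases v)
      case (Coef \<alpha>)
      then show ?thesis by (cases "\<alpha> \<in> mons n D") (auto simp: env_def intro: polyfun.intros)
    qed (auto simp: env_def intro: polyfun.const)
  qed (use d_pos in auto)
  moreover have "osculants n d (\<lambda>\<alpha>. env c (Coef \<alpha>)) = osculants n d c" for c
  proof -
    have "osculates n d (\<lambda>\<alpha>. env c (Coef \<alpha>)) = osculates n d c"
      by (intro ext osculates_cong) (auto simp: env_def)
    then show ?thesis unfolding osculants_eq by simp
  qed
  ultimately have cons: "constructible (mons n D) ?P" by simp
  obtain \<epsilon> where "\<epsilon> > 0" and ball: "\<And>c. \<forall>\<alpha>\<in>mons n D. cmod (c \<alpha> - model_coeff \<alpha>) < \<epsilon> \<Longrightarrow> ?P c"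
    using near_card_osculants unfolding near_def by blast
  from constructible_generic_if_near[OF cons \<open>\<epsilon> > 0\<close> finite_mons ball]
  have "\<exists>g. polyfun (mons n D) g \<and> (\<exists>c. g c \<noteq> 0) \<and> (\<forall>c. g c \<noteq> 0 \<longrightarrow> ?P c)" .
  then show ?thesis using polyfun_imp_poly_fun finite_mons by blast
qed

end
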